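(* Let $\mathcal V\subset TM$ be a Goursat bundle of derived length $k\geq 2$ and decceleration vector $\tau=\mathrm{deccel}(\mathcal V)=\langle\rho_1,\rho_2,\ldots,\rho_k\rangle$, $\rho_k=1$. Let $x$ be any first integral of $\mathrm{Char}\,\mathcal V^{(k-1)}$ (with $dx\neq 0$), and let $\Pi^k$ be the associated locally defined bundle. Let $\varphi^{1,k}$ be any other first integral of $\Pi^k$ such that $dx\wedge d\varphi^{1,k}\ne0$ on an open set $\mathcal U\subseteq M$, and for each $j$ in the range $1\le j\le k-1$ for which $\rho_j>0$ let $\varphi^{1,j},\ldots,\varphi^{\rho_j,j}$ be the fundamental functions of order $j$ on $\mathcal U$. Then there is an open, dense subset $\widehat{\mathcal U}\subseteq\mathcal U$ upon which is defined a section $Z$ of $\mathcal V$ satisfying $Zx=1$ such that the functions $x$, $\varphi^{l_j,j}_0:=\varphi^{l_j,j}$ together with the functions $$\varphi^{l_j,j}_{s_j+1}=Z\varphi^{l_j,j}_{s_j},\qquad j\in\{1,\ldots,k\}\text{ with }\rho_j>0,\ \ 0\le s_j\le j-1,\ \ 1\le l_j\le\rho_j,$$ are contact coordinates for $\mathcal V$ on $\widehat{\mathcal U}$, identifying it with the partial prolongation $\mathcal C(\tau)$; that is, they are local coordinates in which, on putting $z^{l_j,j}_{s}=\varphi^{l_j,j}_{s}$ ($0\le s\le j$), $\mathcal V$ takes the form $\mathcal C(\tau)$.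
   Context: Everything is smooth ($C^\infty$). $\{X,Y,\ldots\}$ denotes the sub-bundle of $TM$ whose sections are the $C^\infty(M)$-module generated by the listed vector fields. $^\perp$ denotes the annihilator in $T^*M$ of a sub-bundle of $TM$. A first integral of a sub-bundle of $TM$ (equivalently of its annihilator) is a function whose differential lies in the annihilator. **Derived flag and Cauchy bundles.** For $\mathcal V\subset TM$ the structure tensor is $\delta_0:\mathcal V\times\mathcal V\to TM/\mathcal V$, $\delta_0(X,Y)=[X,Y]\bmod\mathcal V$. If it has constant rank, the first derived bundle $\mathcal V^{(1)}$ is the sub-bundle whose sections are generated by sections of $\mathcal V$ and their brackets; iterating gives $\mathcal V=\mathcal V^{(0)}\subset\mathcal V^{(1)}\subset\mathcal V^{(2)}\subset\cdots$. $\mathcal V$ is regular if all the structure tensors of the $\mathcal V^{(i)}$ have constant rank; the derived length is the least $k$ with $\mathcal V^{(k+1)}=\mathcal V^{(k)}$. The Cauchy bundle $\mathrm{Char}\,\mathcal V$ is the bundle (when of constant rank) whose sections are those sections $X$ of $\mathcal V$ with $[X,\Gamma(\mathcal V)]\subseteq\Gamma(\mathcal V)$. $\mathcal V$ is totally regular if it is regular and every $\mathcal V^{(i)}$ has a Cauchy bundle of constant rank. Put $m_i=\dim\mathcal V^{(i)}$, $\chi^i=\dim\mathrm{Char}\,\mathcal V^{(i)}$ (fibre dimensions), and for $1\le j\le k-1$ put $\mathrm{Char}\,\mathcal V^{(j)}_{j-1}=\mathcal V^{(j-1)}\cap\mathrm{Char}\,\mathcal V^{(j)}$ with rank $\chi^j_{j-1}$.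 **Decceleration.** With $\Delta_j=m_j-m_{j-1}$ ($1\le j\le k$) and $\Delta^2_i=\Delta_i-\Delta_{i-1}$ ($2\le i\le k$), $\mathrm{deccel}(\mathcal V)=\langle-\Delta^2_2,-\Delta^2_3,\ldots,-\Delta^2_k,\Delta_k\rangle$. **Partial prolongations.** For a list $\tau=\langle\rho_1,\ldots,\rho_k\rangle$ of non-negative integers with $\rho_k\ge1$, the partial prolongation $\mathcal C(\tau)$ is the distribution $$\mathcal C(\tau)=\Big\{\partial_x+\sum_{j:\rho_j>0}\ \sum_{l_j=1}^{\rho_j}\ \sum_{h=0}^{j-1}z^{l_j,j}_{h+1}\,\partial_{z^{l_j,j}_h},\ \ \partial_{z^{l_j,j}_j}\ (\rho_j>0,\ 1\le l_j\le\rho_j)\Big\}$$ on the space with coordinates $x,\ z^{l_j,j}_h$ ($\rho_j>0$, $1\le l_j\le\rho_j$, $0\le h\le j$). Contact coordinates for $\mathcal V$ are local coordinates on $M$ in which $\mathcal V$ has this form. **Goursat bundles (case $\rho_k=\Delta_k=1$).** A totally regular $\mathcal V\subset TM$ of derived length $k$, with $\mathcal V^{(k)}=TM$ and $\Delta_k=1$, is a Goursat bundle of type $\tau$ if: (i) $\mathcal V$ has the derived type of a partial prolongation of type $\tau=\mathrm{deccel}(\mathcal V)$, i.e. its ranks $m_i,\chi^i$ agree with those of $\mathcal C(\tau)$; (ii) each $\mathrm{Char}\,\mathcal V^{(i)}_{i-1}$, $1\le i\le k-1$, is an integrable sub-bundle of constant rank agreeing with the corresponding rank for $\mathcal C(\tau)$.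 (When $\Delta_k>1$ the general definition has a further condition, which is void here.) **The bundle $\Pi^k$.** Let $x$ be any first integral of $\mathrm{Char}\,\mathcal V^{(k-1)}$ and let $Z$ be any (locally defined) section of $\mathcal V$ with $Zx=1$. The sub-bundle $\Pi^k\subset\mathcal V^{(k-1)}$ is defined inductively by $\Pi^0=\mathrm{Char}\,\mathcal V^{(1)}_0$, $\Pi^{l+1}=[\Pi^l,Z]$, $0\le l\le k-1$, where $[\Pi^l,Z]$ denotes the sub-bundle generated by all brackets $[W,Z]$ with $W$ a section of $\Pi^l$ (it contains $\Pi^l$). The bundle $\Pi^k$ is integrable, has codimension $2$ in $TM$, and has $x$ as a first integral. **Fundamental functions of order $j\le k-1$.** Let $\Xi^{(j)}=(\mathrm{Char}\,\mathcal V^{(j)})^\perp$ and $\Xi^{(j)}_{j-1}=(\mathrm{Char}\,\mathcal V^{(j)}_{j-1})^\perp$, $1\le j\le k-1$; these are integrable, $\Xi^{(j)}\subseteq\Xi^{(j)}_{j-1}$ and $\dim\Xi^{(j)}_{j-1}-\dim\Xi^{(j)}=\rho_j$. For $\rho_j>0$ choose a complement $\Omega_j$ spanned by $1$-forms $\omega_1,\dots,\omega_{\rho_j}$ with $\Xi^{(j)}_{j-1}=\Xi^{(j)}\oplus\Omega_j$; fundamental functions of order $j$ are functions $\varphi^{1,j},\ldots,\varphi^{\rho_j,j}$ with $(d\varphi^{1,j},\ldots,d\varphi^{\rho_j,j})^T\equiv M_j(\omega_1,\ldots,\omega_{\rho_j})^T\bmod\Xi^{(j)}$ for some matrix of functions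 $M_j$ with $\det M_j\ne0$.
   Formalization: The bundle Π^k is taken after k−1 brackets with Z starting from Char V^(1)_0, not k as literally defined: k brackets would give all of ker dx for C(τ) (codimension 1), contradicting the stated codimension 2 and leaving no admissible φ^{1,k}. *)

theory Defs
  imports "HOL-Analysis.Analysis" "Jordan_Normal_Form.Determinant"
begin

section \<open>Smooth manifolds\<close>

text \<open>\<open>higher_diff n S f\<close>: \<open>f\<close> is \<open>n\<close> times continuously differentiable on the (open) set \<open>S\<close>.\<close>

fun higher_diff ::
  "nat \<Rightarrow> 'a::real_normed_vector set \<Rightarrow> ('a \<Rightarrow> 'b::real_normed_vector) \<Rightarrow> bool" where
  "higher_diff 0 S f \<longleftrightarrow> continuous_on S f"
| "higher_diff (Suc n) S f \<longleftrightarrow>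
     (\<forall>x\<in>S. f differentiable (at x)) \<and>
     (\<forall>v. higher_diff n S (\<lambda>x. frechet_derivative f (at x) v))"

definition smooth_on :: "'a::real_normed_vector set \<Rightarrow> ('a \<Rightarrow> 'b::real_normed_vector) \<Rightarrow> bool" where
  "smooth_on S f \<longleftrightarrow> (\<forall>n. higher_diff n S f)"

text \<open>A chart is a pair of its domain and its coordinate map into the model space \<open>'a\<close>,
  so the manifold has dimension \<open>DIM('a)\<close>. Its underlying space is the whole type \<open>'m\<close>.\<close>

type_synonym ('m, 'a) chart = "'m set \<times> ('m \<Rightarrow> 'a)"

definition smooth_manifold ::
  "('m::{t2_space,second_countable_topology}, 'a::euclidean_space) chart set \<Rightarrow> bool" where
  "smooth_manifold A \<longleftrightarrow>
     (\<Union>(D, c)\<in>A. D) = UNIV \<and>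
     (\<forall>(D, c)\<in>A. open D \<and> open (c ` D) \<and> homeomorphism D (c ` D) c (inv_into D c)) \<and>
     (\<forall>(D, c)\<in>A. \<forall>(D', c')\<in>A. smooth_on (c ` (D \<inter> D')) (c' \<circ> inv_into D c))"

definition smooth_fun ::
  "('m::topological_space, 'a::euclidean_space) chart set \<Rightarrow> 'm set
     \<Rightarrow> ('m \<Rightarrow> 'b::real_normed_vector) \<Rightarrow> bool" where
  "smooth_fun A W f \<longleftrightarrow> (\<forall>(D, c)\<in>A. smooth_on (c ` (W \<inter> D)) (f \<circ> inv_into D c))"

text \<open>A tangent vector at \<open>p\<close> is represented by its components with respect to one chart chosen
  once and for all at \<open>p\<close>; thus the tangent space at \<open>p\<close> is a copy of \<open>'a\<close>, and a vector
  field is a map \<open>'m \<Rightarrow> 'a\<close>. Smoothness, Lie brackets and differentials take the dependence of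
  the chosen chart on \<open>p\<close> into account.\<close>

definition chart_at :: "('m, 'a) chart set \<Rightarrow> 'm \<Rightarrow> ('m, 'a) chart" where
  "chart_at A p = (SOME C. C \<in> A \<and> p \<in> fst C)"

text \<open>\<open>dirder A f p v\<close> is the derivative of the (possibly vector-valued) function \<open>f\<close> at \<open>p\<close> along
  the tangent vector \<open>v\<close>, and \<open>differential A f p\<close> is the covector \<open>df\<close> at \<open>p\<close>.\<close>

definition dirder ::
  "('m, 'a::euclidean_space) chart set \<Rightarrow> ('m \<Rightarrow> 'b::real_normed_vector) \<Rightarrow> 'm \<Rightarrow> 'a \<Rightarrow> 'b" where
  "dirder A f p v =
     (case chart_at A p of (D, c) \<Rightarrow> frechet_derivative (f \<circ> inv_into D c) (at (c p)) v)"

definition differential ::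
  "('m, 'a::euclidean_space) chart set \<Rightarrow> ('m \<Rightarrow> real) \<Rightarrow> 'm \<Rightarrow> ('a \<Rightarrow>\<^sub>L real)" where
  "differential A f p = Blinfun (dirder A f p)"

definition smooth_field ::
  "('m::topological_space, 'a::euclidean_space) chart set \<Rightarrow> 'm set \<Rightarrow> ('m \<Rightarrow> 'a) \<Rightarrow> bool" where
  "smooth_field A W X \<longleftrightarrow> (\<forall>(D, c)\<in>A. smooth_fun A (W \<inter> D) (\<lambda>q. dirder A c q (X q)))"

definition smooth_form ::
  "('m::topological_space, 'a::euclidean_space) chart set \<Rightarrow> 'm set
     \<Rightarrow> ('m \<Rightarrow> ('a \<Rightarrow>\<^sub>L real)) \<Rightarrow> bool" where
  "smooth_form A W \<omega> \<longleftrightarrow>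
     (\<forall>W' X. open W' \<longrightarrow> W' \<subseteq> W \<longrightarrow> smooth_field A W' X \<longrightarrow>
        smooth_fun A W' (\<lambda>q. blinfun_apply (\<omega> q) (X q)))"

definition lie_derivative ::
  "('m, 'a::euclidean_space) chart set \<Rightarrow> ('m \<Rightarrow> 'a) \<Rightarrow> ('m \<Rightarrow> real) \<Rightarrow> 'm \<Rightarrow> real" where
  "lie_derivative A X f = (\<lambda>p. dirder A f p (X p))"

text \<open>With \<open>c\<close> the chart chosen at \<open>p\<close>, the components of \<open>[X, Y]\<close> at \<open>p\<close> are those of
  \<open>X (Y c) - Y (X c)\<close>.\<close>

definition lie_bracket ::
  "('m, 'a::euclidean_space) chart set \<Rightarrow> ('m \<Rightarrow> 'a) \<Rightarrow> ('m \<Rightarrow> 'a) \<Rightarrow> 'm \<Rightarrow> 'a" where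
  "lie_bracket A X Y p =
     (let c = snd (chart_at A p) in
        dirder A (\<lambda>q. dirder A c q (Y q)) p (X p) - dirder A (\<lambda>q. dirder A c q (X q)) p (Y p))"


section \<open>Sub-bundles of the tangent bundle\<close>

text \<open>A family of subspaces of the tangent spaces is a map \<open>'m \<Rightarrow> 'a set\<close>. Sections are local
  sections, over arbitrary open sets.\<close>

definition smooth_section ::
  "('m::topological_space, 'a::euclidean_space) chart set \<Rightarrow> ('m \<Rightarrow> 'a set) \<Rightarrow> 'm set
     \<Rightarrow> ('m \<Rightarrow> 'a) \<Rightarrow> bool" where
  "smooth_section A V W X \<longleftrightarrow> smooth_field A W X \<and> (\<forall>q\<in>W. X q \<in> V q)"

definition constant_rank :: "('m \<Rightarrow> 'a::euclidean_space set) \<Rightarrow> bool" where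
  "constant_rank V \<longleftrightarrow> (\<exists>r. \<forall>p. dim (V p) = r)"

definition bundle_rank :: "('m \<Rightarrow> 'a::euclidean_space set) \<Rightarrow> nat" where
  "bundle_rank V = (THE r. \<forall>p. dim (V p) = r)"

definition subbundle ::
  "('m::topological_space, 'a::euclidean_space) chart set \<Rightarrow> ('m \<Rightarrow> 'a set) \<Rightarrow> bool" where
  "subbundle A V \<longleftrightarrow>
     (\<exists>r. \<forall>p. subspace (V p) \<and> dim (V p) = r \<and>
        (\<exists>W X. open W \<and> p \<in> W \<and> (\<forall>i<r. smooth_field A W (X i)) \<and>
               (\<forall>q\<in>W. V q = span ((\<lambda>i. X i q) ` {..<r}))))"

text \<open>Integrability is the Frobenius condition.\<close>

definition integrable_bundle ::
  "('m::topological_space, 'a::euclidean_space) chart set \<Rightarrow> ('m \<Rightarrow> 'a set) \<Rightarrow> bool" where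
  "integrable_bundle A V \<longleftrightarrow>
     (\<forall>W X Y. open W \<longrightarrow> smooth_section A V W X \<longrightarrow> smooth_section A V W Y \<longrightarrow>
        (\<forall>q\<in>W. lie_bracket A X Y q \<in> V q))"

definition annihilator :: "('m \<Rightarrow> 'a::euclidean_space set) \<Rightarrow> 'm \<Rightarrow> ('a \<Rightarrow>\<^sub>L real) set" where
  "annihilator V p = {\<alpha>. \<forall>v\<in>V p. blinfun_apply \<alpha> v = 0}"

definition first_integral ::
  "('m::topological_space, 'a::euclidean_space) chart set \<Rightarrow> 'm set \<Rightarrow> ('m \<Rightarrow> 'a set)
     \<Rightarrow> ('m \<Rightarrow> real) \<Rightarrow> bool" where
  "first_integral A W V f \<longleftrightarrow>
     smooth_fun A W f \<and> (\<forall>p\<in>W. differential A f p \<in> annihilator V p)"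


section \<open>Derived flag, Cauchy bundles, decceleration\<close>

definition brackets ::
  "('m::topological_space, 'a::euclidean_space) chart set \<Rightarrow> ('m \<Rightarrow> 'a set) \<Rightarrow> 'm \<Rightarrow> 'a set" where
  "brackets A V p = {lie_bracket A X Y p | X Y W.
     open W \<and> p \<in> W \<and> smooth_section A V W X \<and> smooth_section A V W Y}"

text \<open>The rank at \<open>p\<close> of the structure tensor \<open>(X, Y) \<mapsto> [X, Y] mod V\<close>: the dimension of the image,
  in the quotient by \<open>V p\<close>, of the span of the brackets.\<close>

definition structure_tensor_rank ::
  "('m::topological_space, 'a::euclidean_space) chart set \<Rightarrow> ('m \<Rightarrow> 'a set) \<Rightarrow> 'm \<Rightarrow> nat" where
  "structure_tensor_rank A V p = dim (V p \<union> brackets A V p) - dim (V p)"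

definition derived_bundle ::
  "('m::topological_space, 'a::euclidean_space) chart set \<Rightarrow> ('m \<Rightarrow> 'a set) \<Rightarrow> 'm \<Rightarrow> 'a set" where
  "derived_bundle A V p = span (V p \<union> brackets A V p)"

definition derived_flag ::
  "('m::topological_space, 'a::euclidean_space) chart set \<Rightarrow> ('m \<Rightarrow> 'a set) \<Rightarrow> nat \<Rightarrow> 'm \<Rightarrow> 'a set"
  where
  "derived_flag A V i = (derived_bundle A ^^ i) V"

definition derived_length ::
  "('m::topological_space, 'a::euclidean_space) chart set \<Rightarrow> ('m \<Rightarrow> 'a set) \<Rightarrow> nat" where
  "derived_length A V = (LEAST k. derived_flag A V (Suc k) = derived_flag A V k)"

text \<open>The fibre at \<open>p\<close> consists of the values at \<open>p\<close> of the Cauchy vector fields of \<open>V\<close> defined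
  near \<open>p\<close>; when its dimension is constant, these fields are exactly its sections.\<close>

definition cauchy_bundle ::
  "('m::topological_space, 'a::euclidean_space) chart set \<Rightarrow> ('m \<Rightarrow> 'a set) \<Rightarrow> 'm \<Rightarrow> 'a set" where
  "cauchy_bundle A V p = {X p | X W. open W \<and> p \<in> W \<and> smooth_section A V W X \<and>
     (\<forall>W' Y. open W' \<longrightarrow> W' \<subseteq> W \<longrightarrow> smooth_section A V W' Y \<longrightarrow>
        (\<forall>q\<in>W'. lie_bracket A X Y q \<in> V q))}"

definition char_bundle ::
  "('m::topological_space, 'a::euclidean_space) chart set \<Rightarrow> ('m \<Rightarrow> 'a set) \<Rightarrow> nat \<Rightarrow> 'm \<Rightarrow> 'a set"
  where
  "char_bundle A V j = cauchy_bundle A (derived_flag A V j)"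

definition char_bundle_int ::
  "('m::topological_space, 'a::euclidean_space) chart set \<Rightarrow> ('m \<Rightarrow> 'a set) \<Rightarrow> nat \<Rightarrow> 'm \<Rightarrow> 'a set"
  where
  "char_bundle_int A V j p = derived_flag A V (j - 1) p \<inter> char_bundle A V j p"

definition regular_bundle ::
  "('m::topological_space, 'a::euclidean_space) chart set \<Rightarrow> ('m \<Rightarrow> 'a set) \<Rightarrow> bool" where
  "regular_bundle A V \<longleftrightarrow>
     subbundle A V \<and> (\<forall>i. \<exists>r. \<forall>p. structure_tensor_rank A (derived_flag A V i) p = r)"

definition totally_regular ::
  "('m::topological_space, 'a::euclidean_space) chart set \<Rightarrow> ('m \<Rightarrow> 'a set) \<Rightarrow> bool" where
  "totally_regular A V \<longleftrightarrow> regular_bundle A V \<and> (\<forall>i. constant_rank (char_bundle A V i))"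

definition flag_rank ::
  "('m::topological_space, 'a::euclidean_space) chart set \<Rightarrow> ('m \<Rightarrow> 'a set) \<Rightarrow> nat \<Rightarrow> nat" where
  "flag_rank A V i = bundle_rank (derived_flag A V i)"

definition Delta ::
  "('m::topological_space, 'a::euclidean_space) chart set \<Rightarrow> ('m \<Rightarrow> 'a set) \<Rightarrow> nat \<Rightarrow> int" where
  "Delta A V j = int (flag_rank A V j) - int (flag_rank A V (j - 1))"

definition Delta2 ::
  "('m::topological_space, 'a::euclidean_space) chart set \<Rightarrow> ('m \<Rightarrow> 'a set) \<Rightarrow> nat \<Rightarrow> int" where
  "Delta2 A V i = Delta A V i - Delta A V (i - 1)"

definition deccel ::
  "('m::topological_space, 'a::euclidean_space) chart set \<Rightarrow> ('m \<Rightarrow> 'a set) \<Rightarrow> int list" where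
  "deccel A V = (let k = derived_length A V in
     map (\<lambda>i. - Delta2 A V i) [2..<Suc k] @ [Delta A V k])"


section \<open>Local coordinates and partial prolongations\<close>

text \<open>\<open>CX\<close> labels the coordinate \<open>x\<close>, and \<open>CZ l j h\<close> the coordinate \<open>z\<^sup>l\<^sup>,\<^sup>j\<^sub>h\<close>.\<close>

datatype pp_coord = CX | CZ nat nat nat

definition rho :: "nat list \<Rightarrow> nat \<Rightarrow> nat" where
  "rho \<tau> j = \<tau> ! (j - 1)"

definition pp_coords :: "nat list \<Rightarrow> pp_coord set" where
  "pp_coords \<tau> = insert CX
     {CZ l j h | l j h. 1 \<le> j \<and> j \<le> length \<tau> \<and> 1 \<le> l \<and> l \<le> rho \<tau> j \<and> h \<le> j}"

definition is_chart ::
  "('m::topological_space, 'a::euclidean_space) chart set \<Rightarrow> 'm set \<Rightarrow> ('m \<Rightarrow> 'a) \<Rightarrow> bool" where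
  "is_chart A W \<psi> \<longleftrightarrow> open W \<and> open (\<psi> ` W) \<and> inj_on \<psi> W \<and> smooth_fun A W \<psi> \<and>
     (\<forall>(D, c)\<in>A. smooth_on (\<psi> ` (W \<inter> D)) (c \<circ> inv_into W \<psi>))"

text \<open>The functions \<open>f i\<close>, \<open>i \<in> I\<close>, are the components of a chart on \<open>W\<close>; in particular
  \<open>I\<close> has exactly \<open>DIM('a)\<close> elements.\<close>

definition local_coordinates ::
  "('m::topological_space, 'a::euclidean_space) chart set \<Rightarrow> 'm set \<Rightarrow> 'i set
     \<Rightarrow> ('i \<Rightarrow> 'm \<Rightarrow> real) \<Rightarrow> bool" where
  "local_coordinates A W I f \<longleftrightarrow>
     (\<exists>e. bij_betw e I (Basis :: 'a set) \<and> is_chart A W (\<lambda>p. \<Sum>i\<in>I. f i p *\<^sub>R e i))"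

text \<open>The coordinate vector field \<open>\<partial>\<^sub>i\<close> of the local coordinates \<open>f\<close>.\<close>

definition coord_field ::
  "('m, 'a::euclidean_space) chart set \<Rightarrow> 'i set \<Rightarrow> ('i \<Rightarrow> 'm \<Rightarrow> real) \<Rightarrow> 'i \<Rightarrow> 'm \<Rightarrow> 'a" where
  "coord_field A I f i p =
     (THE v. \<forall>j\<in>I. dirder A (f j) p v = (if j = i then 1 else 0))"

text \<open>The distribution \<open>C(\<tau>)\<close> written in the local coordinates \<open>f\<close>.\<close>

definition partial_prolongation ::
  "('m, 'a::euclidean_space) chart set \<Rightarrow> nat list \<Rightarrow> (pp_coord \<Rightarrow> 'm \<Rightarrow> real) \<Rightarrow> 'm \<Rightarrow> 'a set"
  where
  "partial_prolongation A \<tau> f p =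
     (let d = (\<lambda>i. coord_field A (pp_coords \<tau>) f i p) in
      span (insert
        (d CX + (\<Sum>j=1..length \<tau>. \<Sum>l=1..rho \<tau> j. \<Sum>h<j. f (CZ l j (Suc h)) p *\<^sub>R d (CZ l j h)))
        {d (CZ l j j) | l j. 1 \<le> j \<and> j \<le> length \<tau> \<and> 1 \<le> l \<and> l \<le> rho \<tau> j}))"

definition contact_coordinates ::
  "('m::topological_space, 'a::euclidean_space) chart set \<Rightarrow> ('m \<Rightarrow> 'a set) \<Rightarrow> nat list \<Rightarrow> 'm set
     \<Rightarrow> (pp_coord \<Rightarrow> 'm \<Rightarrow> real) \<Rightarrow> bool" where
  "contact_coordinates A V \<tau> U f \<longleftrightarrow>
     (\<forall>p\<in>U. \<exists>W. open W \<and> p \<in> W \<and> W \<subseteq> U \<and> local_coordinates A W (pp_coords \<tau>) f \<and>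
        (\<forall>q\<in>W. V q = partial_prolongation A \<tau> f q))"

text \<open>The standard \<open>C(\<tau>)\<close>, on the space \<open>'a\<close> whose linear coordinates are labelled through a
  bijection \<open>e\<close> of the coordinates of \<open>C(\<tau>)\<close> with the standard basis.\<close>

abbreviation euclidean_atlas :: "('a::euclidean_space, 'a) chart set" where
  "euclidean_atlas \<equiv> {(UNIV, id)}"

definition standard_pp :: "nat list \<Rightarrow> (pp_coord \<Rightarrow> 'a::euclidean_space) \<Rightarrow> 'a \<Rightarrow> 'a set" where
  "standard_pp \<tau> e = partial_prolongation euclidean_atlas \<tau> (\<lambda>i y. y \<bullet> e i)"


section \<open>Goursat bundles\<close>

text \<open>The case in which the last entry of the decceleration vector is \<open>1\<close>. The ranks for \<open>i = k\<close>
  force the space carrying \<open>C(\<tau>)\<close> to have the same dimension as the manifold, so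
  that nothing is lost in modelling it on \<open>'a\<close>.\<close>

definition goursat_bundle ::
  "('m::topological_space, 'a::euclidean_space) chart set \<Rightarrow> ('m \<Rightarrow> 'a set) \<Rightarrow> nat list \<Rightarrow> bool"
  where
  "goursat_bundle A V \<tau> \<longleftrightarrow>
     (let k = derived_length A V in
      totally_regular A V \<and> derived_flag A V k = (\<lambda>_. UNIV) \<and> Delta A V k = 1 \<and>
      map int \<tau> = deccel A V \<and>
      (\<exists>e. bij_betw e (pp_coords \<tau>) (Basis :: 'a set) \<and>
        (let E = euclidean_atlas; C = standard_pp \<tau> e in
         (\<forall>i\<le>k. flag_rank A V i = flag_rank E C i \<and>
                bundle_rank (char_bundle A V i) = bundle_rank (char_bundle E C i)) \<and>
         (\<forall>i\<in>{1..k-1}. subbundle A (char_bundle_int A V i) \<and>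
                integrable_bundle A (char_bundle_int A V i) \<and>
                bundle_rank (char_bundle_int A V i) = bundle_rank (char_bundle_int E C i)))))"


section \<open>The bundle \<open>\<Pi>\<^sup>k\<close> and the fundamental functions\<close>

text \<open>\<open>bracket_with A P Z\<close> is generated by the brackets \<open>[X, Z]\<close>, \<open>X\<close> a section of \<open>P\<close>.\<close>

definition bracket_with ::
  "('m::topological_space, 'a::euclidean_space) chart set \<Rightarrow> ('m \<Rightarrow> 'a) \<Rightarrow> ('m \<Rightarrow> 'a set)
     \<Rightarrow> 'm \<Rightarrow> 'a set" where
  "bracket_with A Z P p =
     span {lie_bracket A X Z p | X W. open W \<and> p \<in> W \<and> smooth_section A P W X}"

definition pi_iter ::
  "('m::topological_space, 'a::euclidean_space) chart set \<Rightarrow> ('m \<Rightarrow> 'a set) \<Rightarrow> ('m \<Rightarrow> 'a) \<Rightarrow> nat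
     \<Rightarrow> 'm \<Rightarrow> 'a set" where
  "pi_iter A V Z l = (bracket_with A Z ^^ l) (char_bundle_int A V 1)"

definition unit_section ::
  "('m::topological_space, 'a::euclidean_space) chart set \<Rightarrow> ('m \<Rightarrow> 'a set) \<Rightarrow> ('m \<Rightarrow> real)
     \<Rightarrow> 'm set \<Rightarrow> ('m \<Rightarrow> 'a) \<Rightarrow> bool" where
  "unit_section A V x W Z \<longleftrightarrow>
     smooth_section A V W Z \<and> (\<forall>q\<in>W. lie_derivative A Z x q = 1)"

text \<open>The points near which there is a local section \<open>Z\<close> of \<open>V\<close> with \<open>Z x = 1\<close>, that is, the domain
  of definition of \<open>\<Pi>\<^sup>k\<close>.\<close>

definition transversal_locus ::
  "('m::topological_space, 'a::euclidean_space) chart set \<Rightarrow> ('m \<Rightarrow> 'a set) \<Rightarrow> ('m \<Rightarrow> real)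
     \<Rightarrow> 'm set \<Rightarrow> 'm set" where
  "transversal_locus A V x U = {p\<in>U. \<exists>W Z. open W \<and> p \<in> W \<and> W \<subseteq> U \<and> unit_section A V x W Z}"

text \<open>\<open>\<Pi>\<^sup>k\<close> is the bundle of codimension \<open>2\<close> inside \<open>V\<^sup>(\<^sup>k\<^sup>-\<^sup>1\<^sup>)\<close>. Starting from
  \<open>Char V\<^sup>(\<^sup>1\<^sup>)\<^sub>0\<close> it is reached after \<open>k - 1\<close> brackets with \<open>Z\<close>; for \<open>V = C(\<tau>)\<close> with \<open>x\<close> its first
  coordinate, one more bracket would give the whole kernel of \<open>dx\<close>, which has codimension \<open>1\<close> and
  no first integral independent of \<open>x\<close>.\<close>

definition is_Pi_bundle ::
  "('m::topological_space, 'a::euclidean_space) chart set \<Rightarrow> ('m \<Rightarrow> 'a set) \<Rightarrow> nat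
     \<Rightarrow> ('m \<Rightarrow> real) \<Rightarrow> 'm set \<Rightarrow> ('m \<Rightarrow> 'a set) \<Rightarrow> bool" where
  "is_Pi_bundle A V k x U P \<longleftrightarrow>
     (\<forall>p\<in>transversal_locus A V x U. \<exists>W Z. open W \<and> p \<in> W \<and> W \<subseteq> U \<and> unit_section A V x W Z \<and>
        (\<forall>q\<in>W. P q = pi_iter A V Z (k - 1) q))"

definition wedge_nonzero :: "('a::euclidean_space \<Rightarrow>\<^sub>L real) \<Rightarrow> ('a \<Rightarrow>\<^sub>L real) \<Rightarrow> bool" where
  "wedge_nonzero \<alpha> \<beta> \<longleftrightarrow>
     (\<exists>u v. blinfun_apply \<alpha> u * blinfun_apply \<beta> v - blinfun_apply \<alpha> v * blinfun_apply \<beta> u \<noteq> 0)"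

text \<open>\<open>r\<close> is \<open>\<rho>\<^sub>j\<close>. The matrix \<open>M\<close> is indexed from \<open>0\<close>, the functions and forms from \<open>1\<close>.\<close>

definition fundamental_functions ::
  "('m::topological_space, 'a::euclidean_space) chart set \<Rightarrow> ('m \<Rightarrow> 'a set) \<Rightarrow> nat \<Rightarrow> nat
     \<Rightarrow> 'm set \<Rightarrow> (nat \<Rightarrow> 'm \<Rightarrow> real) \<Rightarrow> bool" where
  "fundamental_functions A V j r U \<phi> \<longleftrightarrow>
     (let \<Xi> = annihilator (char_bundle A V j); \<Xi>' = annihilator (char_bundle_int A V j) in
      (\<forall>l\<in>{1..r}. smooth_fun A U (\<phi> l)) \<and>
      (\<exists>\<omega> M.
        (\<forall>l\<in>{1..r}. smooth_form A U (\<omega> l)) \<and>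
        (\<forall>p\<in>U. let \<Omega> = span ((\<lambda>l. \<omega> l p) ` {1..r}) in
            \<Xi>' p = {\<alpha> + \<beta> | \<alpha> \<beta>. \<alpha> \<in> \<Xi> p \<and> \<beta> \<in> \<Omega>} \<and> \<Xi> p \<inter> \<Omega> = {0} \<and> dim \<Omega> = r) \<and>
        (\<forall>a<r. \<forall>b<r. smooth_fun A U (\<lambda>p. M p $$ (a, b))) \<and>
        (\<forall>p\<in>U. M p \<in> carrier_mat r r \<and> Determinant.det (M p :: real mat) \<noteq> 0 \<and>
            (\<forall>l\<in>{1..r}. differential A (\<phi> l) p
                - (\<Sum>m=1..r. (M p $$ (l - 1, m - 1)) *\<^sub>R \<omega> m p) \<in> \<Xi> p))))"

text \<open>The functions \<open>x\<close> and \<open>\<phi>\<^sup>l\<^sup>,\<^sup>j\<^sub>s\<close>, where \<open>\<phi>\<^sup>l\<^sup>,\<^sup>j\<^sub>0 = \<phi>\<^sup>l\<^sup>,\<^sup>j\<close> and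
  \<open>\<phi>\<^sup>l\<^sup>,\<^sup>j\<^sub>s\<^sub>+\<^sub>1 = Z \<phi>\<^sup>l\<^sup>,\<^sup>j\<^sub>s\<close>.\<close>

definition prolonged_functions ::
  "('m, 'a::euclidean_space) chart set \<Rightarrow> ('m \<Rightarrow> 'a) \<Rightarrow> ('m \<Rightarrow> real)
     \<Rightarrow> (nat \<Rightarrow> nat \<Rightarrow> 'm \<Rightarrow> real) \<Rightarrow> pp_coord \<Rightarrow> 'm \<Rightarrow> real" where
  "prolonged_functions A Z x \<phi> i =
     (case i of CX \<Rightarrow> x | CZ l j s \<Rightarrow> (lie_derivative A Z ^^ s) (\<phi> l j))"

end

theory Submission
  imports Defs
begin

text \<open>
  Write \<open>V\<^sup>(\<^sup>a\<^sup>)\<close> for the derived flag and \<open>H\<^sub>a\<close> for the kernel of \<open>dx\<close> on \<open>V\<^sup>(\<^sup>a\<^sup>)\<close>. If \<open>dx\<close> vanished on \<open>V\<close>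
  over an open set, it would vanish on all iterated brackets, hence on the whole tangent space; so
  sections \<open>Z\<close> of \<open>V\<close> with \<open>Zx = 1\<close> exist near a dense set of points, and a maximal disjoint
  family of their domains gives one such section on an open dense set (\<open>dense_unit_section\<close>). Any
  section of this kind works.

  Along \<open>Z\<close> one has \<open>V\<^sup>(\<^sup>a\<^sup>) = H\<^sub>a \<oplus> \<langle>Z\<rangle>\<close>. A Cauchy field of \<open>V\<^sup>(\<^sup>a\<^sup>)\<close> is one of all later \<open>V\<^sup>(\<^sup>b\<^sup>)\<close>
  (\<open>cauchy_field_derived\<close>), so \<open>dx\<close> vanishes on \<open>Char V\<^sup>(\<^sup>a\<^sup>)\<close> for \<open>a < k\<close>; comparison of ranks with
  the model then gives \<open>Char V\<^sup>(\<^sup>a\<^sup>+\<^sup>1\<^sup>)\<^sub>a = H\<^sub>a\<close> for \<open>a + 1 < k\<close> (\<open>char_int_eq_H\<close>). In particular \<open>H\<^sub>a\<close> is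
  integrable for \<open>a \<le> k - 2\<close>, so that \<open>H\<^sub>a\<^sub>+\<^sub>1\<close> is generated by \<open>[H\<^sub>a, Z]\<close> and \<open>H\<^sub>k\<^sub>-\<^sub>1\<close> lies in
  \<open>\<Pi>\<^sup>k\<close> (\<open>H_in_pi_iter\<close>). The differential of a fundamental function of order \<open>j\<close> annihilates
  \<open>Char V\<^sup>(\<^sup>j\<^sup>)\<^sub>j\<^sub>-\<^sub>1\<close>. Thus every \<open>\<phi>\<^sup>l\<^sup>,\<^sup>j\<close>, \<open>1 \<le> j \<le> k\<close>, is a first integral of \<open>H\<^sub>j\<^sub>-\<^sub>1\<close>.

  As \<open>[H\<^sub>a, Z]\<close> lies in \<open>H\<^sub>a\<^sub>+\<^sub>1\<close>, the derivative along \<open>Z\<close> of a first integral of \<open>H\<^sub>a\<^sub>+\<^sub>1\<close> is a first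
  integral of \<open>H\<^sub>a\<close> (\<open>first_integral_descends\<close>). So \<open>\<phi>\<^sup>l\<^sup>,\<^sup>j\<^sub>s\<close> is a first integral of \<open>H\<^sub>j\<^sub>-\<^sub>1\<^sub>-\<^sub>s\<close>, and
  the contact forms \<open>d\<phi>\<^sub>s - \<phi>\<^sub>s\<^sub>+\<^sub>1 dx\<close>, \<open>s < j\<close>, vanish on \<open>V\<close>: on \<open>H\<^sub>0\<close> both terms are zero, and
  on \<open>Z\<close> they cancel.

  It remains to see that the differentials are independent; then the contact forms cut out exactly
  \<open>V\<close>, by dimension, and the inverse function theorem yields charts. By descending induction on \<open>a\<close>,
  the differentials of \<open>x\<close> and of the \<open>\<phi>\<^sup>l\<^sup>,\<^sup>j\<^sub>s\<close> with \<open>s + a < j\<close> are independent (\<open>pp_level\<close>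
  collects these indices). For \<open>a = k - 1\<close> this is the hypothesis on \<open>dx \<and> d\<phi>\<^sup>1\<^sup>,\<^sup>k\<close>. From \<open>a \<ge> 1\<close>
  to \<open>a - 1\<close> two kinds of functions are added. The first are the derivatives along \<open>Z\<close> of the last
  functions present. Their independence (\<open>independent_prolong\<close>) comes from the rank of \<open>V\<^sup>(\<^sup>a\<^sup>+\<^sup>1\<^sup>)\<close>
  and the structure equation \<open>d(df - g dx) = - dg \<and> dx\<close>: a relation among them modulo the earlier
  ones would make some contact form vanish on too large a bundle. The second are the fundamental
  functions of order \<open>a\<close>; the differentials already present lie in \<open>(Char V\<^sup>(\<^sup>a\<^sup>))\<^sup>\<bottom>\<close>, and the new
  ones are independent modulo that space (\<open>independent_fundamental\<close>). For \<open>a = 0\<close> one more step of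
  the first kind gives all coordinates.

  The ranks of \<open>C(\<tau>)\<close> which enter are computed in the locale \<open>pp_model\<close>.
\<close>

text \<open>The infix dot is the inner product of Euclidean space; the scalar product of vectors that goes
  with matrices shares the symbol.\<close>

no_notation scalar_prod (infix "\<bullet>" 70)

section \<open>Calculus of smooth maps\<close>

lemma higher_diff_subset: "higher_diff n S f \<Longrightarrow> T \<subseteq> S \<Longrightarrow> higher_diff n T f"
proof (induction n arbitrary: f)
  case 0 then show ?case by (auto intro: continuous_on_subset)
next
  case (Suc n) then show ?case by auto
qed

lemma higher_diff_cong:
  assumes "open S" "\<And>x. x \<in> S \<Longrightarrow> f x = g x" "higher_diff n S f"
  shows "higher_diff n S g"
  using assms
proof (induction n arbitrary: f g)
  case 0 then show ?case using continuous_on_eq[of S f g] by simp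
next
  case (Suc n)
  have fd: "(f has_derivative frechet_derivative f (at x)) (at x)" if "x \<in> S" for x
    using Suc.prems(3) that by (simp add: frechet_derivative_works[symmetric])
  have gd: "(g has_derivative frechet_derivative f (at x)) (at x)" if "x \<in> S" for x
    by (rule has_derivative_transform_within_open[OF fd[OF that] Suc.prems(1) that]) (rule Suc.prems(2))
  have eq: "frechet_derivative f (at x) = frechet_derivative g (at x)" if "x \<in> S" for x
    by (rule frechet_derivative_at[OF gd[OF that]])
  have "higher_diff n S (\<lambda>x. frechet_derivative g (at x) v)" for v
  proof (rule Suc.IH)
    show "higher_diff n S (\<lambda>x. frechet_derivative f (at x) v)" using Suc.prems(3) by simp
  qed (use Suc.prems(1) eq in auto)
  moreover have "g differentiable (at x)" if "x \<in> S" for x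
    using gd[OF that] by (rule differentiableI)
  ultimately show ?case by simp
qed

lemma higher_diff_Suc_D: "higher_diff (Suc n) S f \<Longrightarrow> higher_diff n S f"
proof (induction n arbitrary: f)
  case 0
  then show ?case
    by (auto intro!: differentiable_imp_continuous_on simp: differentiable_on_def
        differentiable_at_withinI)
next
  case (Suc n)
  then show ?case by (metis higher_diff.simps(2))
qed

lemma higher_diff_continuous: "higher_diff n S f \<Longrightarrow> continuous_on S f"
  by (induction n) (use higher_diff_Suc_D in auto)

lemma higher_diff_local:
  assumes "\<And>x. x \<in> S \<Longrightarrow> \<exists>T. open T \<and> x \<in> T \<and> higher_diff n T f"
  shows "higher_diff n S f"
  using assms
proof (induction n arbitrary: f)
  case 0
  have "continuous_on (\<Union>{T. open T \<and> continuous_on T f}) f"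
    by (rule continuous_on_open_Union) auto
  moreover have "S \<subseteq> \<Union>{T. open T \<and> continuous_on T f}"
    using 0 by auto
  ultimately show ?case by (auto intro: continuous_on_subset)
next
  case (Suc n)
  have "higher_diff n S (\<lambda>x. frechet_derivative f (at x) v)" for v
    by (rule Suc.IH) (use Suc.prems in fastforce)
  then show ?case using Suc.prems by fastforce
qed

lemma higher_diff_SucI:
  assumes "open S" "\<And>x. x \<in> S \<Longrightarrow> (f has_derivative f' x) (at x)"
    and "\<And>v. higher_diff n S (\<lambda>x. f' x v)"
  shows "higher_diff (Suc n) S f"
proof -
  have eq: "f' x = frechet_derivative f (at x)" if "x \<in> S" for x
    by (rule frechet_derivative_at[OF assms(2)[OF that]])
  have "higher_diff n S (\<lambda>x. frechet_derivative f (at x) v)" for v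
    by (rule higher_diff_cong[OF assms(1) _ assms(3)[of v]]) (simp add: eq)
  moreover have "f differentiable (at x)" if "x \<in> S" for x
    using assms(2)[OF that] by (rule differentiableI)
  ultimately show ?thesis by simp
qed

lemma higher_diff_SucD:
  assumes "higher_diff (Suc n) S f" "x \<in> S"
  shows "(f has_derivative frechet_derivative f (at x)) (at x)"
  using assms by (simp add: frechet_derivative_works[symmetric])

lemma higher_diff_const: "open S \<Longrightarrow> higher_diff n S (\<lambda>_. c)"
proof (induction n arbitrary: c)
  case (Suc n)
  show ?case by (rule higher_diff_SucI[of S _ "\<lambda>_ _. 0"]) (use Suc in auto)
qed simp

lemma higher_diff_bounded_linear_comp:
  assumes "open S" "bounded_linear L" "higher_diff n S f"
  shows "higher_diff n S (\<lambda>x. L (f x))"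
  using assms(3)
proof (induction n arbitrary: f)
  case 0 then show ?case using assms(2) by (simp add: bounded_linear.continuous_on)
next
  case (Suc n)
  show ?case
  proof (rule higher_diff_SucI[OF assms(1)])
    show "((\<lambda>x. L (f x)) has_derivative (\<lambda>v. L (frechet_derivative f (at x) v))) (at x)" if "x \<in> S" for x
      by (rule bounded_linear.has_derivative[OF assms(2) higher_diff_SucD[OF Suc.prems that]])
    show "higher_diff n S (\<lambda>x. L (frechet_derivative f (at x) v))" for v
      by (rule Suc.IH) (use Suc.prems in simp)
  qed
qed

lemma higher_diff_id: "open S \<Longrightarrow> higher_diff n S (\<lambda>x. x)"
proof (cases n)
  case (Suc m)
  assume "open S"
  then show ?thesis unfolding Suc
    by (intro higher_diff_SucI[of S _ "\<lambda>_ v. v"] higher_diff_const) auto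
qed simp

lemma higher_diff_add:
  assumes "open S" "higher_diff n S f" "higher_diff n S g"
  shows "higher_diff n S (\<lambda>x. f x + g x)"
  using assms(2,3)
proof (induction n arbitrary: f g)
  case 0 then show ?case by (simp add: continuous_on_add)
next
  case (Suc n)
  show ?case
  proof (rule higher_diff_SucI[OF assms(1)])
    show "((\<lambda>x. f x + g x) has_derivative
       (\<lambda>v. frechet_derivative f (at x) v + frechet_derivative g (at x) v)) (at x)" if "x \<in> S" for x
      using higher_diff_SucD[OF Suc.prems(1) that] higher_diff_SucD[OF Suc.prems(2) that]
      by (rule has_derivative_add)
  qed (use Suc in auto)
qed

lemma higher_diff_scaleR:
  fixes f :: "_ \<Rightarrow> real"
  assumes "open S" "higher_diff n S f" "higher_diff n S g"
  shows "higher_diff n S (\<lambda>x. f x *\<^sub>R g x)"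
  using assms(2,3)
proof (induction n arbitrary: f g)
  case 0 then show ?case by (simp add: continuous_on_scaleR)
next
  case (Suc n)
  show ?case
  proof (rule higher_diff_SucI[OF assms(1)])
    show "((\<lambda>x. f x *\<^sub>R g x) has_derivative
       (\<lambda>v. f x *\<^sub>R frechet_derivative g (at x) v + frechet_derivative f (at x) v *\<^sub>R g x)) (at x)" if "x \<in> S" for x
      using higher_diff_SucD[OF Suc.prems(1) that] higher_diff_SucD[OF Suc.prems(2) that]
      by (rule has_derivative_scaleR)
    show "higher_diff n S (\<lambda>x. f x *\<^sub>R frechet_derivative g (at x) v + frechet_derivative f (at x) v *\<^sub>R g x)" for v
      by (intro higher_diff_add assms(1) Suc.IH) (use Suc.prems higher_diff_Suc_D in auto)
  qed
qed

lemma higher_diff_mult: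
  fixes f g :: "_ \<Rightarrow> real"
  assumes "open S" "higher_diff n S f" "higher_diff n S g"
  shows "higher_diff n S (\<lambda>x. f x * g x)"
  using higher_diff_scaleR[OF assms] by simp

lemma higher_diff_sum:
  assumes "open S" "\<And>i. i \<in> I \<Longrightarrow> higher_diff n S (f i)"
  shows "higher_diff n S (\<lambda>x. \<Sum>i\<in>I. f i x)"
  using assms(2)
  by (induction I rule: infinite_finite_induct)
     (simp_all add: higher_diff_const higher_diff_add assms(1))

lemma higher_diff_inverse:
  fixes f :: "_ \<Rightarrow> real"
  assumes "open S" "higher_diff n S f" "\<And>x. x \<in> S \<Longrightarrow> f x \<noteq> 0"
  shows "higher_diff n S (\<lambda>x. inverse (f x))"
  using assms(2)
proof (induction n)
  case 0 then show ?case using assms(3) by (simp add: continuous_on_inverse)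
next
  case (Suc n)
  show ?case
  proof (rule higher_diff_SucI[OF assms(1)])
    show "((\<lambda>x. inverse (f x)) has_derivative
       (\<lambda>v. (-1) * (inverse (f x) * frechet_derivative f (at x) v * inverse (f x)))) (at x)" if "x \<in> S" for x
      using Deriv.has_derivative_inverse[OF assms(3)[OF that] higher_diff_SucD[OF Suc.prems that]] by simp
    show "higher_diff n S (\<lambda>x. (-1) * (inverse (f x) * frechet_derivative f (at x) v * inverse (f x)))" for v
      by (intro higher_diff_mult higher_diff_const assms(1) Suc.IH higher_diff_Suc_D[OF Suc.prems])
         (use Suc.prems in auto)
  qed
qed

lemma higher_diff_componentwise:
  fixes f :: "_ \<Rightarrow> 'b::euclidean_space"
  assumes "open S" "\<And>b. b \<in> Basis \<Longrightarrow> higher_diff n S (\<lambda>x. f x \<bullet> b)"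
  shows "higher_diff n S f"
proof -
  have "higher_diff n S (\<lambda>x. \<Sum>b\<in>Basis. (f x \<bullet> b) *\<^sub>R b)"
    by (intro higher_diff_sum higher_diff_scaleR assms higher_diff_const)
  then show ?thesis by (simp add: euclidean_representation)
qed

text \<open>In the standard basis an expression \<open>D f(y) (X y)\<close>, where both arguments vary, becomes a sum
  of products.\<close>

lemma linear_basis_expansion:
  fixes L :: "'a::euclidean_space \<Rightarrow> 'b::real_vector"
  assumes "linear L"
  shows "L v = (\<Sum>b\<in>Basis. (v \<bullet> b) *\<^sub>R L b)"
  by (metis (mono_tags, lifting) assms euclidean_representation linear_scale linear_sum sum.cong)

lemma higher_diff_directional:
  fixes X :: "'c::real_normed_vector \<Rightarrow> 'a::euclidean_space"
  assumes "open S" "higher_diff n S X"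
    and "\<And>v. higher_diff n S (\<lambda>y. L y v)" and "\<And>y. y \<in> S \<Longrightarrow> linear (L y)"
  shows "higher_diff n S (\<lambda>y. L y (X y))"
proof -
  have "higher_diff n S (\<lambda>y. \<Sum>b\<in>Basis. (X y \<bullet> b) *\<^sub>R L y b)"
    by (intro higher_diff_sum higher_diff_scaleR assms
        higher_diff_bounded_linear_comp[OF assms(1) bounded_linear_inner_left])
  then show ?thesis
    by (rule higher_diff_cong[OF assms(1), rotated]) (simp add: linear_basis_expansion[symmetric] assms(4))
qed

text \<open>By the chain rule the derivative is \<open>D h (g x) (D g x v)\<close>, whose first factor is again a
  composition with \<open>g\<close>; the induction on the order therefore runs over all \<open>h\<close> at once.\<close>

lemma higher_diff_compose:
  fixes g :: "'c::real_normed_vector \<Rightarrow> 'a::euclidean_space"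
  assumes "open S" "open T" "g ` S \<subseteq> T" "higher_diff n S g" "smooth_on T h"
  shows "higher_diff n S (\<lambda>x. h (g x))"
  using assms(4,5)
proof (induction n arbitrary: h)
  case 0
  then have "continuous_on T h" unfolding smooth_on_def using higher_diff_continuous by blast
  with 0 assms(3) show ?case by (auto intro: continuous_on_compose2)
next
  case (Suc n)
  have h: "(h has_derivative frechet_derivative h (at (g x))) (at (g x))" if "x \<in> S" for x
    by (rule higher_diff_SucD[of 0 T]) (use Suc.prems(2) assms(3) that in \<open>auto simp: smooth_on_def simp del: higher_diff.simps\<close>)
  show ?case
  proof (rule higher_diff_SucI[OF assms(1)])
    show "((\<lambda>x. h (g x)) has_derivative
       (\<lambda>v. frechet_derivative h (at (g x)) (frechet_derivative g (at x) v))) (at x)" if "x \<in> S" for x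
      by (rule has_derivative_compose[OF higher_diff_SucD[OF Suc.prems(1) that] h[OF that]])
    show "higher_diff n S (\<lambda>x. frechet_derivative h (at (g x)) (frechet_derivative g (at x) v))" for v
    proof (rule higher_diff_directional[OF assms(1), where L = "\<lambda>x. frechet_derivative h (at (g x))"])
      show "higher_diff n S (\<lambda>x. frechet_derivative g (at x) v)" using Suc.prems(1) by simp
      show "higher_diff n S (\<lambda>x. frechet_derivative h (at (g x)) w)" for w
      proof (rule Suc.IH[of "\<lambda>y. frechet_derivative h (at y) w"])
        show "higher_diff n S g" using Suc.prems(1) by (rule higher_diff_Suc_D)
        show "smooth_on T (\<lambda>y. frechet_derivative h (at y) w)"
          using Suc.prems(2) unfolding smooth_on_def by (metis higher_diff.simps(2))
      qed
      show "linear (frechet_derivative h (at (g x)))" if "x \<in> S" for x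
        using h[OF that] has_derivative_linear by blast
    qed
  qed
qed

lemma smooth_on_subset: "smooth_on S f \<Longrightarrow> T \<subseteq> S \<Longrightarrow> smooth_on T f"
  unfolding smooth_on_def using higher_diff_subset by blast

lemma smooth_on_cong:
  "open S \<Longrightarrow> (\<And>x. x \<in> S \<Longrightarrow> f x = g x) \<Longrightarrow> smooth_on S f \<Longrightarrow> smooth_on S g"
  unfolding smooth_on_def using higher_diff_cong by blast

lemma smooth_on_local:
  "(\<And>x. x \<in> S \<Longrightarrow> \<exists>T. open T \<and> x \<in> T \<and> smooth_on T f) \<Longrightarrow> smooth_on S f"
  unfolding smooth_on_def by (meson higher_diff_local)

lemma smooth_on_has_derivative:
  "smooth_on S f \<Longrightarrow> x \<in> S \<Longrightarrow> (f has_derivative frechet_derivative f (at x)) (at x)"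
  unfolding smooth_on_def by (meson higher_diff_SucD)

lemma smooth_on_continuous: "smooth_on S f \<Longrightarrow> continuous_on S f"
  unfolding smooth_on_def using higher_diff_continuous by blast

lemma smooth_on_const: "open S \<Longrightarrow> smooth_on S (\<lambda>_. c)"
  unfolding smooth_on_def using higher_diff_const by blast

lemma smooth_on_linear:
  assumes "open S" "bounded_linear L" shows "smooth_on S L"
  unfolding smooth_on_def
  using higher_diff_bounded_linear_comp[OF assms higher_diff_id[OF assms(1)]] by simp

lemma smooth_on_linear_comp:
  "open S \<Longrightarrow> bounded_linear L \<Longrightarrow> smooth_on S f \<Longrightarrow> smooth_on S (\<lambda>x. L (f x))"
  unfolding smooth_on_def using higher_diff_bounded_linear_comp by blast

lemma smooth_on_add:
  "open S \<Longrightarrow> smooth_on S f \<Longrightarrow> smooth_on S g \<Longrightarrow> smooth_on S (\<lambda>x. f x + g x)"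
  unfolding smooth_on_def using higher_diff_add by blast

lemma smooth_on_scaleR:
  fixes f :: "_ \<Rightarrow> real"
  shows "open S \<Longrightarrow> smooth_on S f \<Longrightarrow> smooth_on S g \<Longrightarrow> smooth_on S (\<lambda>x. f x *\<^sub>R g x)"
  unfolding smooth_on_def using higher_diff_scaleR by blast

lemma smooth_on_inverse:
  fixes f :: "_ \<Rightarrow> real"
  shows "open S \<Longrightarrow> smooth_on S f \<Longrightarrow> (\<And>x. x \<in> S \<Longrightarrow> f x \<noteq> 0) \<Longrightarrow> smooth_on S (\<lambda>x. inverse (f x))"
  unfolding smooth_on_def using higher_diff_inverse by blast

lemma smooth_on_componentwise:
  fixes f :: "_ \<Rightarrow> 'b::euclidean_space"
  shows "open S \<Longrightarrow> (\<And>b. b \<in> Basis \<Longrightarrow> smooth_on S (\<lambda>x. f x \<bullet> b)) \<Longrightarrow> smooth_on S f"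
  unfolding smooth_on_def using higher_diff_componentwise by blast

lemma smooth_on_derivative: "smooth_on S f \<Longrightarrow> smooth_on S (\<lambda>x. frechet_derivative f (at x) v)"
  unfolding smooth_on_def by (metis higher_diff.simps(2))

lemma smooth_on_directional:
  fixes X :: "'c::euclidean_space \<Rightarrow> 'c"
  assumes "open S" "smooth_on S X" "smooth_on S f"
  shows "smooth_on S (\<lambda>y. frechet_derivative f (at y) (X y))"
  unfolding smooth_on_def
proof
  fix n
  show "higher_diff n S (\<lambda>y. frechet_derivative f (at y) (X y))"
  proof (rule higher_diff_directional[OF assms(1), where L = "\<lambda>y. frechet_derivative f (at y)"])
    show "linear (frechet_derivative f (at y))" if "y \<in> S" for y
      using smooth_on_has_derivative[OF assms(3) that] has_derivative_linear by blast
  qed (use assms smooth_on_derivative smooth_on_def in blast)+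
qed

lemma smooth_on_real_derivative_along:
  fixes f :: "'a::real_normed_vector \<Rightarrow> real"
  assumes "smooth_on S f" "q + s *\<^sub>R u \<in> S"
  shows "((\<lambda>t. f (q + t *\<^sub>R u)) has_real_derivative frechet_derivative f (at (q + s *\<^sub>R u)) u) (at s)"
proof -
  let ?D = "frechet_derivative f (at (q + s *\<^sub>R u))"
  have D: "(f has_derivative ?D) (at (q + s *\<^sub>R u))"
    using smooth_on_has_derivative[OF assms] .
  have l: "((\<lambda>t. q + t *\<^sub>R u) has_derivative (\<lambda>t. t *\<^sub>R u)) (at s)"
    by (auto intro!: derivative_eq_intros)
  have "((\<lambda>t. f (q + t *\<^sub>R u)) has_derivative (\<lambda>t. ?D (t *\<^sub>R u))) (at s)"
    by (rule has_derivative_compose[OF l D])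
  moreover have "(\<lambda>t. ?D (t *\<^sub>R u)) = (*) (?D u)"
    using linear_scale[OF has_derivative_linear[OF D]] by (auto simp: mult.commute)
  ultimately show ?thesis unfolding has_field_derivative_def by (simp only:)
qed

text \<open>The second difference quotient of \<open>f\<close> in two directions is a value of the mixed second
  derivative, by the mean value theorem applied twice. As the quotient is symmetric in
  the two directions, so is the second derivative.\<close>

lemma mixed_difference_mean_value:
  fixes f :: "'a::real_normed_vector \<Rightarrow> real"
  assumes f: "smooth_on S f" and "ball p d \<subseteq> S" "0 < h" "h * (norm u + norm v) < d"
  obtains q where "dist p q \<le> h * (norm u + norm v)"
    "f (p + h *\<^sub>R u + h *\<^sub>R v) - f (p + h *\<^sub>R u) - f (p + h *\<^sub>R v) + f p
       = h * h * frechet_derivative (\<lambda>x. frechet_derivative f (at x) u) (at q) v"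
proof -
  have nrm: "dist p (p + s *\<^sub>R u + t *\<^sub>R v) \<le> h * (norm u + norm v)"
    if "0 \<le> s" "s \<le> h" "0 \<le> t" "t \<le> h" for s t
  proof -
    have "dist p (p + s *\<^sub>R u + t *\<^sub>R v) = norm (s *\<^sub>R u + t *\<^sub>R v)"
      by (metis add.assoc add_diff_cancel_left' dist_commute dist_norm)
    also have "\<dots> \<le> s * norm u + t * norm v"
      using norm_triangle_ineq[of "s *\<^sub>R u" "t *\<^sub>R v"] that by simp
    also have "\<dots> \<le> h * norm u + h * norm v"
      using that by (intro add_mono mult_right_mono) auto
    finally show ?thesis by (simp add: distrib_left)
  qed
  have inS: "p + s *\<^sub>R u + t *\<^sub>R v \<in> S" if "0 \<le> s" "s \<le> h" "0 \<le> t" "t \<le> h" for s t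
    using nrm[OF that] assms by auto
  let ?D = "\<lambda>x. frechet_derivative f (at x) u"
  \<comment> \<open>the mixed difference is the increment of \<open>\<phi>\<close> over \<open>[0, h]\<close>\<close>
  define \<phi> where "\<phi> s = f (p + h *\<^sub>R v + s *\<^sub>R u) - f (p + s *\<^sub>R u)" for s
  have d1: "(\<phi> has_real_derivative (?D (p + h *\<^sub>R v + s *\<^sub>R u) - ?D (p + s *\<^sub>R u))) (at s)"
    if "0 \<le> s" "s \<le> h" for s
    unfolding \<phi>_def
    using inS[OF that, of h] inS[OF that, of 0] \<open>0 < h\<close>
    by (intro DERIV_diff smooth_on_real_derivative_along[OF f]) (auto simp: add_ac)
  obtain s where s: "0 < s" "s < h" "\<phi> h - \<phi> 0 = (h - 0) * (?D (p + h *\<^sub>R v + s *\<^sub>R u) - ?D (p + s *\<^sub>R u))"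
    using MVT2[OF \<open>0 < h\<close> d1] by blast
  have d2: "((\<lambda>t. ?D (p + s *\<^sub>R u + t *\<^sub>R v)) has_real_derivative
      frechet_derivative ?D (at (p + s *\<^sub>R u + t *\<^sub>R v)) v) (at t)"
    if "0 \<le> t" "t \<le> h" for t
    by (rule smooth_on_real_derivative_along[OF smooth_on_derivative[OF f]]) (use inS s that in auto)
  obtain t where t: "0 < t" "t < h" "?D (p + s *\<^sub>R u + h *\<^sub>R v) - ?D (p + s *\<^sub>R u + 0 *\<^sub>R v)
      = (h - 0) * frechet_derivative ?D (at (p + s *\<^sub>R u + t *\<^sub>R v)) v"
    using MVT2[OF \<open>0 < h\<close> d2] by blast
  show ?thesis
  proof (rule that[of "p + s *\<^sub>R u + t *\<^sub>R v"])
    show "dist p (p + s *\<^sub>R u + t *\<^sub>R v) \<le> h * (norm u + norm v)" by (rule nrm) (use s t in auto)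
    have "f (p + h *\<^sub>R u + h *\<^sub>R v) - f (p + h *\<^sub>R u) - f (p + h *\<^sub>R v) + f p = \<phi> h - \<phi> 0"
      by (simp add: \<phi>_def add_ac)
    also have "\<dots> = h * (?D (p + s *\<^sub>R u + h *\<^sub>R v) - ?D (p + s *\<^sub>R u + 0 *\<^sub>R v))"
      using s(3) by (simp add: add_ac)
    finally show "f (p + h *\<^sub>R u + h *\<^sub>R v) - f (p + h *\<^sub>R u) - f (p + h *\<^sub>R v) + f p
       = h * h * frechet_derivative ?D (at (p + s *\<^sub>R u + t *\<^sub>R v)) v" using t(3) by simp
  qed
qed

lemma second_derivative_symmetric:
  fixes f :: "'a::real_normed_vector \<Rightarrow> real"
  assumes "open S" and f: "smooth_on S f" and "p \<in> S"
  shows "frechet_derivative (\<lambda>x. frechet_derivative f (at x) u) (at p) v =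
         frechet_derivative (\<lambda>x. frechet_derivative f (at x) v) (at p) u"
proof (rule ccontr)
  define F where "F u v q = frechet_derivative (\<lambda>x. frechet_derivative f (at x) u) (at q) v" for u v q
  assume "\<not> ?thesis"
  then have e: "\<bar>F u v p - F v u p\<bar> / 2 > 0" (is "?e > 0") by (simp add: F_def)
  have "continuous (at p) (F a b)" for a b
  proof -
    have "continuous_on S (F a b)"
      unfolding F_def by (intro smooth_on_continuous smooth_on_derivative f)
    then show ?thesis using assms(1,3) continuous_on_eq_continuous_at by blast
  qed
  then have "\<exists>d>0. \<forall>q. dist q p < d \<longrightarrow> dist (F a b q) (F a b p) < ?e" for a b
    using e unfolding continuous_at_eps_delta by metis
  then obtain d1 d2 where d: "d1 > 0" "d2 > 0"
    "\<And>q. dist q p < d1 \<Longrightarrow> dist (F u v q) (F u v p) < ?e"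
    "\<And>q. dist q p < d2 \<Longrightarrow> dist (F v u q) (F v u p) < ?e"
    by metis
  obtain d3 where d3: "d3 > 0" "ball p d3 \<subseteq> S" using assms openE by blast
  let ?N = "norm u + norm v"
  obtain h where h: "h > 0" "h * ?N < d1" "h * ?N < d2" "h * ?N < d3"
  proof
    let ?m = "min d1 (min d2 d3)"
    let ?h = "?m / (?N + 1)"
    have N: "?N + 1 > 0" by (smt (verit) norm_ge_zero)
    have m: "?m > 0" using d d3 by simp
    show "?h > 0" using N m by simp
    have "?h * ?N < ?h * (?N + 1)" using \<open>?h > 0\<close> by (simp add: distrib_left)
    also have "\<dots> = ?m" using N by simp
    finally show "?h * ?N < d1" "?h * ?N < d2" "?h * ?N < d3" by auto
  qed
  obtain q where q: "dist p q \<le> h * ?N" "f (p + h *\<^sub>R u + h *\<^sub>R v) - f (p + h *\<^sub>R u) - f (p + h *\<^sub>R v) + f p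
       = h * h * F u v q"
    using mixed_difference_mean_value[OF f d3(2) h(1) h(4)] unfolding F_def by blast
  have "h * (norm v + norm u) < d3" using h(4) by (simp add: add.commute)
  then obtain q' where q': "dist p q' \<le> h * (norm v + norm u)" "f (p + h *\<^sub>R v + h *\<^sub>R u) - f (p + h *\<^sub>R v) - f (p + h *\<^sub>R u) + f p
       = h * h * F v u q'"
    using mixed_difference_mean_value[OF f d3(2) h(1)] unfolding F_def by blast
  have swap: "p + h *\<^sub>R v + h *\<^sub>R u = p + h *\<^sub>R u + h *\<^sub>R v" by simp
  have "h * h * F u v q = h * h * F v u q'"
    unfolding q(2)[symmetric] q'(2)[symmetric] swap by simp
  then have "F u v q = F v u q'" using h(1) by simp
  moreover have "dist (F u v q) (F u v p) < ?e" by (rule d(3)) (use q(1) h(2) in \<open>simp add: dist_commute\<close>)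
  moreover have "dist (F v u q') (F v u p) < ?e" by (rule d(4)) (use q'(1) h(3) in \<open>simp add: dist_commute add.commute\<close>)
  ultimately show False unfolding dist_real_def by (smt (verit) field_sum_of_halves)
qed

lemma linear_difference_bound:
  fixes f g :: "'a::euclidean_space \<Rightarrow> 'b::real_normed_vector"
  assumes "linear f" "linear g"
  shows "norm (f u - g u) \<le> (\<Sum>b\<in>Basis. norm (f b - g b)) * norm u"
proof -
  have "f u - g u = (\<Sum>b\<in>Basis. (u \<bullet> b) *\<^sub>R (f b - g b))"
    using linear_basis_expansion[OF assms(1), of u] linear_basis_expansion[OF assms(2), of u]
    by (simp add: scaleR_diff_right sum_subtractf)
  then have "norm (f u - g u) \<le> (\<Sum>b\<in>Basis. \<bar>u \<bullet> b\<bar> * norm (f b - g b))"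
    by (metis (mono_tags, lifting) norm_scaleR norm_sum sum.cong)
  also have "\<dots> \<le> (\<Sum>b\<in>Basis. norm u * norm (f b - g b))"
    by (intro sum_mono mult_right_mono) (auto simp: Basis_le_norm)
  finally show ?thesis by (simp add: sum_distrib_left mult.commute)
qed

text \<open>Near \<open>p\<close> the maps \<open>L z\<close> differ from \<open>L p\<close> by at most half of a lower bound for \<open>L p\<close>. The estimates
  for solutions of linear systems rest on the bound that remains.\<close>

lemma linear_family_bounded_below:
  fixes L :: "'c::topological_space \<Rightarrow> 'a::euclidean_space \<Rightarrow> 'b::euclidean_space"
  assumes "open S" "p \<in> S" "\<And>v. continuous_on S (\<lambda>z. L z v)"
    and lin: "\<And>z. z \<in> S \<Longrightarrow> linear (L z)" and inj: "inj (L p)"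
  obtains c T where "c > 0" "open T" "p \<in> T" "T \<subseteq> S" "\<And>z u. z \<in> T \<Longrightarrow> c * norm u \<le> norm (L z u)"
proof -
  obtain c where c: "c > 0" "\<And>u. c * norm u \<le> norm (L p u)"
    using linear_inj_bounded_below_pos[OF lin[OF assms(2)] inj] by (metis mult.commute)
  define m where "m z = (\<Sum>b\<in>Basis. norm (L z b - L p b))" for z
  have "continuous_on S m" unfolding m_def
    by (intro continuous_intros assms(3))
  then have "open (S \<inter> m -` {..< c / 2})"
    using assms(1) continuous_open_preimage open_lessThan by blast
  moreover have "p \<in> S \<inter> m -` {..< c / 2}" using assms(2) c(1) by (simp add: m_def)
  moreover have "c / 2 * norm u \<le> norm (L z u)" if "z \<in> S \<inter> m -` {..< c / 2}" for z u
  proof -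
    have "norm (L z u - L p u) \<le> norm u * m z"
      using linear_difference_bound[OF lin lin, of z p u] that assms(2) by (simp add: m_def mult.commute)
    also have "\<dots> \<le> norm u * (c / 2)" using that by (intro mult_left_mono) auto
    finally have "norm (L z u - L p u) \<le> c / 2 * norm u" by (simp add: mult.commute)
    moreover have "norm (L p u) \<le> norm (L z u) + norm (L z u - L p u)"
      by (metis norm_minus_commute norm_triangle_sub)
    ultimately show ?thesis using c(2)[of u] by simp
  qed
  ultimately show ?thesis using that[of "c/2" "S \<inter> m -` {..< c / 2}"] c(1) by auto
qed

lemma linear_solution_continuous:
  fixes L :: "'c::t2_space \<Rightarrow> 'a::euclidean_space \<Rightarrow> 'b::euclidean_space"
  assumes "open S" and L: "\<And>v. continuous_on S (\<lambda>z. L z v)"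
    and lin: "\<And>z. z \<in> S \<Longrightarrow> linear (L z)" and inj: "\<And>z. z \<in> S \<Longrightarrow> inj (L z)"
    and w: "\<And>z. z \<in> S \<Longrightarrow> L z (w z) = h z" and h: "continuous_on S h"
  shows "continuous_on S w"
proof -
  have "isCont w p" if p: "p \<in> S" for p
  proof -
    obtain c T where T: "c > 0" "open T" "p \<in> T" "T \<subseteq> S" "\<And>z u. z \<in> T \<Longrightarrow> c * norm u \<le> norm (L z u)"
      using linear_family_bounded_below[OF assms(1) p L lin inj] p by blast
    have "continuous_on S (\<lambda>z. h z - L z (w p))" by (intro continuous_intros h L)
    then have "isCont (\<lambda>z. h z - L z (w p)) p" using assms(1) p continuous_on_eq_continuous_at by blast
    then have "((\<lambda>z. h z - L z (w p)) \<longlongrightarrow> 0) (at p)"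
      using w[OF p] by (simp add: isCont_def)
    then have lim: "((\<lambda>z. norm (h z - L z (w p)) / c) \<longlongrightarrow> 0) (at p)"
      using tendsto_divide_zero tendsto_norm_zero by blast
    have "\<forall>\<^sub>F z in at p. norm (w z - w p) \<le> norm (h z - L z (w p)) / c"
    proof (rule eventually_at_topological[THEN iffD2], intro exI[of _ T] conjI ballI impI)
      fix z assume z: "z \<in> T"
      have "L z (w z - w p) = h z - L z (w p)"
        using linear_diff[OF lin] w z T(4) by auto
      then have "c * norm (w z - w p) \<le> norm (h z - L z (w p))" using T(5)[OF z, of "w z - w p"] by simp
      then show "norm (w z - w p) \<le> norm (h z - L z (w p)) / c" using T(1) by (simp add: field_simps)
    qed (use T in auto)
    then have "((\<lambda>z. w z - w p) \<longlongrightarrow> 0) (at p)" by (rule Lim_null_comparison[OF _ lim])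
    then show ?thesis unfolding isCont_def using LIM_zero_iff by blast
  qed
  then show ?thesis using assms(1) continuous_on_eq_continuous_at by blast
qed

text \<open>The difference \<open>w z - w p\<close> solves the system with right side \<open>h z - L z (w p)\<close>, which vanishes at
  \<open>p\<close>. To first order its solution is that of the system frozen at \<open>p\<close>.\<close>

lemma linear_solution_has_derivative:
  fixes L :: "'c::real_normed_vector \<Rightarrow> 'a::euclidean_space \<Rightarrow> 'a"
  assumes "open S" and L: "\<And>v. smooth_on S (\<lambda>z. L z v)"
    and lin: "\<And>z. z \<in> S \<Longrightarrow> linear (L z)" and inj: "\<And>z. z \<in> S \<Longrightarrow> inj (L z)"
    and w: "\<And>z. z \<in> S \<Longrightarrow> L z (w z) = h z" and p: "p \<in> S"
    and h: "(h has_derivative h') (at p)"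
  obtains w' where "(w has_derivative w') (at p)"
    "\<And>v. L p (w' v) = h' v - frechet_derivative (\<lambda>z. L z (w p)) (at p) v"
proof -
  obtain c T where T: "c > 0" "open T" "p \<in> T" "T \<subseteq> S" "\<And>z u. z \<in> T \<Longrightarrow> c * norm u \<le> norm (L z u)"
    using linear_family_bounded_below[OF assms(1) p smooth_on_continuous[OF L] lin inj] p by blast
  define k where "k z = h z - L z (w p)" for z
  define k' where "k' v = h' v - frechet_derivative (\<lambda>z. L z (w p)) (at p) v" for v
  have k: "(k has_derivative k') (at p)"
    unfolding k_def k'_def by (intro has_derivative_diff h smooth_on_has_derivative[OF L p])
  obtain M where M: "linear M" "\<And>v. L p (M v) = v" "\<And>v. M (L p v) = v"
    using linear_injective_isomorphism[OF lin[OF p] inj[OF p]] by blast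
  define w' where "w' v = M (k' v)" for v
  have bw': "bounded_linear w'" unfolding w'_def
    using M(1) linear_conv_bounded_linear has_derivative_bounded_linear[OF k]
    by (metis bounded_linear_compose)
  obtain B where B: "B > 0" "\<And>v. norm (w' v) \<le> norm v * B" using bounded_linear.pos_bounded[OF bw'] by blast
  define m where "m z = (\<Sum>b\<in>Basis. norm (L z b - L p b))" for z
  have "continuous_on S m" unfolding m_def
    by (intro continuous_intros smooth_on_continuous L)
  then have m: "isCont m p" using assms(1) p continuous_on_eq_continuous_at by blast
  have Lm: "norm (L z u - L p u) \<le> m z * norm u" if "z \<in> S" for z u
    unfolding m_def by (rule linear_difference_bound[OF lin[OF that] lin[OF p]])
  have "(w has_derivative w') (at p)"
    unfolding has_derivative_at_alt
  proof (intro conjI bw' allI impI)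
    fix e :: real assume "e > 0"
    define e1 where "e1 = c * e / 2"
    define e2 where "e2 = c * e / (2 * B)"
    have e12: "e1 > 0" "e2 > 0" using \<open>e > 0\<close> T(1) B(1) by (auto simp: e1_def e2_def)
    obtain d1 where d1: "d1 > 0" "\<And>y. norm (y - p) < d1 \<Longrightarrow> norm (k y - k p - k' (y - p)) \<le> e1 * norm (y - p)"
      using k e12(1) unfolding has_derivative_at_alt by blast
    obtain d2 where d2: "d2 > 0" "\<And>y. norm (y - p) < d2 \<Longrightarrow> \<bar>m y\<bar> < e2"
      using m e12(2) unfolding continuous_at_eps_delta dist_norm by (force simp: m_def)
    obtain d3 where d3: "d3 > 0" "ball p d3 \<subseteq> T" using T openE by blast
    show "\<exists>d>0. \<forall>y. norm (y - p) < d \<longrightarrow> norm (w y - w p - w' (y - p)) \<le> e * norm (y - p)"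
    proof (intro exI[of _ "min d1 (min d2 d3)"] conjI allI impI)
      fix y assume y: "norm (y - p) < min d1 (min d2 d3)"
      then have yT: "y \<in> T" using d3(2) by (auto simp: dist_norm norm_minus_commute)
      then have yS: "y \<in> S" using T(4) by auto
      have k0: "k p = 0" using w[OF p] by (simp add: k_def)
      have "L y (w y - w p - w' (y - p)) = k y - L y (w' (y - p))"
        using linear_diff[OF lin[OF yS]] w[OF yS] by (simp add: k_def)
      also have "\<dots> = (k y - k p - k' (y - p)) - (L y (w' (y - p)) - L p (w' (y - p)))"
        by (simp add: k0 w'_def M(2))
      finally have "norm (L y (w y - w p - w' (y - p))) \<le>
          norm (k y - k p - k' (y - p)) + norm (L y (w' (y - p)) - L p (w' (y - p)))"
        by (metis norm_triangle_ineq4)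
      also have "\<dots> \<le> e1 * norm (y - p) + m y * norm (w' (y - p))"
        by (intro add_mono d1(2) Lm yS) (use y in auto)
      also have "\<dots> \<le> e1 * norm (y - p) + e2 * (norm (y - p) * B)"
      proof (intro add_left_mono mult_mono)
        show "m y \<le> e2" using d2(2)[of y] y by auto
      qed (use B e12 in auto)
      also have "\<dots> = c * (e * norm (y - p))" using B(1) by (simp add: e1_def e2_def)
      finally have "c * norm (w y - w p - w' (y - p)) \<le> c * (e * norm (y - p))"
        using T(5)[OF yT, of "w y - w p - w' (y - p)"] by simp
      then show "norm (w y - w p - w' (y - p)) \<le> e * norm (y - p)" using T(1) by simp
    qed (use d1 d2 d3 in auto)
  qed
  moreover have "L p (w' v) = h' v - frechet_derivative (\<lambda>z. L z (w p)) (at p) v" for v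
    by (simp add: w'_def M(2) k'_def)
  ultimately show ?thesis using that by blast
qed

text \<open>Differentiating \<open>L w = h\<close> shows that a derivative of \<open>w\<close> solves a system with the same matrix,
  whose right side is as smooth as \<open>w\<close> and the derivative of \<open>h\<close>; hence an induction on the order.\<close>

lemma linear_solution_smooth:
  fixes L :: "'c::real_normed_vector \<Rightarrow> 'a::euclidean_space \<Rightarrow> 'a"
  assumes "open S" and L: "\<And>v. smooth_on S (\<lambda>z. L z v)"
    and lin: "\<And>z. z \<in> S \<Longrightarrow> linear (L z)" and inj: "\<And>z. z \<in> S \<Longrightarrow> inj (L z)"
    and w: "\<And>z. z \<in> S \<Longrightarrow> L z (w z) = h z" and h: "smooth_on S h"
  shows "smooth_on S w"
proof -
  have "higher_diff n S w" if "higher_diff n S h" "\<And>z. z \<in> S \<Longrightarrow> L z (w z) = h z" for n w h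
    using that
  proof (induction n arbitrary: w h)
    case 0
    then show ?case
      using linear_solution_continuous[OF assms(1) smooth_on_continuous[OF L] lin inj, of w h] by simp
  next
    case (Suc n)
    have hd: "(h has_derivative frechet_derivative h (at z)) (at z)" if "z \<in> S" for z
      by (rule higher_diff_SucD[OF Suc.prems(1) that])
    have wd: "(w has_derivative frechet_derivative w (at z)) (at z) \<and>
       (\<forall>v. L z (frechet_derivative w (at z) v)
         = frechet_derivative h (at z) v - frechet_derivative (\<lambda>y. L y (w z)) (at z) v)" if z: "z \<in> S" for z
    proof -
      obtain w' where w': "(w has_derivative w') (at z)"
        "\<And>v. L z (w' v) = frechet_derivative h (at z) v - frechet_derivative (\<lambda>y. L y (w z)) (at z) v"
        using linear_solution_has_derivative[OF assms(1) L lin inj Suc.prems(2) z hd[OF z]] by blast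
      have "frechet_derivative w (at z) = w'" using frechet_derivative_at[OF w'(1)] by simp
      with w' show ?thesis by simp
    qed
    have wn: "higher_diff n S w" by (rule Suc.IH[OF higher_diff_Suc_D[OF Suc.prems(1)] Suc.prems(2)])
    have "higher_diff n S (\<lambda>z. frechet_derivative w (at z) v)" for v
    proof (rule Suc.IH)
      show "L z (frechet_derivative w (at z) v) =
          frechet_derivative h (at z) v + (-1) *\<^sub>R frechet_derivative (\<lambda>y. L y (w z)) (at z) v"
        if "z \<in> S" for z using wd[OF that] by simp
      have "higher_diff n S (\<lambda>z. frechet_derivative (\<lambda>y. L y (w z)) (at z) v)"
      proof (rule higher_diff_directional[OF assms(1) wn])
        show "higher_diff n S (\<lambda>z. frechet_derivative (\<lambda>y. L y u) (at z) v)" for u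
          using smooth_on_derivative[OF L[of u], of v] unfolding smooth_on_def by simp
        show "linear (\<lambda>u. frechet_derivative (\<lambda>y. L y u) (at z) v)" if z: "z \<in> S" for z
        proof (rule linearI)
          have Ld: "((\<lambda>y. L y u) has_derivative frechet_derivative (\<lambda>y. L y u) (at z)) (at z)" for u
            by (rule smooth_on_has_derivative[OF L z])
          have eq1: "((\<lambda>y. L y (u1 + u2)) has_derivative
              (\<lambda>v. frechet_derivative (\<lambda>y. L y u1) (at z) v + frechet_derivative (\<lambda>y. L y u2) (at z) v)) (at z)" for u1 u2
            by (rule has_derivative_transform_within_open[OF has_derivative_add[OF Ld[of u1] Ld[of u2]] assms(1) z])
               (simp add: linear_add[OF lin])
          show "frechet_derivative (\<lambda>y. L y (u1 + u2)) (at z) v =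
              frechet_derivative (\<lambda>y. L y u1) (at z) v + frechet_derivative (\<lambda>y. L y u2) (at z) v" for u1 u2
            using frechet_derivative_at[OF eq1[of u1 u2]] by metis
          have eq2: "((\<lambda>y. L y (r *\<^sub>R u)) has_derivative
              (\<lambda>v. r *\<^sub>R frechet_derivative (\<lambda>y. L y u) (at z) v)) (at z)" for r u
            by (rule has_derivative_transform_within_open[OF has_derivative_scaleR_right[OF Ld[of u]] assms(1) z])
               (simp add: linear_scale[OF lin])
          show "frechet_derivative (\<lambda>y. L y (r *\<^sub>R u)) (at z) v = r *\<^sub>R frechet_derivative (\<lambda>y. L y u) (at z) v" for r u
            using frechet_derivative_at[OF eq2[of r u]] by metis
        qed
      qed
      then show "higher_diff n S (\<lambda>z. frechet_derivative h (at z) v +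
          (-1) *\<^sub>R frechet_derivative (\<lambda>y. L y (w z)) (at z) v)"
        using Suc.prems(1)
        by (intro higher_diff_add higher_diff_bounded_linear_comp[OF assms(1) bounded_linear_scaleR_right] assms(1)) auto
    qed
    then show ?case
      using wd by (intro higher_diff_SucI[OF assms(1), of _ "\<lambda>z. frechet_derivative w (at z)"]) auto
  qed
  then show ?thesis using h w unfolding smooth_on_def by blast
qed

text \<open>The derivative of the inverse \<open>g\<close> at \<open>y\<close> is the inverse matrix of \<open>D G\<close>, which is smooth by
  \<open>linear_solution_smooth\<close>, evaluated at \<open>g y\<close>; so each order of differentiability of \<open>g\<close> gives the
  next one.\<close>

lemma smooth_inverse_function:
  fixes G :: "'a::euclidean_space \<Rightarrow> 'a"
  assumes "open S" and G: "smooth_on S G" and "inj_on G S"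
    and DG: "\<And>z. z \<in> S \<Longrightarrow> inj (frechet_derivative G (at z))"
  shows "open (G ` S)" and "smooth_on (G ` S) (inv_into S G)"
proof -
  show op: "open (G ` S)"
    using invariance_of_domain[OF smooth_on_continuous[OF G] assms(1,3)] .
  let ?g = "inv_into S G" and ?D = "\<lambda>z. frechet_derivative G (at z)"
  have Gd: "(G has_derivative ?D z) (at z)" if "z \<in> S" for z by (rule smooth_on_has_derivative[OF G that])
  have lin: "linear (?D z)" if "z \<in> S" for z using Gd[OF that] has_derivative_linear by blast
  define w where "w z v = inv_into UNIV (?D z) v" for z v
  have Dw: "?D z (w z v) = v" if "z \<in> S" for z v
    using linear_injective_imp_surjective[OF lin[OF that] DG[OF that]] by (simp add: w_def f_inv_into_f)
  have ws: "smooth_on S (\<lambda>z. w z v)" for v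
    by (rule linear_solution_smooth[OF assms(1) smooth_on_derivative[OF G] lin DG Dw smooth_on_const[OF assms(1)]])
  have gd: "(?g has_derivative (\<lambda>v. w (?g y) v)) (at y)" if y: "y \<in> G ` S" for y
  proof -
    obtain z where z: "z \<in> S" "y = G z" using y by auto
    then have gz: "?g y = z" using assms(3) by simp
    have "(?g has_derivative w z) (at (G z))"
      by (rule has_derivative_inverse_on[OF assms(1) Gd])
         (use assms(3) z Dw in \<open>auto simp: fun_eq_iff\<close>)
    then show ?thesis using z gz by simp
  qed
  have "higher_diff n (G ` S) ?g" for n
  proof (induction n)
    case 0
    show ?case using gd has_derivative_continuous_on[of "G ` S" ?g] has_derivative_at_withinI by fastforce
  next
    case (Suc n)
    show ?case
    proof (rule higher_diff_SucI[OF op gd])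
      show "higher_diff n (G ` S) (\<lambda>y. w (?g y) v)" for v
        by (rule higher_diff_compose[OF op assms(1) _ Suc ws]) (auto simp: inv_into_into)
    qed
  qed
  then show "smooth_on (G ` S) ?g" by (simp add: smooth_on_def)
qed

lemma locally_injective:
  fixes G :: "'a::euclidean_space \<Rightarrow> 'a"
  assumes "open S" and G: "smooth_on S G" and p: "p \<in> S" and DG: "inj (frechet_derivative G (at p))"
  obtains T where "open T" "p \<in> T" "T \<subseteq> S" "inj_on G T"
    "\<And>z. z \<in> T \<Longrightarrow> inj (frechet_derivative G (at z))"
proof -
  let ?D = "\<lambda>z. frechet_derivative G (at z)"
  have Gd: "(G has_derivative ?D z) (at z)" if "z \<in> S" for z by (rule smooth_on_has_derivative[OF G that])
  have lin: "linear (?D z)" if "z \<in> S" for z using Gd[OF that] has_derivative_linear by blast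
  have Dc: "continuous_on S (\<lambda>z. ?D z v)" for v by (rule smooth_on_continuous[OF smooth_on_derivative[OF G]])
  obtain c T where T: "c > 0" "open T" "p \<in> T" "T \<subseteq> S" "\<And>z u. z \<in> T \<Longrightarrow> c * norm u \<le> norm (?D z u)"
    using linear_family_bounded_below[OF assms(1) p Dc lin DG] by blast
  have injT: "inj (?D z)" if "z \<in> T" for z
    using T(5)[OF that] T(1,4) lin that
    by (subst linear_injective_0) (auto, smt (verit) mult_pos_pos norm_zero zero_less_norm_iff)
  obtain M where M: "linear M" "M \<circ> ?D p = id"
    using linear_injective_left_inverse[OF lin[OF p] DG] by blast
  define m where "m z = (\<Sum>b\<in>Basis. norm (?D z b - ?D p b))" for z
  have "continuous_on S m" unfolding m_def by (intro continuous_intros Dc)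
  then have m: "isCont m p" using assms(1) p continuous_on_eq_continuous_at by blast
  have ex: "\<exists>d>0. \<forall>x. dist p x < d \<longrightarrow> onorm (\<lambda>v. ?D x v - ?D p v) < e" if e: "e > 0" for e
  proof -
    obtain d1 where d1: "d1 > 0" "\<And>y. dist y p < d1 \<Longrightarrow> dist (m y) (m p) < e"
      using m e unfolding continuous_at_eps_delta by blast
    obtain d2 where d2: "d2 > 0" "ball p d2 \<subseteq> S" using assms(1) p openE by blast
    have "onorm (\<lambda>v. ?D x v - ?D p v) < e" if x: "dist p x < min d1 d2" for x
    proof -
      have xS: "x \<in> S" using x d2 by auto
      have "onorm (\<lambda>v. ?D x v - ?D p v) \<le> m x"
        unfolding m_def by (intro onorm_le linear_difference_bound lin xS p)
      also have "m x < e" using d1(2)[of x] x by (simp add: dist_commute m_def)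
      finally show ?thesis .
    qed
    then show ?thesis using d1 d2 by (intro exI[of _ "min d1 d2"]) auto
  qed
  have bM: "bounded_linear M" using M(1) by (simp add: linear_conv_bounded_linear)
  have GdT: "(G has_derivative ?D z) (at z)" if "z \<in> T" for z using Gd T(4) that by blast
  obtain r where "r > 0" "ball p r \<subseteq> T" "inj_on G (ball p r)"
    by (rule has_derivative_locally_injective[where f = G and f' = ?D, OF T(3,2) bM M(2) GdT ex]) auto
  then show ?thesis using that[of "ball p r"] injT T(4) by (meson centre_in_ball open_ball subset_iff order_trans)
qed

section \<open>Functions, fields and brackets on a manifold\<close>

locale smooth_mfd =
  fixes A :: "('m::{t2_space,second_countable_topology}, 'a::euclidean_space) chart set"
  assumes mfd: "smooth_manifold A"
begin

lemma chart_homeomorphism: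
  assumes "(D, c) \<in> A"
  shows "open D" "open (c ` D)" "homeomorphism D (c ` D) c (inv_into D c)" "inj_on c D"
proof -
  have "\<forall>(D, c)\<in>A. open D \<and> open (c ` D) \<and> homeomorphism D (c ` D) c (inv_into D c)"
    using mfd unfolding smooth_manifold_def by (elim conjE)
  from bspec[OF this assms]
  show "open D" "open (c ` D)" and h: "homeomorphism D (c ` D) c (inv_into D c)" by simp_all
  show "inj_on c D" using homeomorphism_apply1[OF h] by (intro inj_on_inverseI)
qed

lemma chart_image_open:
  assumes "(D, c) \<in> A" "open W"
  shows "open (c ` (W \<inter> D))"
proof -
  have "openin (top_of_set (c ` D)) (c ` (W \<inter> D))"
    using chart_homeomorphism[OF assms(1)] assms(2)
    by (intro homeomorphism_imp_open_map[of D "c ` D" c "inv_into D c"]) (auto simp: openin_open Int_commute)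
  then show ?thesis using chart_homeomorphism(2)[OF assms(1)] openin_open_eq by blast
qed

lemma chart_at_props:
  obtains D c where "chart_at A p = (D, c)" "(D, c) \<in> A" "p \<in> D"
proof -
  have "(\<Union>(D, c)\<in>A. D) = UNIV"
    using mfd unfolding smooth_manifold_def by (elim conjE)
  then have "p \<in> (\<Union>(D, c)\<in>A. D)" by simp
  then obtain C where "C \<in> A" "p \<in> (case C of (D, c) \<Rightarrow> D)" by blast
  then have "\<exists>C. C \<in> A \<and> p \<in> fst C" by (intro exI[of _ C]) (simp add: case_prod_beta)
  then have "chart_at A p \<in> A \<and> p \<in> fst (chart_at A p)"
    unfolding chart_at_def by (rule someI_ex)
  then show ?thesis using that by (metis prod.collapse)
qed

lemma inv_chart: "(D, c) \<in> A \<Longrightarrow> p \<in> D \<Longrightarrow> inv_into D c (c p) = p"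
  using chart_homeomorphism(4) by (simp add: inv_into_f_f)

lemma smooth_fun_chart: "(D, c) \<in> A \<Longrightarrow> smooth_fun A D c"
proof -
  assume c: "(D, c) \<in> A"
  have all: "\<forall>(D, c)\<in>A. \<forall>(D', c')\<in>A. smooth_on (c ` (D \<inter> D')) (c' \<circ> inv_into D c)"
    using mfd unfolding smooth_manifold_def by (elim conjE)
  have "smooth_on (c' ` (D \<inter> D')) (c \<circ> inv_into D' c')" if "(D', c') \<in> A" for D' c'
    using bspec[OF bspec[OF all that, simplified] c] by (simp add: Int_commute)
  then show ?thesis unfolding smooth_fun_def by auto
qed

lemma smooth_fun_in_chart:
  "smooth_fun A W f \<Longrightarrow> (D, c) \<in> A \<Longrightarrow> smooth_on (c ` (W \<inter> D)) (f \<circ> inv_into D c)"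
  unfolding smooth_fun_def by auto

lemma smooth_funI:
  assumes "open W"
    and "\<And>D c. (D, c) \<in> A \<Longrightarrow> open (c ` (W \<inter> D)) \<Longrightarrow> smooth_on (c ` (W \<inter> D)) (\<lambda>y. f (inv_into D c y))"
  shows "smooth_fun A W f"
  unfolding smooth_fun_def o_def using assms(2) chart_image_open[OF _ assms(1)] by auto

lemma smooth_funD:
  "smooth_fun A W f \<Longrightarrow> (D, c) \<in> A \<Longrightarrow> smooth_on (c ` (W \<inter> D)) (\<lambda>y. f (inv_into D c y))"
  using smooth_fun_in_chart unfolding o_def .

lemma smooth_fun_subset:
  assumes "smooth_fun A W f" "W' \<subseteq> W" shows "smooth_fun A W' f"
proof -
  have "smooth_on (c ` (W' \<inter> D)) (f \<circ> inv_into D c)" if "(D, c) \<in> A" for D c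
    by (rule smooth_on_subset[OF smooth_fun_in_chart[OF assms(1) that]]) (use assms(2) in blast)
  then show ?thesis unfolding smooth_fun_def by auto
qed

lemma smooth_fun_local:
  assumes "\<And>p. p \<in> W \<Longrightarrow> \<exists>W'. open W' \<and> p \<in> W' \<and> smooth_fun A W' f"
  shows "smooth_fun A W f"
  unfolding smooth_fun_def
proof clarify
  fix D c assume c: "(D, c) \<in> A"
  show "smooth_on (c ` (W \<inter> D)) (f \<circ> inv_into D c)"
  proof (rule smooth_on_local)
    fix y assume "y \<in> c ` (W \<inter> D)"
    then obtain p where p: "p \<in> W" "p \<in> D" "y = c p" by auto
    obtain W' where W': "open W'" "p \<in> W'" "smooth_fun A W' f" using assms p(1) by blast
    show "\<exists>T. open T \<and> y \<in> T \<and> smooth_on T (f \<circ> inv_into D c)"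
      using chart_image_open[OF c W'(1)] smooth_fun_in_chart[OF W'(3) c] p W'(2) by blast
  qed
qed

lemma smooth_fun_cong:
  assumes "open W" "\<And>p. p \<in> W \<Longrightarrow> f p = g p" "smooth_fun A W f"
  shows "smooth_fun A W g"
  unfolding smooth_fun_def
proof clarify
  fix D c assume c: "(D, c) \<in> A"
  show "smooth_on (c ` (W \<inter> D)) (g \<circ> inv_into D c)"
    by (rule smooth_on_cong[OF chart_image_open[OF c assms(1)] _ smooth_fun_in_chart[OF assms(3) c]])
       (auto simp: inv_chart[OF c] assms(2))
qed

lemma smooth_fun_const: "open W \<Longrightarrow> smooth_fun A W (\<lambda>_. a)"
  by (rule smooth_funI, assumption, rule smooth_on_const)

lemma smooth_fun_add:
  "open W \<Longrightarrow> smooth_fun A W f \<Longrightarrow> smooth_fun A W g \<Longrightarrow> smooth_fun A W (\<lambda>p. f p + g p)"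
  by (rule smooth_funI, assumption, rule smooth_on_add) (auto intro: smooth_funD)

lemma smooth_fun_scaleR:
  "open W \<Longrightarrow> smooth_fun A W f \<Longrightarrow> smooth_fun A W g \<Longrightarrow> smooth_fun A W (\<lambda>p. (f p :: real) *\<^sub>R g p)"
  by (rule smooth_funI, assumption, rule smooth_on_scaleR) (auto intro: smooth_funD)

lemma smooth_fun_mult:
  "open W \<Longrightarrow> smooth_fun A W f \<Longrightarrow> smooth_fun A W g \<Longrightarrow> smooth_fun A W (\<lambda>p. (f p :: real) * g p)"
  using smooth_fun_scaleR[of W f g] by simp

lemma smooth_fun_linear_comp:
  "open W \<Longrightarrow> bounded_linear L \<Longrightarrow> smooth_fun A W f \<Longrightarrow> smooth_fun A W (\<lambda>p. L (f p))"
  by (rule smooth_funI, assumption, rule smooth_on_linear_comp) (auto intro: smooth_funD)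

lemma smooth_fun_diff:
  assumes "open W" "smooth_fun A W f" "smooth_fun A W g"
  shows "smooth_fun A W (\<lambda>p. f p - (g p :: real))"
  using smooth_fun_add[OF assms(1,2) smooth_fun_linear_comp[OF assms(1) bounded_linear_minus[OF bounded_linear_ident] assms(3)]]
  by simp

lemma smooth_fun_sum:
  assumes "open W" "\<And>i. i \<in> I \<Longrightarrow> smooth_fun A W (f i)"
  shows "smooth_fun A W (\<lambda>p. \<Sum>i\<in>I. f i p)"
  using assms(2)
  by (induction I rule: infinite_finite_induct)
     (simp_all add: smooth_fun_const smooth_fun_add assms(1))

lemma smooth_fun_inverse:
  assumes "open W" "smooth_fun A W f" "\<And>p. p \<in> W \<Longrightarrow> f p \<noteq> (0::real)"
  shows "smooth_fun A W (\<lambda>p. inverse (f p))"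
  by (rule smooth_funI[OF assms(1)], rule smooth_on_inverse)
     (use assms(3) in \<open>auto intro!: smooth_funD[OF assms(2)] simp: inv_chart\<close>)

lemma smooth_fun_componentwise:
  fixes f :: "'m \<Rightarrow> 'b::euclidean_space"
  assumes "open W" "\<And>b. b \<in> Basis \<Longrightarrow> smooth_fun A W (\<lambda>p. f p \<bullet> b)"
  shows "smooth_fun A W f"
  by (rule smooth_funI[OF assms(1)], rule smooth_on_componentwise) (auto intro: smooth_funD assms(2))

lemma smooth_fun_inner: "open W \<Longrightarrow> smooth_fun A W f \<Longrightarrow> smooth_fun A W (\<lambda>p. f p \<bullet> b)"
  by (rule smooth_fun_linear_comp[OF _ bounded_linear_inner_left])

lemma smooth_fun_has_derivative:
  assumes "smooth_fun A W f" "p \<in> W" "(D, c) \<in> A" "p \<in> D"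
  shows "((f \<circ> inv_into D c) has_derivative frechet_derivative (f \<circ> inv_into D c) (at (c p))) (at (c p))"
  by (rule smooth_on_has_derivative[OF smooth_fun_in_chart[OF assms(1,3)]]) (use assms in auto)

text \<open>The chain rule for the transition from the chart chosen at \<open>p\<close> to the chart \<open>c\<close>.\<close>

lemma dirder_in_chart:
  assumes W: "open W" "smooth_fun A W f" "p \<in> W" and c: "(D, c) \<in> A" "p \<in> D"
  shows "dirder A f p v = frechet_derivative (f \<circ> inv_into D c) (at (c p)) (dirder A c p v)"
proof -
  obtain D0 c0 where c0: "chart_at A p = (D0, c0)" "(D0, c0) \<in> A" "p \<in> D0" by (rule chart_at_props)
  let ?N = "c0 ` ((W \<inter> D) \<inter> D0)"
  have N: "open ?N" "c0 p \<in> ?N"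
    using chart_image_open[OF c0(2), of "W \<inter> D"] W c c0 chart_homeomorphism(1) by auto
  have t: "((c \<circ> inv_into D0 c0) has_derivative dirder A c p) (at (c0 p))"
    using smooth_fun_has_derivative[OF smooth_fun_chart[OF c(1)] c(2) c0(2,3)]
    unfolding dirder_def c0(1) by simp
  have y: "(c \<circ> inv_into D0 c0) (c0 p) = c p" using inv_chart[OF c0(2,3)] by simp
  have "((\<lambda>z. (f \<circ> inv_into D c) ((c \<circ> inv_into D0 c0) z)) has_derivative
      (\<lambda>v. frechet_derivative (f \<circ> inv_into D c) (at (c p)) (dirder A c p v))) (at (c0 p))"
    by (rule has_derivative_compose[OF t], unfold y) (rule smooth_fun_has_derivative[OF W(2,3) c])
  then have "((f \<circ> inv_into D0 c0) has_derivative
      (\<lambda>v. frechet_derivative (f \<circ> inv_into D c) (at (c p)) (dirder A c p v))) (at (c0 p))"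
    by (rule has_derivative_transform_within_open[OF _ N])
       (auto simp: inv_chart[OF c0(2)] inv_chart[OF c(1)])
  from frechet_derivative_at[OF this] show ?thesis
    unfolding dirder_def c0(1) by (simp add: fun_eq_iff)
qed

lemma dirder_has_derivative:
  assumes "smooth_fun A W f" "p \<in> W" "chart_at A p = (D, c)"
  shows "((f \<circ> inv_into D c) has_derivative dirder A f p) (at (c p))"
proof -
  have "(D, c) \<in> A" "p \<in> D" using chart_at_props[of p] assms(3) by auto
  from smooth_fun_has_derivative[OF assms(1,2) this] show ?thesis
    unfolding dirder_def assms(3) by simp
qed

lemma dirder_linear:
  assumes "smooth_fun A W f" "p \<in> W"
  shows "linear (dirder A f p)"
  by (metis dirder_has_derivative[OF assms] chart_at_props has_derivative_linear)

lemma dirder_eqI: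
  assumes "((f \<circ> inv_into D c) has_derivative F) (at (c p))" "chart_at A p = (D, c)"
  shows "dirder A f p = F"
  using frechet_derivative_at[OF assms(1)] unfolding dirder_def assms(2) by simp

lemma dirder_cong:
  assumes "open W" "p \<in> W" "smooth_fun A W f" "\<And>q. q \<in> W \<Longrightarrow> f q = g q"
  shows "dirder A g p = dirder A f p"
proof -
  obtain D c where c: "chart_at A p = (D, c)" "(D, c) \<in> A" "p \<in> D" by (rule chart_at_props)
  show ?thesis
  proof (rule dirder_eqI[OF _ c(1)])
    show "((g \<circ> inv_into D c) has_derivative dirder A f p) (at (c p))"
      by (rule has_derivative_transform_within_open[OF dirder_has_derivative[OF assms(3,2) c(1)]
            chart_image_open[OF c(2) assms(1)]])
         (use assms c in \<open>auto simp: inv_chart[OF c(2)]\<close>)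
  qed
qed

lemma dirder_const: "dirder A (\<lambda>_. a) p v = 0"
proof -
  obtain D c where c: "chart_at A p = (D, c)" by (metis surj_pair)
  have "dirder A (\<lambda>_. a) p = (\<lambda>_. 0)"
    by (rule dirder_eqI[OF _ c]) (simp add: o_def)
  then show ?thesis by simp
qed

lemma dirder_add:
  assumes "smooth_fun A W f" "smooth_fun A W g" "p \<in> W"
  shows "dirder A (\<lambda>q. f q + g q) p v = dirder A f p v + dirder A g p v"
proof -
  obtain D c where c: "chart_at A p = (D, c)" by (metis surj_pair)
  have "dirder A (\<lambda>q. f q + g q) p = (\<lambda>v. dirder A f p v + dirder A g p v)"
    using has_derivative_add[OF dirder_has_derivative[OF assms(1,3) c] dirder_has_derivative[OF assms(2,3) c]]
    by (intro dirder_eqI[OF _ c]) (simp add: o_def)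
  then show ?thesis by simp
qed

lemma dirder_diff:
  assumes "smooth_fun A W f" "smooth_fun A W g" "p \<in> W"
  shows "dirder A (\<lambda>q. f q - g q) p v = dirder A f p v - dirder A g p v"
proof -
  obtain D c where c: "chart_at A p = (D, c)" by (metis surj_pair)
  have "dirder A (\<lambda>q. f q - g q) p = (\<lambda>v. dirder A f p v - dirder A g p v)"
    using has_derivative_diff[OF dirder_has_derivative[OF assms(1,3) c] dirder_has_derivative[OF assms(2,3) c]]
    by (intro dirder_eqI[OF _ c]) (simp add: o_def)
  then show ?thesis by simp
qed

lemma dirder_mult:
  fixes f g :: "'m \<Rightarrow> real"
  assumes "smooth_fun A W f" "smooth_fun A W g" "p \<in> W"
  shows "dirder A (\<lambda>q. f q * g q) p v = f p * dirder A g p v + dirder A f p v * g p"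
proof -
  obtain D c where c: "chart_at A p = (D, c)" "(D, c) \<in> A" "p \<in> D" by (rule chart_at_props)
  have "dirder A (\<lambda>q. f q * g q) p = (\<lambda>v. f p * dirder A g p v + dirder A f p v * g p)"
    using has_derivative_mult[OF dirder_has_derivative[OF assms(1,3) c(1)] dirder_has_derivative[OF assms(2,3) c(1)]]
    by (intro dirder_eqI[OF _ c(1)]) (simp add: o_def inv_chart[OF c(2,3)])
  then show ?thesis by simp
qed

lemma dirder_linear_comp:
  assumes "smooth_fun A W f" "p \<in> W" "bounded_linear L"
  shows "dirder A (\<lambda>q. L (f q)) p v = L (dirder A f p v)"
proof -
  obtain D c where c: "chart_at A p = (D, c)" by (metis surj_pair)
  have "dirder A (\<lambda>q. L (f q)) p = (\<lambda>v. L (dirder A f p v))"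
    using bounded_linear.has_derivative[OF assms(3) dirder_has_derivative[OF assms(1,2) c]]
    by (intro dirder_eqI[OF _ c]) (simp add: o_def)
  then show ?thesis by simp
qed

lemma dirder_own_chart:
  assumes "chart_at A p = (D, c)"
  shows "dirder A c p v = v"
proof -
  have c: "(D, c) \<in> A" "p \<in> D" using chart_at_props[of p] assms by auto
  have "dirder A c p = (\<lambda>v. v)"
  proof (rule dirder_eqI[OF _ assms])
    show "((c \<circ> inv_into D c) has_derivative (\<lambda>v. v)) (at (c p))"
      by (rule has_derivative_transform_within_open[OF has_derivative_ident chart_homeomorphism(2)[OF c(1)]])
         (use c in \<open>auto simp: f_inv_into_f\<close>)
  qed
  then show ?thesis by simp
qed

lemma inj_dirder_chart:
  assumes c: "(D, c) \<in> A" "p \<in> D"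
  shows "inj (dirder A c p)"
proof -
  obtain D0 c0 where c0: "chart_at A p = (D0, c0)" "(D0, c0) \<in> A" "p \<in> D0" by (rule chart_at_props)
  have "v = frechet_derivative (c0 \<circ> inv_into D c) (at (c p)) (dirder A c p v)" for v
    using dirder_in_chart[OF chart_homeomorphism(1)[OF c0(2)] smooth_fun_chart[OF c0(2)] c0(3) c, of v]
    by (simp add: dirder_own_chart[OF c0(1)])
  then show ?thesis by (metis injI)
qed

text \<open>By this criterion identities between fields, such as the Jacobi identity, reduce to identities
  between operators on functions.\<close>

lemma vector_eqI:
  assumes "open W" "p \<in> W"
    and "\<And>f W'. open W' \<Longrightarrow> W' \<subseteq> W \<Longrightarrow> p \<in> W' \<Longrightarrow> smooth_fun A W' (f :: 'm \<Rightarrow> real)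
      \<Longrightarrow> dirder A f p v = dirder A f p w"
  shows "v = w"
proof (rule euclidean_eqI)
  fix b :: 'a
  obtain D c where c: "chart_at A p = (D, c)" "(D, c) \<in> A" "p \<in> D" by (rule chart_at_props)
  have sm: "smooth_fun A (W \<inter> D) c" by (rule smooth_fun_subset[OF smooth_fun_chart[OF c(2)]]) simp
  have op: "open (W \<inter> D)" using assms(1) chart_homeomorphism(1)[OF c(2)] by blast
  have "dirder A (\<lambda>q. c q \<bullet> b) p v = dirder A (\<lambda>q. c q \<bullet> b) p w"
    by (rule assms(3)[OF op _ _ smooth_fun_inner[OF op sm]]) (use assms c in auto)
  then show "v \<bullet> b = w \<bullet> b"
    using dirder_linear_comp[OF sm _ bounded_linear_inner_left, of p b] assms(2) c(3)
    by (simp add: dirder_own_chart[OF c(1)])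
qed

lemma lie_derivative_smooth:
  assumes W: "open W" and X: "smooth_field A W X" and f: "smooth_fun A W f"
  shows "smooth_fun A W (lie_derivative A X f)"
  unfolding smooth_fun_def
proof clarify
  fix D c assume c: "(D, c) \<in> A"
  let ?S = "c ` (W \<inter> D)" and ?X = "(\<lambda>q. dirder A c q (X q)) \<circ> inv_into D c"
  have op: "open ?S" by (rule chart_image_open[OF c W])
  have "smooth_fun A (W \<inter> D) (\<lambda>q. dirder A c q (X q))" using X c unfolding smooth_field_def by auto
  then have "smooth_on ?S ?X" using smooth_fun_in_chart[OF _ c, of "W \<inter> D"] by (simp add: Int_assoc)
  from smooth_on_directional[OF op this smooth_fun_in_chart[OF f c]]
  show "smooth_on ?S (lie_derivative A X f \<circ> inv_into D c)"
    by (rule smooth_on_cong[OF op, rotated])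
       (auto simp: lie_derivative_def inv_chart[OF c] dirder_in_chart[OF W f _ c])
qed

text \<open>Applied to the coordinate functions of a chart, a field yields its components there.\<close>

lemma smooth_fieldI:
  assumes W: "open W"
    and X: "\<And>f W'. open W' \<Longrightarrow> W' \<subseteq> W \<Longrightarrow> smooth_fun A W' f \<Longrightarrow> smooth_fun A W' (lie_derivative A X f)"
  shows "smooth_field A W X"
  unfolding smooth_field_def
proof clarify
  fix D c assume c: "(D, c) \<in> A"
  have op: "open (W \<inter> D)" using W chart_homeomorphism(1)[OF c] by blast
  have sm: "smooth_fun A (W \<inter> D) c" by (rule smooth_fun_subset[OF smooth_fun_chart[OF c]]) simp
  show "smooth_fun A (W \<inter> D) (\<lambda>q. dirder A c q (X q))"
  proof (rule smooth_fun_componentwise[OF op])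
    fix b :: 'a
    have "smooth_fun A (W \<inter> D) (lie_derivative A X (\<lambda>q. c q \<bullet> b))"
      by (rule X[OF op _ smooth_fun_inner[OF op sm]]) simp
    then show "smooth_fun A (W \<inter> D) (\<lambda>q. dirder A c q (X q) \<bullet> b)"
      by (rule smooth_fun_cong[OF op, rotated])
         (simp add: lie_derivative_def dirder_linear_comp[OF sm _ bounded_linear_inner_left])
  qed
qed

lemma smooth_field_subset: "smooth_field A W X \<Longrightarrow> W' \<subseteq> W \<Longrightarrow> smooth_field A W' X"
  unfolding smooth_field_def by (fast intro: smooth_fun_subset)

lemma smooth_field_cong:
  assumes "open W" "\<And>p. p \<in> W \<Longrightarrow> X p = Y p" "smooth_field A W X"
  shows "smooth_field A W Y"
proof (rule smooth_fieldI[OF assms(1)])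
  fix f :: "'m \<Rightarrow> real" and W' assume W': "open W'" "W' \<subseteq> W" "smooth_fun A W' f"
  show "smooth_fun A W' (lie_derivative A Y f)"
    by (rule smooth_fun_cong[OF W'(1) _ lie_derivative_smooth[OF W'(1) smooth_field_subset[OF assms(3) W'(2)] W'(3)]])
       (use W' assms in \<open>auto simp: lie_derivative_def\<close>)
qed

lemma smooth_field_local:
  assumes "open W" "\<And>p. p \<in> W \<Longrightarrow> \<exists>W'. open W' \<and> p \<in> W' \<and> smooth_field A W' X"
  shows "smooth_field A W X"
proof (rule smooth_fieldI[OF assms(1)])
  fix f :: "'m \<Rightarrow> real" and W0 assume W0: "open W0" "W0 \<subseteq> W" "smooth_fun A W0 f"
  show "smooth_fun A W0 (lie_derivative A X f)"
  proof (rule smooth_fun_local)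
    fix p assume p: "p \<in> W0"
    then obtain W' where W': "open W'" "p \<in> W'" "smooth_field A W' X" using assms(2) W0 by blast
    have "smooth_fun A (W0 \<inter> W') (lie_derivative A X f)"
      by (rule lie_derivative_smooth) (use W0 W' in \<open>auto intro: smooth_fun_subset smooth_field_subset\<close>)
    then show "\<exists>W'. open W' \<and> p \<in> W' \<and> smooth_fun A W' (lie_derivative A X f)"
      using W0 W' p by (intro exI[of _ "W0 \<inter> W'"]) auto
  qed
qed

lemma smooth_field_add:
  assumes W: "open W" and "smooth_field A W X" "smooth_field A W Y"
  shows "smooth_field A W (\<lambda>q. X q + Y q)"
proof (rule smooth_fieldI[OF W])
  fix f :: "'m \<Rightarrow> real" and W' assume W': "open W'" "W' \<subseteq> W" "smooth_fun A W' f"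
  have "smooth_fun A W' (\<lambda>q. lie_derivative A X f q + lie_derivative A Y f q)"
    by (intro smooth_fun_add lie_derivative_smooth W' smooth_field_subset[OF assms(2) W'(2)] smooth_field_subset[OF assms(3) W'(2)])
  then show "smooth_fun A W' (lie_derivative A (\<lambda>q. X q + Y q) f)"
    by (rule smooth_fun_cong[OF W'(1), rotated])
       (simp add: lie_derivative_def linear_add[OF dirder_linear[OF W'(3)]])
qed

lemma smooth_field_scaleR:
  assumes W: "open W" and "smooth_fun A W g" "smooth_field A W X"
  shows "smooth_field A W (\<lambda>q. g q *\<^sub>R X q)"
proof (rule smooth_fieldI[OF W])
  fix f :: "'m \<Rightarrow> real" and W' assume W': "open W'" "W' \<subseteq> W" "smooth_fun A W' f"
  have "smooth_fun A W' (\<lambda>q. g q * lie_derivative A X f q)"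
    by (intro smooth_fun_mult lie_derivative_smooth W' smooth_field_subset[OF assms(3) W'(2)] smooth_fun_subset[OF assms(2) W'(2)])
  then show "smooth_fun A W' (lie_derivative A (\<lambda>q. g q *\<^sub>R X q) f)"
    by (rule smooth_fun_cong[OF W'(1), rotated])
       (simp add: lie_derivative_def linear_scale[OF dirder_linear[OF W'(3)]])
qed

lemma smooth_field_zero: "open W \<Longrightarrow> smooth_field A W (\<lambda>_. 0)"
  by (rule smooth_fieldI, assumption, rule smooth_fun_cong[OF _ _ smooth_fun_const[where a = 0]])
     (auto simp: lie_derivative_def linear_0[OF dirder_linear])

lemma smooth_field_diff:
  assumes W: "open W" and "smooth_field A W X" "smooth_field A W Y"
  shows "smooth_field A W (\<lambda>q. X q - Y q)"
  using smooth_field_add[OF W assms(2) smooth_field_scaleR[OF W smooth_fun_const[OF W, of "-1"] assms(3)]]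
  by simp

lemma smooth_field_sum:
  assumes W: "open W" and "\<And>i. i \<in> I \<Longrightarrow> smooth_field A W (X i)"
  shows "smooth_field A W (\<lambda>q. \<Sum>i\<in>I. X i q)"
  using assms(2)
  by (induction I rule: infinite_finite_induct) (auto intro: smooth_field_add smooth_field_zero W)

text \<open>In the chart chosen at the point, the terms with second derivatives of \<open>f\<close> cancel by
  \<open>second_derivative_symmetric\<close>.\<close>

lemma dirder_lie_bracket:
  assumes W: "open W" "p \<in> W" and X: "smooth_field A W X" and Y: "smooth_field A W Y"
    and f: "smooth_fun A W (f :: 'm \<Rightarrow> real)"
  shows "dirder A f p (lie_bracket A X Y p) =
    lie_derivative A X (lie_derivative A Y f) p - lie_derivative A Y (lie_derivative A X f) p"
proof -
  obtain D c where c: "chart_at A p = (D, c)" "(D, c) \<in> A" "p \<in> D" by (rule chart_at_props)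
  let ?S = "c ` (W \<inter> D)" and ?F = "f \<circ> inv_into D c"
  have op: "open ?S" by (rule chart_image_open[OF c(2) W(1)])
  have pS: "c p \<in> ?S" using W c by auto
  have F: "smooth_on ?S ?F" by (rule smooth_fun_in_chart[OF f c(2)])
  have DF: "dirder A f p v = frechet_derivative ?F (at (c p)) v" for v
    using dirder_in_chart[OF W(1) f W(2) c(2,3)] by (simp add: dirder_own_chart[OF c(1)])
  \<comment> \<open>the second derivative of \<open>f\<close> in the chart\<close>
  define H where "H u v = frechet_derivative (\<lambda>x. frechet_derivative ?F (at x) u) (at (c p)) v" for u v
  have sym: "H u v = H v u" for u v
    unfolding H_def by (rule second_derivative_symmetric[OF op F pS])
  have main: "lie_derivative A X (lie_derivative A Y f) p =
      H (Y p) (X p) + dirder A f p (dirder A (\<lambda>q. dirder A c q (Y q)) p (X p))"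
    if X: "smooth_field A W X" and Y: "smooth_field A W Y" for X Y
  proof -
    let ?Yc = "\<lambda>q. dirder A c q (Y q)"
    have Yc: "smooth_fun A (W \<inter> D) ?Yc" using Y c(2) unfolding smooth_field_def by auto
    have Ycd: "((?Yc \<circ> inv_into D c) has_derivative dirder A ?Yc p) (at (c p))"
      by (rule dirder_has_derivative[OF Yc _ c(1)]) (use W c in auto)
    have Yp: "?Yc p = Y p" by (rule dirder_own_chart[OF c(1)])
    have "((\<lambda>y. \<Sum>b\<in>Basis. ((?Yc \<circ> inv_into D c) y \<bullet> b) * frechet_derivative ?F (at y) b) has_derivative
       (\<lambda>v. \<Sum>b\<in>Basis. ((?Yc \<circ> inv_into D c) (c p) \<bullet> b) * H b v
          + (dirder A ?Yc p v \<bullet> b) * frechet_derivative ?F (at (c p)) b)) (at (c p))"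
      unfolding H_def
      by (intro has_derivative_sum has_derivative_mult has_derivative_inner_left Ycd
          smooth_on_has_derivative[OF smooth_on_derivative[OF F] pS])
    then have d: "((lie_derivative A Y f \<circ> inv_into D c) has_derivative
       (\<lambda>v. \<Sum>b\<in>Basis. ((?Yc \<circ> inv_into D c) (c p) \<bullet> b) * H b v
          + (dirder A ?Yc p v \<bullet> b) * frechet_derivative ?F (at (c p)) b)) (at (c p))"
    proof (rule has_derivative_transform_within_open[OF _ op pS])
      fix y assume "y \<in> ?S"
      then obtain q where q: "q \<in> W" "q \<in> D" "y = c q" by auto
      have "linear (frechet_derivative ?F (at y))"
        using smooth_on_has_derivative[OF F] \<open>y \<in> ?S\<close> has_derivative_linear by blast
      from linear_basis_expansion[OF this, of "?Yc q"]
      show "(\<Sum>b\<in>Basis. ((?Yc \<circ> inv_into D c) y \<bullet> b) * frechet_derivative ?F (at y) b)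
          = (lie_derivative A Y f \<circ> inv_into D c) y"
        using q dirder_in_chart[OF W(1) f q(1) c(2) q(2)] by (simp add: lie_derivative_def inv_chart[OF c(2)])
    qed
    have linF: "linear (dirder A f p)" by (rule dirder_linear[OF f W(2)])
    have linH: "linear (\<lambda>u. H u v)" for v
    proof -
      have "linear (H v)"
        unfolding H_def
        using smooth_on_has_derivative[OF smooth_on_derivative[OF F] pS] has_derivative_linear by blast
      moreover have "(\<lambda>u. H u v) = H v" using sym by blast
      ultimately show ?thesis by simp
    qed
    have "lie_derivative A X (lie_derivative A Y f) p =
       (\<Sum>b\<in>Basis. (Y p \<bullet> b) * H b (X p) + (dirder A ?Yc p (X p) \<bullet> b) * dirder A f p b)"
      using dirder_eqI[OF d c(1)] inv_chart[OF c(2,3)] Yp unfolding lie_derivative_def DF by simp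
    also have "\<dots> = (\<Sum>b\<in>Basis. (Y p \<bullet> b) * H b (X p)) + (\<Sum>b\<in>Basis. (dirder A ?Yc p (X p) \<bullet> b) * dirder A f p b)"
      by (rule sum.distrib)
    also have "\<dots> = H (Y p) (X p) + dirder A f p (dirder A ?Yc p (X p))"
      using linear_basis_expansion[OF linH, of "Y p" "X p"] linear_basis_expansion[OF linF, of "dirder A ?Yc p (X p)"]
      by simp
    finally show ?thesis .
  qed
  have "lie_bracket A X Y p = dirder A (\<lambda>q. dirder A c q (Y q)) p (X p) - dirder A (\<lambda>q. dirder A c q (X q)) p (Y p)"
    unfolding lie_bracket_def c(1) by simp
  then show ?thesis
    using main[OF X Y] main[OF Y X] sym[of "X p" "Y p"] linear_diff[OF dirder_linear[OF f W(2)]] by simp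
qed

lemma lie_derivative_cong:
  assumes "open W" "p \<in> W" "smooth_fun A W f" "\<And>q. q \<in> W \<Longrightarrow> f q = g q"
  shows "lie_derivative A X g p = lie_derivative A X f p"
  unfolding lie_derivative_def using dirder_cong[OF assms] by simp

lemma smooth_field_lie_bracket:
  assumes W: "open W" and X: "smooth_field A W X" and Y: "smooth_field A W Y"
  shows "smooth_field A W (lie_bracket A X Y)"
proof (rule smooth_fieldI[OF W])
  fix f :: "'m \<Rightarrow> real" and W' assume W': "open W'" "W' \<subseteq> W" "smooth_fun A W' f"
  note X' = smooth_field_subset[OF X W'(2)] and Y' = smooth_field_subset[OF Y W'(2)]
  have "smooth_fun A W' (\<lambda>q. lie_derivative A X (lie_derivative A Y f) q - lie_derivative A Y (lie_derivative A X f) q)"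
    by (intro smooth_fun_diff lie_derivative_smooth W' X' Y')
  then show "smooth_fun A W' (lie_derivative A (lie_bracket A X Y) f)"
    by (rule smooth_fun_cong[OF W'(1), rotated])
       (simp add: lie_derivative_def[of A "lie_bracket A X Y"] dirder_lie_bracket[OF W'(1) _ X' Y' W'(3)])
qed

lemma lie_bracket_swap: "lie_bracket A Y X p = - lie_bracket A X Y p"
  unfolding lie_bracket_def Let_def by simp

lemma lie_bracket_cong:
  assumes W: "open W" "p \<in> W" and X: "smooth_field A W X" and Y: "smooth_field A W Y"
    and eq: "\<And>q. q \<in> W \<Longrightarrow> X q = X' q" "\<And>q. q \<in> W \<Longrightarrow> Y q = Y' q"
  shows "lie_bracket A X' Y' p = lie_bracket A X Y p"
proof -
  obtain D c where c: "chart_at A p = (D, c)" "(D, c) \<in> A" "p \<in> D" by (rule chart_at_props)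
  have op: "open (W \<inter> D)" "p \<in> W \<inter> D" using W c chart_homeomorphism(1) by auto
  have sm: "smooth_fun A (W \<inter> D) (\<lambda>q. dirder A c q (X q))" "smooth_fun A (W \<inter> D) (\<lambda>q. dirder A c q (Y q))"
    using X Y c(2) unfolding smooth_field_def by auto
  have "dirder A (\<lambda>q. dirder A c q (X' q)) p = dirder A (\<lambda>q. dirder A c q (X q)) p"
    by (rule dirder_cong[OF op sm(1)]) (use eq in auto)
  moreover have "dirder A (\<lambda>q. dirder A c q (Y' q)) p = dirder A (\<lambda>q. dirder A c q (Y q)) p"
    by (rule dirder_cong[OF op sm(2)]) (use eq in auto)
  ultimately show ?thesis unfolding lie_bracket_def c(1) using eq[OF W(2)] by simp
qed

lemma lie_bracket_add_right:
  assumes W: "open W" "p \<in> W" and X: "smooth_field A W X" and Y: "smooth_field A W Y" and Z: "smooth_field A W Z"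
  shows "lie_bracket A X (\<lambda>q. Y q + Z q) p = lie_bracket A X Y p + lie_bracket A X Z p"
proof (rule vector_eqI[OF W])
  fix f :: "'m \<Rightarrow> real" and W' assume W': "open W'" "W' \<subseteq> W" "p \<in> W'" "smooth_fun A W' (f :: 'm \<Rightarrow> real)"
  note X' = smooth_field_subset[OF X W'(2)] and Y' = smooth_field_subset[OF Y W'(2)] and Z' = smooth_field_subset[OF Z W'(2)]
  note S = smooth_field_add[OF W'(1) Y' Z']
  have e: "lie_derivative A (\<lambda>q. Y q + Z q) g q = lie_derivative A Y g q + lie_derivative A Z g q"
    if "q \<in> W'" "smooth_fun A W' g" for q g
    by (simp add: lie_derivative_def linear_add[OF dirder_linear[OF that(2,1)]])
  note ls = lie_derivative_smooth[OF W'(1)]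
  have "lie_derivative A X (lie_derivative A (\<lambda>q. Y q + Z q) f) p
      = lie_derivative A X (\<lambda>q. lie_derivative A Y f q + lie_derivative A Z f q) p"
    by (rule lie_derivative_cong[OF W'(1,3)])
       (auto simp: e[OF _ W'(4)] intro!: smooth_fun_add W' ls Y' Z')
  also have "\<dots> = lie_derivative A X (lie_derivative A Y f) p + lie_derivative A X (lie_derivative A Z f) p"
    unfolding lie_derivative_def[of A X]
    by (rule dirder_add[OF ls[OF Y' W'(4)] ls[OF Z' W'(4)] W'(3)])
  finally show "dirder A f p (lie_bracket A X (\<lambda>q. Y q + Z q) p) = dirder A f p (lie_bracket A X Y p + lie_bracket A X Z p)"
    using e[OF W'(3) ls[OF X' W'(4)]]
    by (simp add: linear_add[OF dirder_linear[OF W'(4,3)]] dirder_lie_bracket[OF W'(1,3) X' _ W'(4)] Y' Z' S)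
qed

lemma lie_bracket_scale_right:
  assumes W: "open W" "p \<in> W" and X: "smooth_field A W X" and Y: "smooth_field A W Y" and g: "smooth_fun A W g"
  shows "lie_bracket A X (\<lambda>q. g q *\<^sub>R Y q) p = lie_derivative A X g p *\<^sub>R Y p + g p *\<^sub>R lie_bracket A X Y p"
proof (rule vector_eqI[OF W])
  fix f :: "'m \<Rightarrow> real" and W' assume W': "open W'" "W' \<subseteq> W" "p \<in> W'" "smooth_fun A W' (f :: 'm \<Rightarrow> real)"
  note X' = smooth_field_subset[OF X W'(2)] and Y' = smooth_field_subset[OF Y W'(2)] and g' = smooth_fun_subset[OF g W'(2)]
  note S = smooth_field_scaleR[OF W'(1) g' Y']
  have e: "lie_derivative A (\<lambda>q. g q *\<^sub>R Y q) h q = g q * lie_derivative A Y h q"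
    if "q \<in> W'" "smooth_fun A W' h" for q h
    by (simp add: lie_derivative_def linear_scale[OF dirder_linear[OF that(2,1)]])
  note ls = lie_derivative_smooth[OF W'(1)]
  have "lie_derivative A X (lie_derivative A (\<lambda>q. g q *\<^sub>R Y q) f) p
      = lie_derivative A X (\<lambda>q. g q * lie_derivative A Y f q) p"
    by (rule lie_derivative_cong[OF W'(1,3)])
       (auto simp: e[OF _ W'(4)] intro!: smooth_fun_mult W' ls Y' g')
  also have "\<dots> = g p * lie_derivative A X (lie_derivative A Y f) p + lie_derivative A X g p * lie_derivative A Y f p"
    unfolding lie_derivative_def[of A X]
    by (rule dirder_mult[OF g' ls[OF Y' W'(4)] W'(3)])
  finally show "dirder A f p (lie_bracket A X (\<lambda>q. g q *\<^sub>R Y q) p) =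
      dirder A f p (lie_derivative A X g p *\<^sub>R Y p + g p *\<^sub>R lie_bracket A X Y p)"
    using e[OF W'(3) ls[OF X' W'(4)]]
    by (simp add: linear_add[OF dirder_linear[OF W'(4,3)]] linear_scale[OF dirder_linear[OF W'(4,3)]]
        dirder_lie_bracket[OF W'(1,3) X' _ W'(4)] Y' S right_diff_distrib)
       (simp add: lie_derivative_def)
qed

lemma lie_bracket_scale_left:
  assumes W: "open W" "p \<in> W" and X: "smooth_field A W X" and Y: "smooth_field A W Y" and g: "smooth_fun A W g"
  shows "lie_bracket A (\<lambda>q. g q *\<^sub>R X q) Y p = g p *\<^sub>R lie_bracket A X Y p - lie_derivative A Y g p *\<^sub>R X p"
  unfolding lie_bracket_swap[of "\<lambda>q. g q *\<^sub>R X q" Y p] lie_bracket_scale_right[OF W Y X g]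
  by (simp add: lie_bracket_swap[of X Y p])

lemma lie_bracket_add_left:
  assumes W: "open W" "p \<in> W" and X: "smooth_field A W X" and Y: "smooth_field A W Y" and Z: "smooth_field A W Z"
  shows "lie_bracket A (\<lambda>q. X q + Y q) Z p = lie_bracket A X Z p + lie_bracket A Y Z p"
  unfolding lie_bracket_swap[of _ Z p] lie_bracket_add_right[OF W Z X Y] by simp

lemma lie_bracket_sum_right:
  assumes W: "open W" "p \<in> W" and X: "smooth_field A W X" and "finite I" "\<And>i. i \<in> I \<Longrightarrow> smooth_field A W (Y i)"
  shows "lie_bracket A X (\<lambda>q. \<Sum>i\<in>I. Y i q) p = (\<Sum>i\<in>I. lie_bracket A X (Y i) p)"
  using assms(4,5)
proof (induction I)
  case empty
  have "lie_bracket A X (\<lambda>q. 0 *\<^sub>R 0) p = 0"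
    using lie_bracket_scale_right[OF W X smooth_field_zero[OF W(1)] smooth_fun_const[OF W(1), of 0]]
    by (simp add: lie_derivative_def dirder_const)
  then show ?case by simp
next
  case (insert i I)
  then show ?case
    using lie_bracket_add_right[OF W X, of "Y i" "\<lambda>q. \<Sum>i\<in>I. Y i q"] smooth_field_sum[OF W(1), of I Y] by simp
qed

text \<open>On a function both sides are the same combination of third derivatives along \<open>X\<close>, \<open>Y\<close> and \<open>Z\<close>.\<close>

lemma jacobi:
  assumes W: "open W" "p \<in> W" and X: "smooth_field A W X" and Y: "smooth_field A W Y" and Z: "smooth_field A W Z"
  shows "lie_bracket A X (lie_bracket A Y Z) p =
    lie_bracket A (lie_bracket A X Y) Z p + lie_bracket A Y (lie_bracket A X Z) p"
proof (rule vector_eqI[OF W])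
  fix f :: "'m \<Rightarrow> real" and W' assume W': "open W'" "W' \<subseteq> W" "p \<in> W'" "smooth_fun A W' (f :: 'm \<Rightarrow> real)"
  note X' = smooth_field_subset[OF X W'(2)] and Y' = smooth_field_subset[OF Y W'(2)] and Z' = smooth_field_subset[OF Z W'(2)]
  note ls = lie_derivative_smooth[OF W'(1)] and bs = smooth_field_lie_bracket[OF W'(1)]
  have e: "lie_derivative A (lie_bracket A U V) g q =
      lie_derivative A U (lie_derivative A V g) q - lie_derivative A V (lie_derivative A U g) q"
    if "q \<in> W'" "smooth_fun A W' g" "smooth_field A W' U" "smooth_field A W' V" for q g U V
    unfolding lie_derivative_def[of A "lie_bracket A U V"]
    by (rule dirder_lie_bracket[OF W'(1) that(1) that(3,4,2)])
  have e2: "lie_derivative A T (lie_derivative A (lie_bracket A U V) f) p =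
      lie_derivative A T (lie_derivative A U (lie_derivative A V f)) p - lie_derivative A T (lie_derivative A V (lie_derivative A U f)) p"
    if T: "smooth_field A W' T" and U: "smooth_field A W' U" and V: "smooth_field A W' V" for T U V
  proof -
    note s = ls[OF U ls[OF V W'(4)]] ls[OF V ls[OF U W'(4)]]
    have "lie_derivative A T (lie_derivative A (lie_bracket A U V) f) p =
       lie_derivative A T (\<lambda>q. lie_derivative A U (lie_derivative A V f) q - lie_derivative A V (lie_derivative A U f) q) p"
      by (rule lie_derivative_cong[OF W'(1,3) smooth_fun_diff[OF W'(1) s]]) (simp add: e W'(4) U V)
    then show ?thesis unfolding lie_derivative_def[of A T] using dirder_diff[OF s W'(3)] by simp
  qed
  show "dirder A f p (lie_bracket A X (lie_bracket A Y Z) p) =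
      dirder A f p (lie_bracket A (lie_bracket A X Y) Z p + lie_bracket A Y (lie_bracket A X Z) p)"
    by (simp add: linear_add[OF dirder_linear[OF W'(4,3)]] dirder_lie_bracket[OF W'(1,3) _ _ W'(4)]
        X' Y' Z' bs e e2 W' ls)
qed

end

section \<open>Bundles, derived bundles and Cauchy fields\<close>

text \<open>Families rather than sets, so that repeated vectors count as dependent.\<close>

definition independent_family :: "'i set \<Rightarrow> ('i \<Rightarrow> 'v::real_vector) \<Rightarrow> bool" where
  "independent_family I v \<longleftrightarrow> (\<forall>a. (\<Sum>i\<in>I. a i *\<^sub>R v i) = 0 \<longrightarrow> (\<forall>i\<in>I. a i = 0))"

lemma independent_familyD:
  "independent_family I v \<Longrightarrow> (\<Sum>i\<in>I. a i *\<^sub>R v i) = 0 \<Longrightarrow> i \<in> I \<Longrightarrow> a i = 0"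
  unfolding independent_family_def by blast

lemma span_image_finite:
  fixes v :: "'i \<Rightarrow> 'v::real_vector"
  assumes "finite I"
  shows "w \<in> span (v ` I) \<longleftrightarrow> (\<exists>a. w = (\<Sum>i\<in>I. a i *\<^sub>R v i))"
proof
  show "\<exists>a. w = (\<Sum>i\<in>I. a i *\<^sub>R v i) \<Longrightarrow> w \<in> span (v ` I)"
    by (elim exE, simp only:, intro span_sum span_scale span_base imageI)
  assume "w \<in> span (v ` I)"
  then show "\<exists>a. w = (\<Sum>i\<in>I. a i *\<^sub>R v i)"
  proof (induction rule: span_induct_alt)
    case base then show ?case by (intro exI[of _ "\<lambda>_. 0"]) simp
  next
    case (step c x y)
    then obtain a j where a: "y = (\<Sum>i\<in>I. a i *\<^sub>R v i)" "j \<in> I" "x = v j" by auto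
    have "c *\<^sub>R x + y = (\<Sum>i\<in>I. (a i + (if i = j then c else 0)) *\<^sub>R v i)"
      using assms a by (simp add: scaleR_add_left sum.distrib if_distrib[of "\<lambda>t. t *\<^sub>R _"] sum.delta' cong: if_cong)
    then show ?case by (intro exI[of _ "\<lambda>i. a i + (if i = j then c else 0)"])
  qed
qed

lemma independent_family_iff:
  fixes v :: "'i \<Rightarrow> 'v::real_vector"
  assumes "finite I"
  shows "independent_family I v \<longleftrightarrow> inj_on v I \<and> independent (v ` I)"
proof
  assume ind: "independent_family I v"
  have inj: "inj_on v I"
  proof (rule inj_onI, rule ccontr)
    fix i j assume ij: "i \<in> I" "j \<in> I" "v i = v j" "i \<noteq> j"
    define a where "a t = (if t = i then (1::real) else if t = j then -1 else 0)" for t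
    have "(\<Sum>t\<in>I. a t *\<^sub>R v t) = (\<Sum>t\<in>{i, j}. a t *\<^sub>R v t)"
      using ij assms by (intro sum.mono_neutral_right) (auto simp: a_def)
    also have "\<dots> = 0" using ij by (simp add: a_def)
    finally show False using independent_familyD[OF ind _ ij(1), of a] by (simp add: a_def)
  qed
  moreover have "independent (v ` I)"
  proof
    assume "dependent (v ` I)"
    then obtain u where u: "(\<Sum>w\<in>v ` I. u w *\<^sub>R w) = 0" "\<exists>w\<in>v ` I. u w \<noteq> 0"
      using assms by (auto simp: dependent_finite)
    from u(1) have "(\<Sum>i\<in>I. u (v i) *\<^sub>R v i) = 0" by (simp add: sum.reindex[OF inj])
    from independent_familyD[OF ind this] u(2) show False by auto
  qed
  ultimately show "inj_on v I \<and> independent (v ` I)" ..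
next
  assume *: "inj_on v I \<and> independent (v ` I)"
  show "independent_family I v"
    unfolding independent_family_def
  proof (intro allI impI ballI)
    fix a i assume a: "(\<Sum>i\<in>I. a i *\<^sub>R v i) = 0" and i: "i \<in> I"
    let ?u = "\<lambda>w. a (inv_into I v w)"
    have "(\<Sum>w\<in>v ` I. ?u w *\<^sub>R w) = (\<Sum>i\<in>I. a i *\<^sub>R v i)"
      using * by (simp add: sum.reindex)
    then have z: "(\<Sum>w\<in>v ` I. ?u w *\<^sub>R w) = 0" using a by simp
    have "\<not> (\<exists>w\<in>v ` I. ?u w \<noteq> 0)"
    proof
      assume "\<exists>w\<in>v ` I. ?u w \<noteq> 0"
      then have "dependent (v ` I)"
        unfolding dependent_finite[OF finite_imageI[OF assms]] by (intro exI[of _ ?u] conjI z)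
      then show False using * by simp
    qed
    then have "?u (v i) = 0" using i by blast
    then show "a i = 0" using * i by simp
  qed
qed

lemma independent_family_dim_span:
  fixes v :: "'i \<Rightarrow> 'v::euclidean_space"
  assumes "finite I" "independent_family I v"
  shows "dim (span (v ` I)) = card I"
  using assms by (simp add: independent_family_iff dim_eq_card_independent card_image)

text \<open>A family that is independent at \<open>p\<close> is completed by constant vectors to one that is a basis near
  \<open>p\<close>. The coefficients of a smooth map then solve a linear system with smooth matrix.\<close>

lemma smooth_frame_coefficients:
  fixes Y :: "'i \<Rightarrow> 'a::euclidean_space \<Rightarrow> 'a"
  assumes "open S" "p \<in> S" "finite I" and Y: "\<And>i. i \<in> I \<Longrightarrow> smooth_on S (Y i)"
    and ind: "independent_family I (\<lambda>i. Y i p)"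
  obtains T where "open T" "p \<in> T" "T \<subseteq> S"
    "\<And>z. z \<in> T \<Longrightarrow> independent_family I (\<lambda>i. Y i z)"
    "\<forall>T' X a. open T' \<longrightarrow> T' \<subseteq> T \<longrightarrow> smooth_on T' X \<longrightarrow> (\<forall>z\<in>T'. X z = (\<Sum>i\<in>I. a i z *\<^sub>R Y i z))
       \<longrightarrow> (\<forall>i\<in>I. smooth_on T' (a i))"
proof -
  let ?v = "\<lambda>i. Y i p"
  have vI: "inj_on ?v I" "independent (?v ` I)" using ind assms(3) by (auto simp: independent_family_iff)
  obtain C where C: "?v ` I \<subseteq> C" "independent C" "UNIV \<subseteq> span C"
    using maximal_independent_subset_extend[of "?v ` I" UNIV] vI(2) by auto
  have finC: "finite C" using C(2) independent_imp_finite by blast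
  have "card C = DIM('a)" using C(2,3) dim_eq_card[of C UNIV] by (metis dim_UNIV span_UNIV top.extremum_uniqueI)
  then obtain g where g: "bij_betw g (Basis :: 'a set) C"
    using finite_same_card_bij[OF finite_Basis finC] by metis
  define \<sigma> where "\<sigma> i = inv_into Basis g (?v i)" for i
  have \<sigma>: "\<sigma> i \<in> Basis" "g (\<sigma> i) = ?v i" if "i \<in> I" for i
    using g C(1) that unfolding \<sigma>_def bij_betw_def
    by (metis imageI inv_into_into subsetD, metis f_inv_into_f imageI subsetD)
  have \<sigma>inj: "inj_on \<sigma> I" using \<sigma> vI(1) unfolding inj_on_def by metis
  \<comment> \<open>the frame, completed to a basis by constant vectors\<close>
  define E where "E b z = (if b \<in> \<sigma> ` I then Y (inv_into I \<sigma> b) z else g b)" for b z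
  have E\<sigma>: "E (\<sigma> i) z = Y i z" if "i \<in> I" for i z using that \<sigma>inj by (simp add: E_def)
  have Ep: "E b p = g b" if "b \<in> Basis" for b
    using \<sigma>inj \<sigma> by (auto simp: E_def)
  define L where "L z u = (\<Sum>b\<in>Basis. (u \<bullet> b) *\<^sub>R E b z)" for z u
  have lin: "linear (L z)" for z
    unfolding L_def by (intro linear_compose_sum ballI linear_compose_scale_right[OF bounded_linear.linear[OF bounded_linear_inner_left], unfolded o_def] linearI) (auto simp: inner_add_left scaleR_add_left)
  have E: "smooth_on S (E b)" for b
    unfolding E_def using Y inv_into_into[of b \<sigma> I]
    by (cases "b \<in> \<sigma> ` I") (auto intro: smooth_on_const[OF assms(1)])
  have L: "smooth_on S (\<lambda>z. L z u)" for u
  proof -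
    have "higher_diff n S (\<lambda>z. L z u)" for n
      unfolding L_def using E
      by (intro higher_diff_sum higher_diff_scaleR higher_diff_const assms(1)) (simp add: smooth_on_def)
    then show ?thesis by (simp add: smooth_on_def)
  qed
  have indg: "independent_family Basis g"
    using g C(2) by (simp add: independent_family_iff bij_betw_def)
  have injp: "inj (L p)"
  proof -
    have "u = 0" if u: "L p u = 0" for u
    proof (rule euclidean_eqI)
      fix b :: 'a assume b: "b \<in> Basis"
      have "L p u = (\<Sum>b\<in>Basis. (u \<bullet> b) *\<^sub>R g b)"
        unfolding L_def by (intro sum.cong refl) (simp add: Ep)
      with u have "(\<Sum>b\<in>Basis. (u \<bullet> b) *\<^sub>R g b) = 0" by simp
      from independent_familyD[of Basis g "\<lambda>b. u \<bullet> b", OF indg this b] show "u \<bullet> b = 0 \<bullet> b" by simp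
    qed
    then show ?thesis using linear_injective_0[OF lin, of p] by blast
  qed
  obtain c T where T: "c > 0" "open T" "p \<in> T" "T \<subseteq> S" "\<And>z u. z \<in> T \<Longrightarrow> c * norm u \<le> norm (L z u)"
    by (rule linear_family_bounded_below[OF assms(1,2) smooth_on_continuous[OF L] lin injp]) (rule that)
  have inj: "inj (L z)" if z: "z \<in> T" for z
  proof -
    have "u = 0" if "L z u = 0" for u
    proof -
      have "c * norm u \<le> 0" using T(5)[OF z, of u] that by simp
      then show "u = 0" using T(1) by (simp add: mult_le_0_iff)
    qed
    then show ?thesis using linear_injective_0[OF lin, of z] by blast
  qed
  have Lsum: "L z (\<Sum>i\<in>I. a i *\<^sub>R \<sigma> i) = (\<Sum>i\<in>I. a i *\<^sub>R Y i z)" for z a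
  proof -
    have "L z (\<sigma> i) = Y i z" if "i \<in> I" for i
    proof -
      have "L z (\<sigma> i) = (\<Sum>b\<in>Basis. if b = \<sigma> i then E b z else 0)"
        unfolding L_def using \<sigma>(1)[OF that] by (intro sum.cong) (auto simp: inner_Basis)
      also have "\<dots> = Y i z" using \<sigma>(1)[OF that] E\<sigma>[OF that] by simp
      finally show ?thesis .
    qed
    then show ?thesis using lin by (simp add: linear_sum linear_scale)
  qed
  have comp: "(\<Sum>i\<in>I. a i *\<^sub>R \<sigma> i) \<bullet> \<sigma> j = a j" if "j \<in> I" for a j
  proof -
    have "(\<Sum>i\<in>I. a i *\<^sub>R \<sigma> i) \<bullet> \<sigma> j = (\<Sum>i\<in>I. if i = j then a j else 0)"
      unfolding inner_sum_left using \<sigma>(1) \<sigma>inj that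
      by (intro sum.cong) (auto simp: inner_Basis inj_on_def)
    then show ?thesis using that assms(3) by simp
  qed
  show ?thesis
  proof (rule that[OF T(2,3,4)])
    fix z assume z: "z \<in> T"
    show "independent_family I (\<lambda>i. Y i z)"
      unfolding independent_family_def
    proof (intro allI impI ballI)
      fix a i assume "(\<Sum>i\<in>I. a i *\<^sub>R Y i z) = 0" "i \<in> I"
      then have "L z (\<Sum>i\<in>I. a i *\<^sub>R \<sigma> i) = 0" by (simp add: Lsum)
      then have "(\<Sum>i\<in>I. a i *\<^sub>R \<sigma> i) = 0" using inj[OF z] lin linear_injective_0 by blast
      then show "a i = 0" using comp[OF \<open>i \<in> I\<close>, of a] by simp
    qed
  next
    show "\<forall>T' X a. open T' \<longrightarrow> T' \<subseteq> T \<longrightarrow> smooth_on T' X \<longrightarrow> (\<forall>z\<in>T'. X z = (\<Sum>i\<in>I. a i z *\<^sub>R Y i z))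
       \<longrightarrow> (\<forall>i\<in>I. smooth_on T' (a i))"
    proof (intro allI impI)
      fix T' X and a :: "'i \<Rightarrow> 'a \<Rightarrow> real" assume T': "open T'" "T' \<subseteq> T" "smooth_on T' X"
        "\<forall>z\<in>T'. X z = (\<Sum>i\<in>I. a i z *\<^sub>R Y i z)"
      have "smooth_on T' (\<lambda>z. \<Sum>i\<in>I. a i z *\<^sub>R \<sigma> i)"
      proof (rule linear_solution_smooth[OF T'(1) smooth_on_subset[OF L] lin inj _ T'(3)])
        show "L z (\<Sum>i\<in>I. a i z *\<^sub>R \<sigma> i) = X z" if "z \<in> T'" for z using T'(4) that Lsum by simp
      qed (use T' T in auto)
      then have "smooth_on T' (\<lambda>z. (\<Sum>i\<in>I. a i z *\<^sub>R \<sigma> i) \<bullet> \<sigma> j)" for j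
        by (rule smooth_on_linear_comp[OF T'(1) bounded_linear_inner_left])
      note sm = this
      show "\<forall>i\<in>I. smooth_on T' (a i)"
      proof
        fix i assume i: "i \<in> I"
        show "smooth_on T' (a i)" using sm[of i] by (simp add: comp[OF i])
      qed
    qed
  qed
qed

definition cauchy_field ::
  "('m::topological_space, 'a::euclidean_space) chart set \<Rightarrow> ('m \<Rightarrow> 'a set) \<Rightarrow> 'm set \<Rightarrow> ('m \<Rightarrow> 'a) \<Rightarrow> bool"
  where
  "cauchy_field A V W X \<longleftrightarrow> smooth_section A V W X \<and>
     (\<forall>W' Y. open W' \<longrightarrow> W' \<subseteq> W \<longrightarrow> smooth_section A V W' Y \<longrightarrow> (\<forall>q\<in>W'. lie_bracket A X Y q \<in> V q))"

lemma cauchy_bundle_iff: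
  "v \<in> cauchy_bundle A V p \<longleftrightarrow> (\<exists>X W. v = X p \<and> open W \<and> p \<in> W \<and> cauchy_field A V W X)"
  unfolding cauchy_bundle_def cauchy_field_def by blast

context smooth_mfd
begin

lemma smooth_fun_compose:
  fixes g :: "'m \<Rightarrow> 'b::euclidean_space"
  assumes W: "open W" and g: "smooth_fun A W g" and T: "open T" "g ` W \<subseteq> T" and h: "smooth_on T h"
  shows "smooth_fun A W (\<lambda>p. h (g p))"
proof (rule smooth_funI[OF W])
  fix D c assume c: "(D, c) \<in> A" and op: "open (c ` (W \<inter> D))"
  have sub: "(\<lambda>y. g (inv_into D c y)) ` (c ` (W \<inter> D)) \<subseteq> T"
    using T(2) inv_chart[OF c] by auto
  show "smooth_on (c ` (W \<inter> D)) (\<lambda>y. h (g (inv_into D c y)))"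
    unfolding smooth_on_def
  proof
    fix n
    have "higher_diff n (c ` (W \<inter> D)) (\<lambda>y. g (inv_into D c y))"
      using smooth_funD[OF g c] by (simp add: smooth_on_def)
    then show "higher_diff n (c ` (W \<inter> D)) (\<lambda>y. h (g (inv_into D c y)))"
      by (rule higher_diff_compose[OF op T(1) sub _ h])
  qed
qed

text \<open>Read in a chart, this is \<open>smooth_frame_coefficients\<close>, as the derivative of a chart is injective on
  every tangent space.\<close>

lemma field_frame_coefficients:
  fixes Y :: "'i \<Rightarrow> 'm \<Rightarrow> 'a"
  assumes W: "open W" "p \<in> W" and "finite I" and Y: "\<And>i. i \<in> I \<Longrightarrow> smooth_field A W (Y i)"
    and ind: "independent_family I (\<lambda>i. Y i p)"
  obtains W1 where "open W1" "p \<in> W1" "W1 \<subseteq> W"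
    "\<And>q. q \<in> W1 \<Longrightarrow> independent_family I (\<lambda>i. Y i q)"
    "\<forall>W' X a. open W' \<longrightarrow> W' \<subseteq> W1 \<longrightarrow> smooth_field A W' X \<longrightarrow> (\<forall>q\<in>W'. X q = (\<Sum>i\<in>I. a i q *\<^sub>R Y i q))
       \<longrightarrow> (\<forall>i\<in>I. smooth_fun A W' (a i))"
proof -
  obtain D c where c: "(D, c) \<in> A" "p \<in> D" by (metis chart_at_props)
  let ?S = "c ` (W \<inter> D)"
  have op: "open ?S" by (rule chart_image_open[OF c(1) W(1)])
  define Yc where "Yc i y = dirder A c (inv_into D c y) (Y i (inv_into D c y))" for i y
  have lin: "linear (dirder A c q)" if "q \<in> D" for q by (rule dirder_linear[OF smooth_fun_chart[OF c(1)] that])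
  have Yc: "smooth_on ?S (Yc i)" if "i \<in> I" for i
  proof -
    have "smooth_fun A (W \<inter> D) (\<lambda>q. dirder A c q (Y i q))"
      using Y[OF that] c(1) unfolding smooth_field_def by auto
    from smooth_funD[OF this c(1)] show ?thesis by (simp add: Yc_def[abs_def] Int_assoc)
  qed
  have Ycq: "(\<Sum>i\<in>I. a i *\<^sub>R Yc i (c q)) = dirder A c q (\<Sum>i\<in>I. a i *\<^sub>R Y i q)" if "q \<in> D" for a q
    using lin[OF that] by (simp add: Yc_def inv_chart[OF c(1) that] linear_sum linear_scale)
  have indc: "independent_family I (\<lambda>i. Yc i (c q)) \<longleftrightarrow> independent_family I (\<lambda>i. Y i q)" if "q \<in> D" for q
    unfolding independent_family_def Ycq[OF that]
    using linear_injective_0[OF lin[OF that]] inj_dirder_chart[OF c(1) that] linear_0[OF lin[OF that]] by metis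
  have pS: "c p \<in> ?S" using W(2) c(2) by blast
  have indp: "independent_family I (\<lambda>i. Yc i (c p))" using ind indc[OF c(2)] by simp
  obtain T where T: "open T" "c p \<in> T" "T \<subseteq> ?S"
    "\<And>z. z \<in> T \<Longrightarrow> independent_family I (\<lambda>i. Yc i z)"
    "\<forall>T' X a. open T' \<longrightarrow> T' \<subseteq> T \<longrightarrow> smooth_on T' X \<longrightarrow> (\<forall>z\<in>T'. X z = (\<Sum>i\<in>I. a i z *\<^sub>R Yc i z))
       \<longrightarrow> (\<forall>i\<in>I. smooth_on T' (a i))"
    by (rule smooth_frame_coefficients[OF op pS assms(3) Yc indp], assumption, rule that)
  have cont: "continuous_on D c" using chart_homeomorphism(3)[OF c(1)] homeomorphism_cont1 by blast
  let ?W1 = "D \<inter> c -` T \<inter> W"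
  have W1: "open ?W1" using continuous_open_preimage[OF cont chart_homeomorphism(1)[OF c(1)] T(1)] W(1) by blast
  show ?thesis
  proof (rule that[OF W1])
    show "independent_family I (\<lambda>i. Y i q)" if "q \<in> ?W1" for q using T(4)[of "c q"] indc[of q] that by auto
  next
    show "\<forall>W' X a. open W' \<longrightarrow> W' \<subseteq> ?W1 \<longrightarrow> smooth_field A W' X \<longrightarrow> (\<forall>q\<in>W'. X q = (\<Sum>i\<in>I. a i q *\<^sub>R Y i q))
       \<longrightarrow> (\<forall>i\<in>I. smooth_fun A W' (a i))"
    proof (intro allI impI)
      fix W' X and a :: "'i \<Rightarrow> 'm \<Rightarrow> real"
      assume W': "open W'" "W' \<subseteq> ?W1" "smooth_field A W' X" "\<forall>q\<in>W'. X q = (\<Sum>i\<in>I. a i q *\<^sub>R Y i q)"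
      have WD: "W' \<inter> D = W'" using W'(2) by auto
      let ?T' = "c ` W'"
      have opT: "open ?T'" using chart_image_open[OF c(1) W'(1)] by (simp add: WD)
      have "smooth_fun A (W' \<inter> D) (\<lambda>q. dirder A c q (X q))"
        using W'(3) c(1) unfolding smooth_field_def by auto
      from smooth_funD[OF this c(1)]
      have X: "smooth_on ?T' (\<lambda>y. dirder A c (inv_into D c y) (X (inv_into D c y)))" by (simp add: WD)
      have sm: "smooth_on ?T' (\<lambda>y. a i (inv_into D c y))" if "i \<in> I" for i
      proof (rule T(5)[rule_format, OF opT _ X])
        show "?T' \<subseteq> T" using W'(2) by auto
        show "dirder A c (inv_into D c z) (X (inv_into D c z)) = (\<Sum>i\<in>I. a i (inv_into D c z) *\<^sub>R Yc i z)"
          if z: "z \<in> ?T'" for z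
        proof -
          obtain q where q: "q \<in> W'" "z = c q" using z by auto
          then have qD: "q \<in> D" using WD by auto
          show ?thesis unfolding q(2) inv_chart[OF c(1) qD] Ycq[OF qD] W'(4)[rule_format, OF q(1)] ..
        qed
      qed (rule that)
      have cW: "smooth_fun A W' c" by (rule smooth_fun_subset[OF smooth_fun_chart[OF c(1)]]) (use WD in blast)
      show "\<forall>i\<in>I. smooth_fun A W' (a i)"
      proof
        fix i assume "i \<in> I"
        then have "smooth_fun A W' (\<lambda>q. a i (inv_into D c (c q)))"
          by (intro smooth_fun_compose[OF W'(1) cW opT order_refl] sm)
        then show "smooth_fun A W' (a i)"
        proof (rule smooth_fun_cong[OF W'(1), rotated])
          fix q assume "q \<in> W'"
          then have "q \<in> D" using WD by auto
          then show "a i (inv_into D c (c q)) = a i q" by (simp add: inv_chart[OF c(1)])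
        qed
      qed
    qed
  qed (use W c T in auto)
qed

lemma smooth_section_subset: "smooth_section A V W X \<Longrightarrow> W' \<subseteq> W \<Longrightarrow> smooth_section A V W' X"
  unfolding smooth_section_def using smooth_field_subset by blast

lemma subbundle_subspace: "subbundle A V \<Longrightarrow> subspace (V p)"
  unfolding subbundle_def by blast

lemma subbundle_rank: "subbundle A V \<Longrightarrow> dim (V p) = bundle_rank V"
proof -
  assume "subbundle A V"
  then obtain r where r: "\<And>p. dim (V p) = r" unfolding subbundle_def by blast
  have "bundle_rank V = r" unfolding bundle_rank_def by (rule the_equality) (use r in auto)
  with r show ?thesis by simp
qed

lemma section_through:
  assumes "subbundle A V" "v \<in> V p"
  obtains W X where "open W" "p \<in> W" "smooth_section A V W X" "X p = v"
proof -
  obtain r where r: "\<forall>p. subspace (V p) \<and> dim (V p) = r \<and>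
        (\<exists>W X. open W \<and> p \<in> W \<and> (\<forall>i<r. smooth_field A W (X i)) \<and>
               (\<forall>q\<in>W. V q = span ((\<lambda>i. X i q) ` {..<r})))"
    using assms(1) unfolding subbundle_def by (elim exE) (rule that)
  obtain W Y where "open W \<and> p \<in> W \<and> (\<forall>i<r. smooth_field A W (Y i)) \<and>
      (\<forall>q\<in>W. V q = span ((\<lambda>i. Y i q) ` {..<r}))"
    using r[THEN spec[of _ p]] by (elim conjE exE) (rule that, intro conjI)
  then have W: "open W" "p \<in> W" "\<And>i. i < r \<Longrightarrow> smooth_field A W (Y i)"
    "\<And>q. q \<in> W \<Longrightarrow> V q = span ((\<lambda>i. Y i q) ` {..<r})" by simp_all
  obtain a where a: "v = (\<Sum>i<r. a i *\<^sub>R Y i p)"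
    using assms(2) span_image_finite[of "{..<r}" v "\<lambda>i. Y i p"] unfolding W(4)[OF W(2)] by auto
  have "smooth_field A W (\<lambda>q. \<Sum>i<r. a i *\<^sub>R Y i q)"
    by (intro smooth_field_sum smooth_field_scaleR W smooth_fun_const) (use W(3) in auto)
  moreover have "(\<Sum>i<r. a i *\<^sub>R Y i q) \<in> V q" if "q \<in> W" for q
    unfolding W(4)[OF that] by (intro span_sum span_scale span_base) auto
  ultimately have "smooth_section A V W (\<lambda>q. \<Sum>i<r. a i *\<^sub>R Y i q)" unfolding smooth_section_def by blast
  then show ?thesis by (rule that[OF W(1,2)]) (simp add: a)
qed

lemma derived_bundle_dim:
  assumes "subbundle A V" "\<And>p. structure_tensor_rank A V p = s"
  shows "dim (derived_bundle A V p) = bundle_rank V + s"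
proof -
  have "dim (V p) \<le> dim (V p \<union> brackets A V p)" by (rule dim_subset) auto
  then show ?thesis
    using assms(2)[of p] subbundle_rank[OF assms(1), of p]
    unfolding structure_tensor_rank_def derived_bundle_def by simp
qed

lemma bracket_in_derived:
  assumes "open W" "q \<in> W" "smooth_section A V W S" "smooth_section A V W T"
  shows "lie_bracket A S T q \<in> derived_bundle A V q"
proof -
  have "lie_bracket A S T q \<in> brackets A V q"
    unfolding brackets_def mem_Collect_eq
    by (intro exI[of _ S] exI[of _ T] exI[of _ W] conjI refl assms)
  then show ?thesis unfolding derived_bundle_def by (auto intro: span_base)
qed

text \<open>A frame of the derived bundle near a point can be picked among sections of the bundle and
  brackets of such sections: a choice that is a basis at the point stays independent nearby, and
  it stays a basis because the rank is constant.\<close>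

lemma derived_bundle_frame:
  assumes V: "subbundle A V" and s: "\<And>p. structure_tensor_rank A V p = s"
  obtains W Y where "open W" "p \<in> W"
    "\<And>i. i < bundle_rank V + s \<Longrightarrow> smooth_field A W (Y i)"
    "\<And>i. i < bundle_rank V + s \<Longrightarrow> smooth_section A V W (Y i) \<or>
       (\<exists>S T. smooth_section A V W S \<and> smooth_section A V W T \<and> Y i = lie_bracket A S T)"
    "\<And>q. q \<in> W \<Longrightarrow> derived_bundle A V q = span ((\<lambda>i. Y i q) ` {..<bundle_rank V + s})"
    "\<forall>W' X. open W' \<longrightarrow> W' \<subseteq> W \<longrightarrow> smooth_section A (derived_bundle A V) W' X \<longrightarrow>
       (\<exists>a. (\<forall>i<bundle_rank V + s. smooth_fun A W' (a i)) \<and>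
           (\<forall>q\<in>W'. X q = (\<Sum>i<bundle_rank V + s. a i q *\<^sub>R Y i q)))"
proof -
  let ?r = "bundle_rank V + s" and ?G = "V p \<union> brackets A V p"
  obtain B where B: "B \<subseteq> ?G" "independent B" "?G \<subseteq> span B" "card B = dim ?G"
    by (rule basis_exists)
  have cB: "card B = ?r"
    using B(4) derived_bundle_dim[OF V s, of p] unfolding derived_bundle_def by simp
  have finB: "finite B" using B(2) independent_imp_finite by blast
  obtain v where v: "bij_betw v {..<?r} B"
    using finite_same_card_bij[of "{..<?r}" B] finB cB by auto
  have ext: "\<exists>W Y. open W \<and> p \<in> W \<and> Y p = w \<and> smooth_field A W Y \<and> (smooth_section A V W Y \<or>
       (\<exists>S T. smooth_section A V W S \<and> smooth_section A V W T \<and> Y = lie_bracket A S T))"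
    if w: "w \<in> ?G" for w
  proof (cases "w \<in> V p")
    case True
    obtain W X where "open W" "p \<in> W" "smooth_section A V W X" "X p = w"
      by (rule section_through[OF V True])
    then show ?thesis unfolding smooth_section_def by blast
  next
    case False
    then obtain X Y W where *: "w = lie_bracket A X Y p" "open W" "p \<in> W" "smooth_section A V W X" "smooth_section A V W Y"
      using w unfolding brackets_def by auto
    then have "smooth_field A W (lie_bracket A X Y)"
      unfolding smooth_section_def by (intro smooth_field_lie_bracket) auto
    with * show ?thesis by blast
  qed
  have "\<forall>i\<in>{..<?r}. v i \<in> ?G" using v B(1) unfolding bij_betw_def by blast
  then have "\<forall>i\<in>{..<?r}. \<exists>W Y. open W \<and> p \<in> W \<and> Y p = v i \<and> smooth_field A W Y \<and> (smooth_section A V W Y \<or>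
       (\<exists>S T. smooth_section A V W S \<and> smooth_section A V W T \<and> Y = lie_bracket A S T))"
    using ext by blast
  then obtain Wi Y where Y: "\<And>i. i < ?r \<Longrightarrow> open (Wi i) \<and> p \<in> Wi i \<and> Y i p = v i \<and> smooth_field A (Wi i) (Y i) \<and> (smooth_section A V (Wi i) (Y i) \<or>
       (\<exists>S T. smooth_section A V (Wi i) S \<and> smooth_section A V (Wi i) T \<and> Y i = lie_bracket A S T))"
    unfolding bchoice_iff by (metis lessThan_iff)
  define W0 where "W0 = (\<Inter>i<?r. Wi i)"
  have W0: "open W0" "p \<in> W0" "\<And>i. i < ?r \<Longrightarrow> W0 \<subseteq> Wi i"
    using Y by (auto simp: W0_def)
  have Y0: "smooth_field A W0 (Y i)" if "i \<in> {..<?r}" for i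
    using Y[of i] W0(3)[of i] that smooth_field_subset by (metis lessThan_iff)
  have "independent_family {..<?r} (\<lambda>i. Y i p)"
  proof -
    have "independent_family {..<?r} v" using v B(2) by (simp add: independent_family_iff bij_betw_def)
    moreover have "(\<Sum>i<?r. a i *\<^sub>R Y i p) = (\<Sum>i<?r. a i *\<^sub>R v i)" for a
      using Y by (intro sum.cong refl) simp
    ultimately show ?thesis unfolding independent_family_def by simp
  qed
  note indp = this
  obtain W where W: "open W" "p \<in> W" "W \<subseteq> W0"
    "\<And>q. q \<in> W \<Longrightarrow> independent_family {..<?r} (\<lambda>i. Y i q)"
    "\<forall>W' X a. open W' \<longrightarrow> W' \<subseteq> W \<longrightarrow> smooth_field A W' X \<longrightarrow> (\<forall>q\<in>W'. X q = (\<Sum>i<?r. a i q *\<^sub>R Y i q))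
       \<longrightarrow> (\<forall>i\<in>{..<?r}. smooth_fun A W' (a i))"
    by (rule field_frame_coefficients[OF W0(1,2) finite_lessThan Y0 indp], assumption, rule that)
  have WWi: "W \<subseteq> Wi i" if "i < ?r" for i using W(3) W0(3)[OF that] by blast
  have sb: "smooth_section A V W (Y i) \<or>
       (\<exists>S T. smooth_section A V W S \<and> smooth_section A V W T \<and> Y i = lie_bracket A S T)" if "i < ?r" for i
    using Y[OF that] smooth_section_subset[OF _ WWi[OF that]] by blast
  have in_der: "Y i q \<in> derived_bundle A V q" if "i < ?r" "q \<in> W" for i q
    using sb[OF that(1)]
  proof (elim disjE exE conjE)
    assume "smooth_section A V W (Y i)"
    then show ?thesis using that(2) unfolding derived_bundle_def smooth_section_def by (auto intro: span_base)
  next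
    fix S T assume "smooth_section A V W S" "smooth_section A V W T" "Y i = lie_bracket A S T"
    then show ?thesis using bracket_in_derived[OF W(1) that(2)] by simp
  qed
  have spn: "derived_bundle A V q = span ((\<lambda>i. Y i q) ` {..<?r})" if q: "q \<in> W" for q
  proof (rule subspace_dim_equal[symmetric])
    show "span ((\<lambda>i. Y i q) ` {..<?r}) \<subseteq> derived_bundle A V q"
      using in_der[OF _ q] unfolding derived_bundle_def by (intro span_minimal subspace_span) auto
    show "dim (derived_bundle A V q) \<le> dim (span ((\<lambda>i. Y i q) ` {..<?r}))"
      using independent_family_dim_span[OF _ W(4)[OF q]] derived_bundle_dim[OF V s, of q] by simp
  qed (simp_all add: derived_bundle_def)
  show ?thesis
  proof (rule that[OF W(1,2) _ sb spn])
    show "smooth_field A W (Y i)" if "i < ?r" for i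
      using Y0[of i] that W(3) smooth_field_subset by auto
  next
    show "\<forall>W' X. open W' \<longrightarrow> W' \<subseteq> W \<longrightarrow> smooth_section A (derived_bundle A V) W' X \<longrightarrow>
       (\<exists>a. (\<forall>i<?r. smooth_fun A W' (a i)) \<and> (\<forall>q\<in>W'. X q = (\<Sum>i<?r. a i q *\<^sub>R Y i q)))"
    proof (intro allI impI)
      fix W' X assume W': "open W'" "W' \<subseteq> W" "smooth_section A (derived_bundle A V) W' X"
      have "\<forall>q\<in>W'. \<exists>a. X q = (\<Sum>i<?r. a i *\<^sub>R Y i q)"
        using W'(2,3) spn span_image_finite[of "{..<?r}" _ "\<lambda>i. Y i _"] unfolding smooth_section_def
        by (metis finite_lessThan subsetD)
      then obtain a where a: "\<And>q. q \<in> W' \<Longrightarrow> X q = (\<Sum>i<?r. a q i *\<^sub>R Y i q)" by metis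
      have "\<forall>i<?r. smooth_fun A W' (\<lambda>q. a q i)"
        using W(5)[rule_format, OF W'(1,2), of X "\<lambda>i q. a q i"] W'(3) a by (auto simp: smooth_section_def)
      then show "\<exists>a. (\<forall>i<?r. smooth_fun A W' (a i)) \<and> (\<forall>q\<in>W'. X q = (\<Sum>i<?r. a i q *\<^sub>R Y i q))"
        using a by (intro exI[of _ "\<lambda>i q. a q i"]) auto
    qed
  qed
qed

lemma derived_bundle_subbundle:
  assumes V: "subbundle A V" and s: "\<And>p. structure_tensor_rank A V p = s"
  shows "subbundle A (derived_bundle A V)"
  unfolding subbundle_def
proof (intro exI[of _ "bundle_rank V + s"] allI conjI)
  fix p
  show "subspace (derived_bundle A V p)" by (simp add: derived_bundle_def)
  show "dim (derived_bundle A V p) = bundle_rank V + s" by (rule derived_bundle_dim[OF V s])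
  show "\<exists>W X. open W \<and> p \<in> W \<and> (\<forall>i<bundle_rank V + s. smooth_field A W (X i)) \<and>
     (\<forall>q\<in>W. derived_bundle A V q = span ((\<lambda>i. X i q) ` {..<bundle_rank V + s}))"
    by (rule derived_bundle_frame[OF V s, of p]) blast
qed

lemma derived_flag_0 [simp]: "derived_flag A V 0 = V"
  by (simp add: derived_flag_def)

lemma derived_flag_Suc: "derived_flag A V (Suc i) = derived_bundle A (derived_flag A V i)"
  by (simp add: derived_flag_def)

lemma derived_flag_subbundle:
  assumes "regular_bundle A V"
  shows "subbundle A (derived_flag A V i)"
proof (induction i)
  case 0 then show ?case using assms by (simp add: regular_bundle_def)
next
  case (Suc i)
  obtain s where "\<And>p. structure_tensor_rank A (derived_flag A V i) p = s"
    using assms unfolding regular_bundle_def by metis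
  from derived_bundle_subbundle[OF Suc this] show ?case by (simp add: derived_flag_Suc)
qed

text \<open>By the Jacobi identity the bracket of a Cauchy field with a bracket of two sections is a sum of
  brackets of sections; and by \<open>derived_bundle_frame\<close> sections of the derived bundle are combinations
  of sections and such brackets, with smooth coefficients.\<close>

lemma cauchy_field_derived:
  assumes V: "subbundle A V" and s: "\<And>p. structure_tensor_rank A V p = s"
    and X: "cauchy_field A V W X"
  shows "cauchy_field A (derived_bundle A V) W X"
  unfolding cauchy_field_def
proof (intro conjI allI impI ballI)
  let ?V1 = "derived_bundle A V"
  have sub: "V q \<subseteq> ?V1 q" for q unfolding derived_bundle_def by (auto intro: span_base)
  have Xs: "smooth_section A V W X" using X by (simp add: cauchy_field_def)
  then show "smooth_section A ?V1 W X" unfolding smooth_section_def using sub by blast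
  fix W' Y q assume W': "open W'" "W' \<subseteq> W" "smooth_section A ?V1 W' Y" "q \<in> W'"
  obtain W0 B where B: "open W0" "q \<in> W0"
    "\<And>i. i < bundle_rank V + s \<Longrightarrow> smooth_field A W0 (B i)"
    "\<And>i. i < bundle_rank V + s \<Longrightarrow> smooth_section A V W0 (B i) \<or>
       (\<exists>S T. smooth_section A V W0 S \<and> smooth_section A V W0 T \<and> B i = lie_bracket A S T)"
    "\<And>q. q \<in> W0 \<Longrightarrow> ?V1 q = span ((\<lambda>i. B i q) ` {..<bundle_rank V + s})"
    "\<forall>W' X. open W' \<longrightarrow> W' \<subseteq> W0 \<longrightarrow> smooth_section A ?V1 W' X \<longrightarrow>
       (\<exists>a. (\<forall>i<bundle_rank V + s. smooth_fun A W' (a i)) \<and>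
           (\<forall>q\<in>W'. X q = (\<Sum>i<bundle_rank V + s. a i q *\<^sub>R B i q)))"
    by (rule derived_bundle_frame[OF V s, of q]) (rule that)
  let ?r = "bundle_rank V + s" and ?W = "W' \<inter> W0"
  have W: "open ?W" "q \<in> ?W" "?W \<subseteq> W" "?W \<subseteq> W'" "?W \<subseteq> W0" using W' B by auto
  obtain a where a: "\<And>i. i < ?r \<Longrightarrow> smooth_fun A ?W (a i)" "\<And>q. q \<in> ?W \<Longrightarrow> Y q = (\<Sum>i<?r. a i q *\<^sub>R B i q)"
    using B(6)[rule_format, OF W(1,5) smooth_section_subset[OF W'(3) W(4)]] by auto
  have Xf: "smooth_field A ?W X" using Xs W(3) smooth_field_subset unfolding smooth_section_def by blast
  have Bf: "smooth_field A ?W (B i)" if "i < ?r" for i using B(3)[OF that] W(5) smooth_field_subset by blast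
  have aB: "smooth_field A ?W (\<lambda>q. a i q *\<^sub>R B i q)" if "i \<in> {..<?r}" for i
    using smooth_field_scaleR[OF W(1) a(1) Bf] that by auto
  have "lie_bracket A X Y q = lie_bracket A X (\<lambda>q. \<Sum>i<?r. a i q *\<^sub>R B i q) q"
    by (rule lie_bracket_cong[OF W(1,2) Xf smooth_field_sum[OF W(1) aB]]) (use a(2) in auto)
  also have "\<dots> = (\<Sum>i<?r. lie_bracket A X (\<lambda>q. a i q *\<^sub>R B i q) q)"
    by (rule lie_bracket_sum_right[OF W(1,2) Xf finite_lessThan aB])
  also have "\<dots> = (\<Sum>i<?r. lie_derivative A X (a i) q *\<^sub>R B i q + a i q *\<^sub>R lie_bracket A X (B i) q)"
    by (intro sum.cong lie_bracket_scale_right[OF W(1,2) Xf Bf a(1)]) auto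
  also have "\<dots> \<in> ?V1 q"
  proof -
    have inV: "lie_bracket A X S q' \<in> V q'" if "smooth_section A V ?W S" "q' \<in> ?W" for S q'
      using X that W(1,3) unfolding cauchy_field_def by blast
    have XS: "smooth_section A V ?W (lie_bracket A X S)" if S: "smooth_section A V ?W S" for S
      using inV[OF S] smooth_field_lie_bracket[OF W(1) Xf] S unfolding smooth_section_def by blast
    have br: "lie_bracket A S T q \<in> ?V1 q" if "smooth_section A V ?W S" "smooth_section A V ?W T" for S T
      by (rule bracket_in_derived[OF W(1,2) that])
    have "lie_bracket A X (B i) q \<in> ?V1 q" if i: "i < ?r" for i
      using B(4)[OF i]
    proof (elim disjE exE conjE)
      assume "smooth_section A V W0 (B i)"
      then show ?thesis using inV[OF smooth_section_subset[OF _ W(5)] W(2)] sub by blast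
    next
      fix S T assume ST: "smooth_section A V W0 S" "smooth_section A V W0 T" "B i = lie_bracket A S T"
      note S = smooth_section_subset[OF ST(1) W(5)] and T = smooth_section_subset[OF ST(2) W(5)]
      have "lie_bracket A X (B i) q = lie_bracket A (lie_bracket A X S) T q + lie_bracket A S (lie_bracket A X T) q"
        unfolding ST(3) using S T by (intro jacobi[OF W(1,2) Xf]) (auto simp: smooth_section_def)
      then show ?thesis using br[OF XS[OF S] T] br[OF S XS[OF T]] by (simp add: derived_bundle_def span_add)
    qed
    moreover have "B i q \<in> ?V1 q" if "i < ?r" for i using B(2,5) that by (auto intro: span_base)
    ultimately show ?thesis
      unfolding derived_bundle_def by (intro span_sum span_add span_scale) auto
  qed
  finally show "lie_bracket A X Y q \<in> ?V1 q" .
qed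

lemma cauchy_field_flag_mono:
  assumes "regular_bundle A V" "cauchy_field A (derived_flag A V i) W X" "i \<le> j"
  shows "cauchy_field A (derived_flag A V j) W X"
  using assms(3)
proof (induction rule: dec_induct)
  case base then show ?case by (rule assms(2))
next
  case (step j)
  obtain s where "\<And>p. structure_tensor_rank A (derived_flag A V j) p = s"
    using assms(1) unfolding regular_bundle_def by metis
  from cauchy_field_derived[OF derived_flag_subbundle[OF assms(1)] this step.IH]
  show ?case by (simp add: derived_flag_Suc)
qed

end

section \<open>Linear forms and contact forms\<close>

text \<open>The function type carries no vector space structure, so a linear relation between functionals is
  expressed by its values on all vectors.\<close>

definition independent_forms :: "'i set \<Rightarrow> ('i \<Rightarrow> 'v \<Rightarrow> real) \<Rightarrow> bool" where
  "independent_forms I l \<longleftrightarrow> (\<forall>a. (\<forall>v. (\<Sum>i\<in>I. a i * l i v) = 0) \<longrightarrow> (\<forall>i\<in>I. a i = 0))"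

lemma independent_formsD:
  "independent_forms I l \<Longrightarrow> (\<And>v. (\<Sum>i\<in>I. a i * l i v) = 0) \<Longrightarrow> i \<in> I \<Longrightarrow> a i = 0"
  unfolding independent_forms_def by blast

lemma independent_forms_subset:
  assumes "independent_forms I l" "J \<subseteq> I" "finite I"
  shows "independent_forms J l"
  unfolding independent_forms_def
proof (intro allI impI ballI)
  fix a i assume a: "\<forall>v. (\<Sum>i\<in>J. a i * l i v) = 0" and i: "i \<in> J"
  have "(\<Sum>i\<in>I. (if i \<in> J then a i else 0) * l i v) = 0" for v
  proof -
    have "(\<Sum>i\<in>I. (if i \<in> J then a i else 0) * l i v) = (\<Sum>i\<in>J. (if i \<in> J then a i else 0) * l i v)"
      using assms by (intro sum.mono_neutral_right) auto
    also have "\<dots> = (\<Sum>i\<in>J. a i * l i v)" by (intro sum.cong) auto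
    finally show ?thesis using a by simp
  qed
  from independent_formsD[OF assms(1) this, of i] show "a i = 0" using i assms(2) by auto
qed

lemma forms_kernel_dim:
  fixes l :: "'i \<Rightarrow> 'a::euclidean_space \<Rightarrow> real"
  assumes "finite I" and lin: "\<And>i. i \<in> I \<Longrightarrow> linear (l i)" and ind: "independent_forms I l"
  shows "dim {v. \<forall>i\<in>I. l i v = 0} + card I = DIM('a)"
proof -
  define g where "g i = (\<Sum>b\<in>Basis. l i b *\<^sub>R b)" for i
  have g: "g i \<bullet> v = l i v" if "i \<in> I" for i v
    unfolding g_def inner_sum_left using linear_basis_expansion[OF lin[OF that], of v]
    by (simp add: inner_commute mult.commute)
  have "independent_family I g"
    unfolding independent_family_def
  proof (intro allI impI ballI)
    fix a i assume a: "(\<Sum>i\<in>I. a i *\<^sub>R g i) = 0" and i: "i \<in> I"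
    have "(\<Sum>i\<in>I. a i * l i v) = 0" for v
    proof -
      have "(\<Sum>i\<in>I. a i * l i v) = (\<Sum>i\<in>I. a i *\<^sub>R g i) \<bullet> v"
        unfolding inner_sum_left by (intro sum.cong) (simp_all add: g)
      then show ?thesis using a by simp
    qed
    from independent_formsD[OF ind this i] show "a i = 0" .
  qed
  then have d: "dim (span (g ` I)) = card I" by (rule independent_family_dim_span[OF assms(1)])
  have "{v. \<forall>i\<in>I. l i v = 0} = {y \<in> UNIV. \<forall>x\<in>span (g ` I). real_inner_class.orthogonal x y}"
  proof (intro equalityI subsetI CollectI conjI UNIV_I ballI)
    fix v x assume v: "v \<in> {v. \<forall>i\<in>I. l i v = 0}" and x: "x \<in> span (g ` I)"
    obtain a where "x = (\<Sum>i\<in>I. a i *\<^sub>R g i)" using x span_image_finite[OF assms(1)] by blast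
    then show "real_inner_class.orthogonal x v" using v g by (simp add: Linear_Algebra.orthogonal_def inner_sum_left)
  next
    fix v i assume v: "v \<in> {y \<in> UNIV. \<forall>x\<in>span (g ` I). real_inner_class.orthogonal x y}" and i: "i \<in> I"
    then have "real_inner_class.orthogonal (g i) v" by (auto intro: span_base)
    then show "l i v = 0" using g[OF i] by (simp add: Linear_Algebra.orthogonal_def)
  qed
  then show ?thesis
    using dim_subspace_orthogonal_to_vectors[OF subspace_span[of "g ` I"] subspace_UNIV] d by simp
qed

lemma forms_kernel_subspace: "(\<And>i. i \<in> I \<Longrightarrow> linear (l i)) \<Longrightarrow> subspace {v. \<forall>i\<in>I. l i v = (0::real)}"
  by (rule subspaceI) (auto simp: linear_0 linear_add linear_scale)

text \<open>Otherwise \<open>m\<close> would be independent of the \<open>l\<^sub>i\<close>, and the common kernel would be smaller with \<open>m\<close>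
  than without it.\<close>

lemma form_in_span:
  fixes l :: "'i \<Rightarrow> 'a::euclidean_space \<Rightarrow> real"
  assumes fin: "finite I" and lin: "\<And>i. i \<in> I \<Longrightarrow> linear (l i)" and ind: "independent_forms I l"
    and m: "linear m" and ker: "\<And>v. (\<And>i. i \<in> I \<Longrightarrow> l i v = 0) \<Longrightarrow> m v = 0"
  obtains a where "\<And>v. m v = (\<Sum>i\<in>I. a i * l i v)"
proof -
  define L where "L i = (case i of None \<Rightarrow> m | Some i \<Rightarrow> l i)" for i
  let ?J = "insert None (Some ` I)"
  have sumJ: "(\<Sum>i\<in>?J. a i * L i v) = a None * m v + (\<Sum>i\<in>I. a (Some i) * l i v)" for a v
    using fin by (simp add: L_def sum.reindex)
  have "\<not> independent_forms ?J L"
  proof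
    assume "independent_forms ?J L"
    then have "dim {v. \<forall>i\<in>?J. L i v = 0} + card ?J = DIM('a)"
      by (rule forms_kernel_dim[rotated 2]) (use fin lin m in \<open>auto simp: L_def\<close>)
    moreover have "{v. \<forall>i\<in>?J. L i v = 0} = {v. \<forall>i\<in>I. l i v = 0}"
      using ker by (auto simp: L_def)
    moreover have "card ?J = Suc (card I)" using fin by (simp add: card_image)
    ultimately show False using forms_kernel_dim[OF fin lin ind] by simp
  qed
  then obtain a i where a: "\<And>v. (\<Sum>i\<in>?J. a i * L i v) = 0" "i \<in> ?J" "a i \<noteq> 0"
    unfolding independent_forms_def by blast
  have a0: "a None \<noteq> 0"
  proof
    assume "a None = 0"
    then have "(\<Sum>i\<in>I. a (Some i) * l i v) = 0" for v using a(1)[of v] sumJ by simp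
    from independent_formsD[of I l "\<lambda>i. a (Some i)", OF ind this] a(2,3) \<open>a None = 0\<close> show False by auto
  qed
  show ?thesis
  proof (rule that)
    fix v
    have "a None * m v + (\<Sum>i\<in>I. a (Some i) * l i v) = 0" using a(1)[of v] sumJ[of a v] by simp
    then have "m v = - (\<Sum>i\<in>I. a (Some i) * l i v) / a None" using a0 by (simp add: field_simps)
    also have "\<dots> = (\<Sum>i\<in>I. (- a (Some i) / a None) * l i v)"
      by (simp add: sum_divide_distrib sum_negf[symmetric])
    finally show "m v = (\<Sum>i\<in>I. (- a (Some i) / a None) * l i v)" .
  qed
qed

text \<open>Replacing \<open>l\<^sub>i\<close> by \<open>l\<^sub>i - t\<^sub>i l\<^sub>c\<close> is the passage from differentials to contact forms.\<close>

lemma independent_forms_shear: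
  assumes fin: "finite I" and ind: "independent_forms I l" and c: "c \<in> I"
  shows "independent_forms (I - {c}) (\<lambda>i v. l i v - t i * l c v)"
  unfolding independent_forms_def
proof (intro allI impI ballI)
  fix a i assume a: "\<forall>v. (\<Sum>i\<in>I - {c}. a i * (l i v - t i * l c v)) = 0" and i: "i \<in> I - {c}"
  let ?b = "\<lambda>i. if i = c then - (\<Sum>i\<in>I - {c}. a i * t i) else a i"
  have "(\<Sum>i\<in>I. ?b i * l i v) = 0" for v
  proof -
    have "(\<Sum>i\<in>I. ?b i * l i v) = - (\<Sum>i\<in>I - {c}. a i * t i) * l c v + (\<Sum>i\<in>I - {c}. a i * l i v)"
      using fin c by (subst sum.remove[OF fin c]) (auto intro!: sum.cong)
    also have "\<dots> = (\<Sum>i\<in>I - {c}. a i * (l i v - t i * l c v))"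
      by (simp add: right_diff_distrib sum_subtractf sum_distrib_right mult.assoc)
    finally show ?thesis using a by simp
  qed
  from independent_formsD[of I l ?b i, OF ind this] show "a i = 0" using i by auto
qed

text \<open>A vector on which all \<open>l\<^sub>j\<close>, \<open>j \<noteq> i\<close>, vanish but \<open>l\<^sub>i\<close> does not must exist: otherwise \<open>l\<^sub>i\<close> would
  be a combination of the others by \<open>form_in_span\<close>.\<close>

lemma dual_vector:
  fixes l :: "'i \<Rightarrow> 'a::euclidean_space \<Rightarrow> real"
  assumes fin: "finite I" and lin: "\<And>i. i \<in> I \<Longrightarrow> linear (l i)" and ind: "independent_forms I l"
    and i: "i \<in> I"
  obtains v where "\<And>j. j \<in> I \<Longrightarrow> l j v = (if j = i then 1 else 0)"
proof -
  have "\<exists>v. (\<forall>j\<in>I - {i}. l j v = 0) \<and> l i v \<noteq> 0"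
  proof (rule ccontr)
    assume *: "\<not> ?thesis"
    have "\<exists>a. \<forall>v. l i v = (\<Sum>j\<in>I - {i}. a j * l j v)"
    proof (rule form_in_span[of "I - {i}" l "l i"])
      show "independent_forms (I - {i}) l" by (rule independent_forms_subset[OF ind]) (use fin in auto)
      show "l i v = 0" if "\<And>j. j \<in> I - {i} \<Longrightarrow> l j v = 0" for v
      proof (rule ccontr)
        assume "l i v \<noteq> 0"
        then show False using * that by blast
      qed
      fix a assume "\<And>v. l i v = (\<Sum>j\<in>I - {i}. a j * l j v)"
      then show "\<exists>a. \<forall>v. l i v = (\<Sum>j\<in>I - {i}. a j * l j v)" by blast
    qed (use fin lin i in auto)
    then obtain a where a: "\<And>v. l i v = (\<Sum>j\<in>I - {i}. a j * l j v)" by blast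
    let ?b = "\<lambda>j. if j = i then - 1 else a j"
    have "(\<Sum>j\<in>I. ?b j * l j v) = 0" for v
    proof -
      have "(\<Sum>j\<in>I. ?b j * l j v) = - l i v + (\<Sum>j\<in>I - {i}. ?b j * l j v)"
        using fin i by (subst sum.remove[OF fin i]) auto
      also have "(\<Sum>j\<in>I - {i}. ?b j * l j v) = (\<Sum>j\<in>I - {i}. a j * l j v)" by (intro sum.cong) auto
      finally show ?thesis using a[of v] by simp
    qed
    from independent_formsD[of I l ?b i, OF ind this i] show False by simp
  qed
  then obtain v where v: "\<And>j. j \<in> I - {i} \<Longrightarrow> l j v = 0" "l i v \<noteq> 0" by blast
  show ?thesis
  proof (rule that[of "(1 / l i v) *\<^sub>R v"])
    show "l j ((1 / l i v) *\<^sub>R v) = (if j = i then 1 else 0)" if "j \<in> I" for j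
      using linear_scale[OF lin[OF that], of "1 / l i v" v] v that i by auto
  qed
qed

lemma forms_separate:
  fixes l :: "'i \<Rightarrow> 'a::euclidean_space \<Rightarrow> real"
  assumes fin: "finite I" and lin: "\<And>i. i \<in> I \<Longrightarrow> linear (l i)" and ind: "independent_forms I l"
    and card: "card I = DIM('a)" and eq: "\<And>i. i \<in> I \<Longrightarrow> l i v = l i w"
  shows "v = w"
proof -
  have "dim {v. \<forall>i\<in>I. l i v = 0} = 0" using forms_kernel_dim[OF fin lin ind] card by simp
  then have "{v. \<forall>i\<in>I. l i v = 0} \<subseteq> {0}" by (simp add: dim_eq_0)
  moreover have "v - w \<in> {v. \<forall>i\<in>I. l i v = 0}" using eq lin by (simp add: linear_diff)
  ultimately show ?thesis by auto
qed

fun suc_coord :: "pp_coord \<Rightarrow> pp_coord" where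
  "suc_coord CX = CX"
| "suc_coord (CZ l j s) = CZ l j (Suc s)"

text \<open>In \<open>C(\<tau>)\<close> the differentials of these coordinates span the annihilator of the kernel of \<open>dx\<close> on the
  \<open>a\<close>-th derived bundle. Without \<open>CX\<close> they index the contact forms that annihilate this bundle.\<close>

definition pp_level :: "nat list \<Rightarrow> nat \<Rightarrow> pp_coord set" where
  "pp_level \<tau> a = insert CX
     {CZ l j s | l j s. 1 \<le> j \<and> j \<le> length \<tau> \<and> 1 \<le> l \<and> l \<le> rho \<tau> j \<and> s + a < j}"

lemma CZ_in_pp_coords:
  "CZ l j s \<in> pp_coords \<tau> \<longleftrightarrow> 1 \<le> j \<and> j \<le> length \<tau> \<and> 1 \<le> l \<and> l \<le> rho \<tau> j \<and> s \<le> j"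
  by (auto simp: pp_coords_def)

lemma CZ_in_pp_level:
  "CZ l j s \<in> pp_level \<tau> a \<longleftrightarrow> 1 \<le> j \<and> j \<le> length \<tau> \<and> 1 \<le> l \<and> l \<le> rho \<tau> j \<and> s + a < j"
  by (auto simp: pp_level_def)

lemma CX_in_pp [simp]: "CX \<in> pp_coords \<tau>" "CX \<in> pp_level \<tau> a"
  by (auto simp: pp_coords_def pp_level_def)

lemma finite_pp_coords [simp]: "finite (pp_coords \<tau>)"
proof -
  have "pp_coords \<tau> \<subseteq> insert CX (\<Union>j\<in>{1..length \<tau>}. \<Union>l\<in>{1..rho \<tau> j}. \<Union>h\<in>{..j}. {CZ l j h})"
    by (auto simp: pp_coords_def)
  then show ?thesis by (rule finite_subset) simp
qed

lemma pp_level_subset_coords: "pp_level \<tau> a \<subseteq> pp_coords \<tau>"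
  by (auto simp: pp_coords_def pp_level_def)

lemma finite_pp_level [simp]: "finite (pp_level \<tau> a)"
  using finite_subset[OF pp_level_subset_coords] by simp

lemma pp_level_antimono: "a \<le> b \<Longrightarrow> pp_level \<tau> b \<subseteq> pp_level \<tau> a"
  by (auto simp: pp_level_def)

lemma suc_coord_level:
  "i \<in> pp_level \<tau> (Suc a) \<Longrightarrow> suc_coord i \<in> pp_level \<tau> a"
  "i \<in> pp_level \<tau> 0 \<Longrightarrow> suc_coord i \<in> pp_coords \<tau>"
  by (auto simp: pp_level_def pp_coords_def)

lemma suc_coord_not_level:
  "i \<in> pp_level \<tau> a - pp_level \<tau> (Suc a) \<Longrightarrow> suc_coord i \<notin> pp_level \<tau> a"
  by (auto simp: pp_level_def)

lemma suc_coord_neq [simp]: "suc_coord i = CX \<longleftrightarrow> i = CX"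
  by (cases i) auto

lemma inj_suc_coord: "suc_coord i = suc_coord j \<longleftrightarrow> i = j"
  by (cases i; cases j) auto

lemma sum_pp_level_0:
  "(\<Sum>j=1..length \<tau>. \<Sum>l=1..rho \<tau> j. \<Sum>h<j. F (CZ l j h)) = (\<Sum>i\<in>pp_level \<tau> 0 - {CX}. F i)"
proof -
  let ?S = "SIGMA j:{1..length \<tau>}. SIGMA l:{1..rho \<tau> j}. {..<j}"
  have bij: "bij_betw (\<lambda>(j, l, h). CZ l j h) ?S (pp_level \<tau> 0 - {CX})"
    unfolding bij_betw_def inj_on_def by (auto simp: pp_level_def image_iff)
  have "(\<Sum>i\<in>pp_level \<tau> 0 - {CX}. F i) = (\<Sum>x\<in>?S. F ((\<lambda>(j, l, h). CZ l j h) x))"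
    by (rule sum.reindex_bij_betw[OF bij, symmetric])
  also have "\<dots> = (\<Sum>j=1..length \<tau>. \<Sum>y\<in>(SIGMA l:{1..rho \<tau> j}. {..<j}). F ((\<lambda>(j, l, h). CZ l j h) (j, y)))"
    by (subst sum.Sigma) (auto intro!: sum.cong)
  also have "\<dots> = (\<Sum>j=1..length \<tau>. \<Sum>l=1..rho \<tau> j. \<Sum>h<j. F (CZ l j h))"
    by (intro sum.cong refl) (subst sum.Sigma, auto intro!: sum.cong)
  finally show ?thesis ..
qed

text \<open>The common kernel of the contact forms \<open>df\<^sub>i - f\<^sub>i\<^sub>+ dx\<close> of the indices of level \<open>a\<close>;
  for coordinates \<open>f\<close> this is the \<open>a\<close>-th derived bundle of the partial prolongation.\<close>

definition contact_bundle ::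
  "('m, 'a::euclidean_space) chart set \<Rightarrow> nat list \<Rightarrow> (pp_coord \<Rightarrow> 'm \<Rightarrow> real) \<Rightarrow> nat \<Rightarrow> 'm \<Rightarrow> 'a set"
  where
  "contact_bundle A \<tau> f a q =
     {v. \<forall>i\<in>pp_level \<tau> a - {CX}. dirder A (f i) q v - f (suc_coord i) q * dirder A (f CX) q v = 0}"

context
  fixes A :: "('m, 'a::euclidean_space) chart set" and I :: "'i set" and f :: "'i \<Rightarrow> 'm \<Rightarrow> real" and q :: 'm
  assumes fin: "finite I" and lin: "\<And>i. i \<in> I \<Longrightarrow> linear (dirder A (f i) q)"
    and ind: "independent_forms I (\<lambda>i. dirder A (f i) q)" and card: "card I = DIM('a)"
begin

lemma coord_field_dual:
  assumes "i \<in> I" "j \<in> I"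
  shows "dirder A (f j) q (coord_field A I f i q) = (if j = i then 1 else 0)"
proof -
  obtain v where v: "\<And>j. j \<in> I \<Longrightarrow> dirder A (f j) q v = (if j = i then 1 else 0)"
    by (rule dual_vector[of I "\<lambda>i. dirder A (f i) q", OF fin lin ind assms(1)], assumption, rule that)
  have "coord_field A I f i q = v"
    unfolding coord_field_def
  proof (rule the_equality)
    show "\<forall>j\<in>I. dirder A (f j) q v = (if j = i then 1 else 0)" by (intro ballI v)
    show "w = v" if w: "\<forall>j\<in>I. dirder A (f j) q w = (if j = i then 1 else 0)" for w
    proof (rule forms_separate[of I "\<lambda>i. dirder A (f i) q", OF fin lin ind card])
      fix j assume j: "j \<in> I"
      show "dirder A (f j) q w = dirder A (f j) q v" unfolding v[OF j] by (rule bspec[OF w j])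
    qed
  qed
  then show ?thesis using v[OF assms(2)] by simp
qed

lemma coord_field_expansion:
  "v = (\<Sum>i\<in>I. dirder A (f i) q v *\<^sub>R coord_field A I f i q)"
proof (rule forms_separate[of I "\<lambda>i. dirder A (f i) q", OF fin lin ind card])
  fix j assume j: "j \<in> I"
  have "dirder A (f j) q (\<Sum>i\<in>I. dirder A (f i) q v *\<^sub>R coord_field A I f i q)
      = (\<Sum>i\<in>I. if j = i then dirder A (f i) q v else 0)"
    using lin[OF j] j by (simp add: linear_sum linear_scale coord_field_dual if_distrib cong: if_cong sum.cong)
  then show "dirder A (f j) q v = dirder A (f j) q (\<Sum>i\<in>I. dirder A (f i) q v *\<^sub>R coord_field A I f i q)"
    using fin j by simp
qed

end

lemma contact_bundle_subspace:
  assumes "\<And>i. i \<in> pp_coords \<tau> \<Longrightarrow> linear (dirder A (f i) q)"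
  shows "subspace (contact_bundle A \<tau> f a q)"
  unfolding contact_bundle_def
proof (rule forms_kernel_subspace)
  fix i assume "i \<in> pp_level \<tau> a - {CX}"
  then have "i \<in> pp_coords \<tau>" using pp_level_subset_coords by blast
  then have "linear (dirder A (f i) q)" by (rule assms)
  moreover have "linear (dirder A (f CX) q)" by (rule assms) simp
  ultimately show "linear (\<lambda>v. dirder A (f i) q v - f (suc_coord i) q * dirder A (f CX) q v)"
    by (intro linearI) (auto simp: linear_add linear_scale algebra_simps)
qed

lemma contact_bundle_dim:
  fixes A :: "('m, 'a::euclidean_space) chart set"
  assumes lin: "\<And>i. i \<in> pp_coords \<tau> \<Longrightarrow> linear (dirder A (f i) q)"
    and ind: "independent_forms (pp_level \<tau> a) (\<lambda>i. dirder A (f i) q)"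
  shows "dim (contact_bundle A \<tau> f a q) + card (pp_level \<tau> a) = Suc DIM('a)"
proof -
  let ?I = "pp_level \<tau> a - {CX}"
  let ?\<theta> = "\<lambda>i v. dirder A (f i) q v - f (suc_coord i) q * dirder A (f CX) q v"
  have ind': "independent_forms ?I ?\<theta>"
    by (rule independent_forms_shear[OF finite_pp_level ind CX_in_pp(2)])
  have lin': "linear (?\<theta> i)" if "i \<in> ?I" for i
  proof -
    have "i \<in> pp_coords \<tau>" using that pp_level_subset_coords by blast
    then have "linear (dirder A (f i) q)" by (rule lin)
    moreover have "linear (dirder A (f CX) q)" by (rule lin) simp
    ultimately show ?thesis by (intro linearI) (auto simp: linear_add linear_scale algebra_simps)
  qed
  have "dim (contact_bundle A \<tau> f a q) + card ?I = DIM('a)"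
  proof -
    have fin: "finite ?I" by simp
    show ?thesis unfolding contact_bundle_def
    proof (rule forms_kernel_dim[of ?I ?\<theta>, OF fin])
    qed (fact lin', fact ind')
  qed
  moreover have "Suc (card ?I) = card (pp_level \<tau> a)"
    by (rule card_Suc_Diff1) simp_all
  ultimately show ?thesis by linarith
qed

text \<open>In the frame of coordinate fields, a vector \<open>v\<close> killed by the contact forms is \<open>dx(v)\<close> times the
  first generator of \<open>C(\<tau>)\<close> plus a combination of the fields of the highest coordinates.\<close>

lemma partial_prolongation_eq_contact_bundle:
  fixes A :: "('m, 'a::euclidean_space) chart set"
  assumes lin: "\<And>i. i \<in> pp_coords \<tau> \<Longrightarrow> linear (dirder A (f i) q)"
    and ind: "independent_forms (pp_coords \<tau>) (\<lambda>i. dirder A (f i) q)"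
    and card: "card (pp_coords \<tau>) = DIM('a)"
  shows "partial_prolongation A \<tau> f q = contact_bundle A \<tau> f 0 q"
proof -
  let ?I = "pp_coords \<tau>" and ?l = "\<lambda>i. dirder A (f i) q" and ?J = "pp_level \<tau> 0 - {CX}"
  define d where "d i = coord_field A ?I f i q" for i
  have dual: "?l j (d i) = (if j = i then 1 else 0)" if "i \<in> ?I" "j \<in> ?I" for i j
    unfolding d_def by (rule coord_field_dual[OF finite_pp_coords lin ind card that])
  have expand: "v = (\<Sum>i\<in>?I. ?l i v *\<^sub>R d i)" for v
    unfolding d_def by (rule coord_field_expansion[OF finite_pp_coords lin ind card])
  have JI: "?J \<subseteq> ?I" using pp_level_subset_coords by auto
  define X where "X = d CX + (\<Sum>i\<in>?J. f (suc_coord i) q *\<^sub>R d i)"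
  define T where "T = {d (CZ l j j) | l j. 1 \<le> j \<and> j \<le> length \<tau> \<and> 1 \<le> l \<and> l \<le> rho \<tau> j}"
  have pp: "partial_prolongation A \<tau> f q = span (insert X T)"
    unfolding partial_prolongation_def Let_def X_def T_def d_def
    using sum_pp_level_0[of "\<lambda>i. f (suc_coord i) q *\<^sub>R coord_field A ?I f i q" \<tau>] by simp
  have lX: "?l j X = (if j = CX then 1 else if j \<in> ?J then f (suc_coord j) q else 0)" if j: "j \<in> ?I" for j
  proof -
    have "?l j X = ?l j (d CX) + (\<Sum>i\<in>?J. f (suc_coord i) q * ?l j (d i))"
      unfolding X_def using lin[OF j] by (simp add: linear_add linear_sum linear_scale)
    also have "(\<Sum>i\<in>?J. f (suc_coord i) q * ?l j (d i)) = (\<Sum>i\<in>?J. if j = i then f (suc_coord i) q else 0)"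
      using JI j dual by (intro sum.cong) auto
    also have "\<dots> = (if j \<in> ?J then f (suc_coord j) q else 0)" by simp
    finally show ?thesis using dual[of CX j] j by auto
  qed
  show ?thesis unfolding pp
  proof
    have "X \<in> contact_bundle A \<tau> f 0 q"
      unfolding contact_bundle_def
    proof (intro CollectI ballI)
      fix i assume i: "i \<in> ?J"
      then have "i \<in> ?I" using JI by blast
      then show "?l i X - f (suc_coord i) q * ?l CX X = 0" using lX[of i] lX[of CX] i by simp
    qed
    moreover have "T \<subseteq> contact_bundle A \<tau> f 0 q"
    proof
      fix v assume "v \<in> T"
      then obtain l j where v: "v = d (CZ l j j)" "1 \<le> j" "j \<le> length \<tau>" "1 \<le> l" "l \<le> rho \<tau> j"
        unfolding T_def by auto
      then have I: "CZ l j j \<in> ?I" by (simp add: CZ_in_pp_coords)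
      show "v \<in> contact_bundle A \<tau> f 0 q"
        unfolding contact_bundle_def v(1)
      proof (intro CollectI ballI)
        fix i assume i: "i \<in> ?J"
        then have "i \<in> ?I" using JI by blast
        moreover have "i \<noteq> CZ l j j" using i by (auto simp: CZ_in_pp_level)
        ultimately show "?l i (d (CZ l j j)) - f (suc_coord i) q * ?l CX (d (CZ l j j)) = 0"
          using dual[OF I, of i] dual[OF I, of CX] by simp
      qed
    qed
    ultimately show "span (insert X T) \<subseteq> contact_bundle A \<tau> f 0 q"
      by (intro span_minimal contact_bundle_subspace lin) auto
    show "contact_bundle A \<tau> f 0 q \<subseteq> span (insert X T)"
    proof
      fix v assume v: "v \<in> contact_bundle A \<tau> f 0 q"
      let ?w = "v - ?l CX v *\<^sub>R X"
      have "?l i ?w *\<^sub>R d i \<in> span (insert X T)" if i: "i \<in> ?I" for i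
      proof (cases "i \<in> insert CX ?J")
        case True
        have "?l i ?w = ?l i v - ?l CX v * ?l i X" using lin[OF i] by (simp add: linear_diff linear_scale)
        also have "\<dots> = 0"
        proof (cases "i = CX")
          case True
          then show ?thesis using lX[OF i] by simp
        next
          case False
          then have "i \<in> ?J" using True by blast
          moreover from this v have "?l i v - f (suc_coord i) q * ?l CX v = 0"
            unfolding contact_bundle_def by blast
          ultimately show ?thesis using lX[OF i] by simp
        qed
        finally show ?thesis by (simp add: span_zero)
      next
        case False
        then obtain l j where "i = CZ l j j" "1 \<le> j" "j \<le> length \<tau>" "1 \<le> l" "l \<le> rho \<tau> j"
          using i unfolding pp_coords_def pp_level_def by (auto simp: le_less)
        then have "d i \<in> T" unfolding T_def by auto
        then show ?thesis by (intro span_scale span_base) auto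
      qed
      then have "?w \<in> span (insert X T)"
        by (subst expand[of ?w]) (rule span_sum)
      moreover have "?l CX v *\<^sub>R X \<in> span (insert X T)"
        by (intro span_scale span_base) simp
      ultimately have "?w + ?l CX v *\<^sub>R X \<in> span (insert X T)" by (rule span_add)
      then show "v \<in> span (insert X T)" by simp
    qed
  qed
qed

text \<open>The structure equation \<open>d(df - g dx) = - dg \<and> dx\<close>, evaluated on two fields that \<open>df - g dx\<close>
  annihilates.\<close>

lemma (in smooth_mfd) contact_form_bracket:
  fixes f g x :: "'m \<Rightarrow> real"
  assumes W: "open W" "q \<in> W" and X: "smooth_field A W X" and Y: "smooth_field A W Y"
    and f: "smooth_fun A W f" and g: "smooth_fun A W g" and x: "smooth_fun A W x"
    and Xf: "\<And>p. p \<in> W \<Longrightarrow> dirder A f p (X p) = g p * dirder A x p (X p)"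
    and Yf: "\<And>p. p \<in> W \<Longrightarrow> dirder A f p (Y p) = g p * dirder A x p (Y p)"
  shows "dirder A f q (lie_bracket A X Y q) - g q * dirder A x q (lie_bracket A X Y q) =
    dirder A g q (X q) * dirder A x q (Y q) - dirder A g q (Y q) * dirder A x q (X q)"
proof -
  note ls = lie_derivative_smooth[OF W(1)]
  have a: "lie_derivative A U (lie_derivative A V f) q =
      g q * lie_derivative A U (lie_derivative A V x) q + dirder A g q (U q) * dirder A x q (V q)"
    if U: "smooth_field A W U" and V: "smooth_field A W V"
      and Vf: "\<And>p. p \<in> W \<Longrightarrow> dirder A f p (V p) = g p * dirder A x p (V p)" for U V
  proof -
    have "lie_derivative A U (lie_derivative A V f) q = lie_derivative A U (\<lambda>p. g p * lie_derivative A V x p) q"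
      by (rule lie_derivative_cong[OF W smooth_fun_mult[OF W(1) g ls[OF V x]]]) (simp add: lie_derivative_def Vf)
    also have "\<dots> = g q * lie_derivative A U (lie_derivative A V x) q + dirder A g q (U q) * dirder A x q (V q)"
      unfolding lie_derivative_def[of A U] using dirder_mult[OF g ls[OF V x] W(2)]
      by (simp add: lie_derivative_def)
    finally show ?thesis .
  qed
  have "lie_derivative A X (lie_derivative A Y f) q =
      g q * lie_derivative A X (lie_derivative A Y x) q + dirder A g q (X q) * dirder A x q (Y q)"
    by (rule a[OF X Y]) (rule Yf)
  moreover have "lie_derivative A Y (lie_derivative A X f) q =
      g q * lie_derivative A Y (lie_derivative A X x) q + dirder A g q (Y q) * dirder A x q (X q)"
    by (rule a[OF Y X]) (rule Xf)
  ultimately show ?thesis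
    unfolding dirder_lie_bracket[OF W X Y f] dirder_lie_bracket[OF W X Y x]
    by (simp add: algebra_simps)
qed

section \<open>The derived flag of a partial prolongation\<close>

lemma smooth_manifold_euclidean: "smooth_manifold (euclidean_atlas :: ('a::euclidean_space, 'a) chart set)"
proof -
  have "smooth_on UNIV (id :: 'a \<Rightarrow> 'a)" by (rule smooth_on_linear[OF open_UNIV bounded_linear_ident[folded id_def]])
  then show ?thesis
    unfolding smooth_manifold_def by (auto simp: homeomorphism_def o_def id_def[symmetric])
qed

interpretation E: smooth_mfd "euclidean_atlas :: ('a::euclidean_space, 'a) chart set"
  by (rule smooth_mfd.intro) (rule smooth_manifold_euclidean)

lemma chart_at_euclidean: "chart_at euclidean_atlas p = (UNIV, id)"
  unfolding chart_at_def by (rule some_equality) auto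

lemma dirder_euclidean: "dirder euclidean_atlas f p = frechet_derivative f (at p)"
  unfolding dirder_def chart_at_euclidean by (simp add: fun_eq_iff)

lemma smooth_fun_euclidean: "smooth_fun euclidean_atlas W f \<longleftrightarrow> smooth_on W f"
  unfolding smooth_fun_def by simp

lemma smooth_field_euclidean: "smooth_field euclidean_atlas W X \<longleftrightarrow> smooth_on W X"
  unfolding smooth_field_def by (simp add: dirder_euclidean smooth_fun_euclidean)

lemma lie_bracket_constant: "lie_bracket euclidean_atlas (\<lambda>_. u) (\<lambda>_. v) p = 0"
  unfolding lie_bracket_def chart_at_euclidean Let_def by (simp add: dirder_euclidean)

lemma bundle_rank_eqI: "(\<And>p. dim (V p) = r) \<Longrightarrow> bundle_rank V = r"
  unfolding bundle_rank_def by (rule the_equality) auto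

text \<open>From the model two ranks are wanted: those of the derived bundles, and those of the Cauchy
  bundles intersected with the preceding derived bundle. The derived bundles turn out to be the
  bundles \<open>K a\<close> of contact forms of level \<open>a\<close>.\<close>

locale pp_model =
  fixes \<tau> :: "nat list" and e :: "pp_coord \<Rightarrow> 'a::euclidean_space"
  assumes e: "bij_betw e (pp_coords \<tau>) Basis"
begin

abbreviation "E \<equiv> euclidean_atlas :: ('a, 'a) chart set"
abbreviation "z \<equiv> \<lambda>i y. y \<bullet> e i"
abbreviation "K \<equiv> contact_bundle E \<tau> z"

lemma card_coords: "card (pp_coords \<tau>) = DIM('a)"
  using bij_betw_same_card[OF e] .

lemma inner_e: "i \<in> pp_coords \<tau> \<Longrightarrow> j \<in> pp_coords \<tau> \<Longrightarrow> e i \<bullet> e j = (if i = j then 1 else 0)"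
proof -
  assume ij: "i \<in> pp_coords \<tau>" "j \<in> pp_coords \<tau>"
  then have "e i \<in> Basis" "e j \<in> Basis" using e by (auto simp: bij_betw_def)
  moreover have "e i = e j \<longleftrightarrow> i = j" using e ij by (meson bij_betw_def inj_on_eq_iff)
  ultimately show ?thesis by (simp add: inner_Basis)
qed

lemma level_coords: "i \<in> pp_level \<tau> a \<Longrightarrow> i \<in> pp_coords \<tau>"
  using pp_level_subset_coords by blast

lemma inner_sum_e:
  assumes "J \<subseteq> pp_coords \<tau>" "j \<in> pp_coords \<tau>"
  shows "(\<Sum>i\<in>J. c i *\<^sub>R e i) \<bullet> e j = (if j \<in> J then c j else 0)"
proof -
  have "(\<Sum>i\<in>J. c i *\<^sub>R e i) \<bullet> e j = (\<Sum>i\<in>J. if i = j then c i else 0)"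
    unfolding inner_sum_left
  proof (rule sum.cong[OF refl])
    fix i assume "i \<in> J"
    then have "i \<in> pp_coords \<tau>" using assms(1) by blast
    then show "(c i *\<^sub>R e i) \<bullet> e j = (if i = j then c i else 0)" using inner_e assms(2) by simp
  qed
  also have "\<dots> = (if j \<in> J then c j else 0)"
    using finite_subset[OF assms(1)] by simp
  finally show ?thesis .
qed

lemma dirder_z: "dirder E (z i) p v = v \<bullet> e i"
proof -
  have "((\<lambda>y. y \<bullet> e i) has_derivative (\<lambda>y. y \<bullet> e i)) (at p)"
    by (rule bounded_linear_imp_has_derivative[OF bounded_linear_inner_left])
  from frechet_derivative_at[OF this] show ?thesis by (simp add: dirder_euclidean)
qed

lemma smooth_z: "open W \<Longrightarrow> smooth_fun E W (z i)"
  unfolding smooth_fun_euclidean by (rule smooth_on_linear[OF _ bounded_linear_inner_left])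

lemma linear_dirder_z: "linear (dirder E (z i) p)"
  using E.dirder_linear[OF smooth_z[OF open_UNIV]] by simp

lemma smooth_constant: "open W \<Longrightarrow> smooth_field E W (\<lambda>_. u)"
  unfolding smooth_field_euclidean by (rule smooth_on_const)

lemma mem_K: "v \<in> K a p \<longleftrightarrow> (\<forall>i\<in>pp_level \<tau> a - {CX}. v \<bullet> e i = (p \<bullet> e (suc_coord i)) * (v \<bullet> e CX))"
  unfolding contact_bundle_def by (simp add: dirder_z)

lemma independent_forms_z: "independent_forms (pp_coords \<tau>) (\<lambda>i. dirder E (z i) p)"
  unfolding independent_forms_def
proof (intro allI impI ballI)
  fix a i assume a: "\<forall>v. (\<Sum>i\<in>pp_coords \<tau>. a i * dirder E (z i) p v) = 0" and i: "i \<in> pp_coords \<tau>"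
  have "0 = (\<Sum>j\<in>pp_coords \<tau>. a j * dirder E (z j) p (e i))" using a by simp
  also have "\<dots> = (\<Sum>j\<in>pp_coords \<tau>. a j *\<^sub>R e j) \<bullet> e i"
    unfolding inner_sum_left by (intro sum.cong refl) (simp add: dirder_z inner_commute)
  also have "\<dots> = a i" using inner_sum_e[of "pp_coords \<tau>" i a] i by simp
  finally show "a i = 0" by simp
qed

lemma independent_forms_level: "independent_forms (pp_level \<tau> a) (\<lambda>i. dirder E (z i) p)"
  by (rule independent_forms_subset[OF independent_forms_z pp_level_subset_coords]) simp

lemma standard_pp_eq: "standard_pp \<tau> e = K 0"
  unfolding standard_pp_def
  by (rule ext, rule partial_prolongation_eq_contact_bundle[OF linear_dirder_z independent_forms_z card_coords])

lemma K_subspace: "subspace (K a p)"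
  by (rule contact_bundle_subspace) (rule linear_dirder_z)

lemma K_dim: "dim (K a p) + card (pp_level \<tau> a) = Suc DIM('a)"
  by (rule contact_bundle_dim[OF linear_dirder_z independent_forms_level])

lemma K_mono: "a \<le> b \<Longrightarrow> K a p \<subseteq> K b p"
  unfolding contact_bundle_def using pp_level_antimono[of a b \<tau>] by blast

lemma section_eq:
  assumes "smooth_section E (K a) W X" "i \<in> pp_level \<tau> a - {CX}" "q \<in> W"
  shows "dirder E (z i) q (X q) = z (suc_coord i) q * dirder E (z CX) q (X q)"
  using assms unfolding smooth_section_def by (auto simp: dirder_z mem_K)

lemma bracket_form:
  assumes W: "open W" "q \<in> W" and X: "smooth_section E (K a) W X" and Y: "smooth_section E (K a) W Y"
    and i: "i \<in> pp_level \<tau> a - {CX}"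
  shows "lie_bracket E X Y q \<bullet> e i - (q \<bullet> e (suc_coord i)) * (lie_bracket E X Y q \<bullet> e CX) =
    (X q \<bullet> e (suc_coord i)) * (Y q \<bullet> e CX) - (Y q \<bullet> e (suc_coord i)) * (X q \<bullet> e CX)"
proof -
  have XY: "smooth_field E W X" "smooth_field E W Y" using X Y unfolding smooth_section_def by auto
  show ?thesis
    using E.contact_form_bracket[OF W XY smooth_z[OF W(1)] smooth_z[OF W(1)] smooth_z[OF W(1)]
        section_eq[OF X i] section_eq[OF Y i]] by (simp add: dirder_z)
qed

text \<open>For an index of level \<open>a + 1\<close> the differential of the next coordinate is on \<open>K a\<close> also a multiple
  of \<open>dx\<close>, so the right side of the structure equation vanishes.\<close>

lemma brackets_K: "brackets E (K a) p \<subseteq> K (Suc a) p"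
proof
  fix v assume "v \<in> brackets E (K a) p"
  then obtain X Y W where *: "v = lie_bracket E X Y p" "open W" "p \<in> W"
    "smooth_section E (K a) W X" "smooth_section E (K a) W Y"
    unfolding brackets_def by auto
  show "v \<in> K (Suc a) p"
    unfolding mem_K
  proof
    fix i assume i: "i \<in> pp_level \<tau> (Suc a) - {CX}"
    then have i': "i \<in> pp_level \<tau> a - {CX}" using pp_level_antimono[of a "Suc a" \<tau>] by auto
    have s: "suc_coord i \<in> pp_level \<tau> a - {CX}" using i suc_coord_level by auto
    have XK: "X p \<in> K a p" "Y p \<in> K a p" using * unfolding smooth_section_def by auto
    have "X p \<bullet> e (suc_coord i) = (p \<bullet> e (suc_coord (suc_coord i))) * (X p \<bullet> e CX)"
      "Y p \<bullet> e (suc_coord i) = (p \<bullet> e (suc_coord (suc_coord i))) * (Y p \<bullet> e CX)"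
      using XK s unfolding mem_K by blast+
    then show "v \<bullet> e i = (p \<bullet> e (suc_coord i)) * (v \<bullet> e CX)"
      using bracket_form[OF *(2-5) i'] *(1) by simp
  qed
qed

text \<open>The generator \<open>\<partial>\<^sub>x + \<Sum> z\<^sub>h\<^sub>+\<^sub>1 \<partial>\<^sub>h\<close> of \<open>C(\<tau>)\<close>.\<close>

definition drift :: "'a \<Rightarrow> 'a" where
  "drift y = e CX + (\<Sum>j\<in>pp_level \<tau> 0 - {CX}. (y \<bullet> e (suc_coord j)) *\<^sub>R e j)"

lemma level_0_coords: "pp_level \<tau> 0 - {CX} \<subseteq> pp_coords \<tau>"
  using pp_level_subset_coords by blast

lemma drift_section: "smooth_section E (K a) UNIV drift"
  unfolding smooth_section_def
proof (intro conjI ballI)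
  show "smooth_field E UNIV drift"
    unfolding drift_def
    by (intro E.smooth_field_add E.smooth_field_sum E.smooth_field_scaleR smooth_constant smooth_z open_UNIV)
  fix y
  have "drift y \<in> K 0 y"
    unfolding mem_K
  proof
    fix i assume i: "i \<in> pp_level \<tau> 0 - {CX}"
    then have "i \<in> pp_coords \<tau>" using level_0_coords by blast
    then show "drift y \<bullet> e i = (y \<bullet> e (suc_coord i)) * (drift y \<bullet> e CX)"
      using i by (auto simp: drift_def inner_add_left inner_sum_e[OF level_0_coords] inner_e)
  qed
  then show "drift y \<in> K a y" using K_mono[of 0 a y] by auto
qed

lemma constant_section:
  assumes "i \<in> pp_coords \<tau>" "i \<notin> pp_level \<tau> a"
  shows "smooth_section E (K a) UNIV (\<lambda>_. e i)"
  unfolding smooth_section_def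
proof (intro conjI ballI smooth_constant open_UNIV)
  fix y
  have "e i \<bullet> e j = 0" if "j \<in> pp_level \<tau> a" for j
    using inner_e[OF assms(1) level_coords[OF that]] that assms(2) by auto
  then show "e i \<in> K a y" unfolding mem_K by simp
qed

text \<open>The bracket with this generator lowers the order of a coordinate field by one, because its
  coefficients are linear.\<close>

lemma bracket_drift:
  assumes "i \<in> pp_level \<tau> 0 - {CX}"
  shows "lie_bracket E (\<lambda>_. e (suc_coord i)) drift p = e i"
proof -
  let ?w = "\<lambda>_ :: 'a. e (suc_coord i)" and ?J = "pp_level \<tau> 0 - {CX}"
  note sc = smooth_constant[OF open_UNIV] and sz = smooth_z[OF open_UNIV]
  have si: "suc_coord i \<in> pp_coords \<tau>" using assms suc_coord_level(2) by auto
  have J: "lie_bracket E ?w (\<lambda>q. (q \<bullet> e (suc_coord j)) *\<^sub>R e j) p = (if i = j then 1 else 0) *\<^sub>R e j"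
    if "j \<in> ?J" for j
  proof -
    have sj: "suc_coord j \<in> pp_coords \<tau>" using that suc_coord_level(2) by auto
    have "lie_bracket E ?w (\<lambda>q. (q \<bullet> e (suc_coord j)) *\<^sub>R e j) p =
        lie_derivative E ?w (z (suc_coord j)) p *\<^sub>R e j + (p \<bullet> e (suc_coord j)) *\<^sub>R lie_bracket E ?w (\<lambda>_. e j) p"
      by (intro E.lie_bracket_scale_right[OF open_UNIV UNIV_I] sc sz)
    then show ?thesis
      by (simp add: lie_bracket_constant lie_derivative_def dirder_z inner_e[OF si sj] inj_suc_coord)
  qed
  have "lie_bracket E ?w drift p = lie_bracket E ?w (\<lambda>_. e CX) p +
      lie_bracket E ?w (\<lambda>q. \<Sum>j\<in>?J. (q \<bullet> e (suc_coord j)) *\<^sub>R e j) p"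
    unfolding drift_def
    by (intro E.lie_bracket_add_right[OF open_UNIV UNIV_I] E.smooth_field_sum E.smooth_field_scaleR sc sz open_UNIV UNIV_I)
  also have "lie_bracket E ?w (\<lambda>q. \<Sum>j\<in>?J. (q \<bullet> e (suc_coord j)) *\<^sub>R e j) p =
      (\<Sum>j\<in>?J. lie_bracket E ?w (\<lambda>q. (q \<bullet> e (suc_coord j)) *\<^sub>R e j) p)"
    by (intro E.lie_bracket_sum_right[OF open_UNIV UNIV_I] E.smooth_field_scaleR sc sz open_UNIV UNIV_I) simp
  also have "\<dots> = (\<Sum>j\<in>?J. (if i = j then 1 else 0) *\<^sub>R e j)"
    by (rule sum.cong[OF refl J])
  also have "\<dots> = (\<Sum>j\<in>?J. if i = j then e j else 0)" by (rule sum.cong) auto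
  also have "\<dots> = e i" using assms by simp
  finally show ?thesis unfolding lie_bracket_constant by (simp only: add_0_left)
qed

text \<open>The directions of \<open>K (a + 1)\<close> that are missing in \<open>K a\<close> are those of the coordinates that level
  \<open>a + 1\<close> omits; they are brackets with \<open>drift\<close> of coordinate fields in \<open>K a\<close>.\<close>

lemma derived_K: "derived_bundle E (K a) = K (Suc a)"
proof (rule ext, rule equalityI)
  fix p
  show "derived_bundle E (K a) p \<subseteq> K (Suc a) p"
    unfolding derived_bundle_def
    by (intro span_minimal K_subspace Un_least brackets_K K_mono) simp
  show "K (Suc a) p \<subseteq> derived_bundle E (K a) p"
  proof
    fix v assume v: "v \<in> K (Suc a) p"
    let ?N = "pp_level \<tau> a - pp_level \<tau> (Suc a)"
    have N: "?N \<subseteq> pp_coords \<tau>" using pp_level_subset_coords by blast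
    define t where "t i = v \<bullet> e i - (p \<bullet> e (suc_coord i)) * (v \<bullet> e CX)" for i
    define w where "w = v - (\<Sum>i\<in>?N. t i *\<^sub>R e i)"
    have we: "w \<bullet> e i = v \<bullet> e i - (if i \<in> ?N then t i else 0)" if "i \<in> pp_coords \<tau>" for i
      unfolding w_def inner_diff_left inner_sum_e[OF N that] ..
    have "w \<in> K a p"
      unfolding mem_K
    proof
      fix i assume i: "i \<in> pp_level \<tau> a - {CX}"
      then have ic: "i \<in> pp_coords \<tau>" using level_coords by blast
      show "w \<bullet> e i = (p \<bullet> e (suc_coord i)) * (w \<bullet> e CX)"
      proof (cases "i \<in> ?N")
        case True
        then show ?thesis using we[OF ic] we[of CX] by (simp add: t_def)
      next
        case False
        then have "i \<in> pp_level \<tau> (Suc a) - {CX}" using i by blast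
        then show ?thesis using v we[OF ic] we[of CX] False unfolding mem_K by simp
      qed
    qed
    then have "w \<in> derived_bundle E (K a) p" unfolding derived_bundle_def by (auto intro: span_base)
    moreover have "e i \<in> derived_bundle E (K a) p" if i: "i \<in> ?N" for i
    proof -
      have i0: "i \<in> pp_level \<tau> 0 - {CX}" using i pp_level_antimono[of 0 a \<tau>] by auto
      have "lie_bracket E (\<lambda>_. e (suc_coord i)) drift p \<in> derived_bundle E (K a) p"
        using i0 by (intro E.bracket_in_derived[OF open_UNIV UNIV_I] constant_section drift_section
            suc_coord_not_level[OF i] suc_coord_level(2)) auto
      then show ?thesis by (simp add: bracket_drift[OF i0])
    qed
    moreover have "subspace (derived_bundle E (K a) p)" by (simp add: derived_bundle_def)
    ultimately have "w + (\<Sum>i\<in>?N. t i *\<^sub>R e i) \<in> derived_bundle E (K a) p"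
      by (intro subspace_add subspace_sum subspace_scale) auto
    then show "v \<in> derived_bundle E (K a) p" by (simp add: w_def)
  qed
qed

lemma flag_standard_pp: "derived_flag E (standard_pp \<tau> e) a = K a"
  by (induction a) (simp_all only: E.derived_flag_0 E.derived_flag_Suc standard_pp_eq derived_K)

lemma flag_rank_standard_pp: "flag_rank E (standard_pp \<tau> e) a + card (pp_level \<tau> a) = Suc DIM('a)"
proof -
  have "flag_rank E (standard_pp \<tau> e) a = Suc DIM('a) - card (pp_level \<tau> a)"
    unfolding flag_rank_def flag_standard_pp
  proof (rule bundle_rank_eqI)
    show "dim (K a p) = Suc DIM('a) - card (pp_level \<tau> a)" for p using K_dim[of a p] by simp
  qed
  then show ?thesis using K_dim[of a 0] by simp
qed

text \<open>A Cauchy field of \<open>C(\<tau>)\<^sup>(\<^sup>i\<^sup>)\<close> has no \<open>x\<close>-component: its bracket with the coordinate field of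
  \<open>z\<^sup>1\<^sup>,\<^sup>k\<^sub>k\<^sub>-\<^sub>i\<close> would contain \<open>\<partial>\<close> of the preceding coordinate.\<close>

lemma char_bundle_int_standard_pp:
  assumes i: "1 \<le> i" "i < length \<tau>" and k: "1 \<le> rho \<tau> (length \<tau>)"
  shows "char_bundle_int E (standard_pp \<tau> e) i p = {v. \<forall>c\<in>pp_level \<tau> (i - 1). v \<bullet> e c = 0}"
proof (intro equalityI subsetI)
  fix v assume "v \<in> char_bundle_int E (standard_pp \<tau> e) i p"
  then have v: "v \<in> K (i - 1) p" "v \<in> cauchy_bundle E (K i) p"
    unfolding char_bundle_int_def char_bundle_def flag_standard_pp by auto
  obtain Y W where Y: "v = Y p" "open W" "p \<in> W" "cauchy_field E (K i) W Y"
    using v(2) unfolding cauchy_bundle_iff by blast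
  let ?k = "length \<tau>"
  let ?c = "CZ 1 ?k (?k - i - 1)" and ?d = "CZ 1 ?k (?k - i)"
  have cd: "suc_coord ?c = ?d" using i by simp
  have d: "?d \<in> pp_coords \<tau>" "?d \<notin> pp_level \<tau> i" using i k by (auto simp: CZ_in_pp_coords CZ_in_pp_level)
  have c: "?c \<in> pp_level \<tau> i - {CX}" using i k by (auto simp: CZ_in_pp_level)
  have Ys: "smooth_section E (K i) W Y" using Y(4) unfolding cauchy_field_def by blast
  have ds: "smooth_section E (K i) W (\<lambda>_. e ?d)"
    using E.smooth_section_subset[OF constant_section[OF d]] by blast
  have "lie_bracket E Y (\<lambda>_. e ?d) p \<in> K i p"
    using Y ds unfolding cauchy_field_def by blast
  from this[unfolded mem_K, rule_format, OF c] bracket_form[OF Y(2,3) Ys ds c]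
  have "0 = (Y p \<bullet> e (suc_coord ?c)) * (e ?d \<bullet> e CX) - (e ?d \<bullet> e (suc_coord ?c)) * (Y p \<bullet> e CX)"
    by linarith
  then have "0 = (Y p \<bullet> e ?d) * (e ?d \<bullet> e CX) - (e ?d \<bullet> e ?d) * (Y p \<bullet> e CX)"
    unfolding cd .
  then have x: "v \<bullet> e CX = 0" using inner_e[OF d(1) d(1)] inner_e[OF d(1), of CX] Y(1) by simp
  show "v \<in> {v. \<forall>c\<in>pp_level \<tau> (i - 1). v \<bullet> e c = 0}"
  proof (intro CollectI ballI)
    fix c assume c: "c \<in> pp_level \<tau> (i - 1)"
    show "v \<bullet> e c = 0"
    proof (cases "c = CX")
      case False
      then have "v \<bullet> e c = (p \<bullet> e (suc_coord c)) * (v \<bullet> e CX)" using v(1) c unfolding mem_K by blast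
      then show ?thesis using x by simp
    qed (simp add: x)
  qed
next
  fix v assume "v \<in> {v. \<forall>c\<in>pp_level \<tau> (i - 1). v \<bullet> e c = 0}"
  then have v: "v \<bullet> e c = 0" if "c \<in> pp_level \<tau> (i - 1)" for c using that by blast
  have v': "v \<bullet> e c = 0" if "c \<in> pp_level \<tau> i" for c
    using v pp_level_antimono[of "i - 1" i \<tau>] that by auto
  have vK: "v \<in> K (i - 1) q" "v \<in> K i q" for q unfolding mem_K using v v' by simp_all
  have vs: "smooth_section E (K i) W (\<lambda>_. v)" if "open W" for W
    unfolding smooth_section_def using vK(2) smooth_constant[OF that] by blast
  have "cauchy_field E (K i) UNIV (\<lambda>_. v)"
    unfolding cauchy_field_def
  proof (intro conjI vs open_UNIV allI impI ballI)
    fix W Y q assume W: "open W" "smooth_section E (K i) W Y" "q \<in> W"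
    show "lie_bracket E (\<lambda>_. v) Y q \<in> K i q"
      unfolding mem_K
    proof
      fix c assume c: "c \<in> pp_level \<tau> i - {CX}"
      then have "suc_coord c \<in> pp_level \<tau> (i - 1)" using suc_coord_level(1)[of c \<tau> "i - 1"] i by simp
      then show "lie_bracket E (\<lambda>_. v) Y q \<bullet> e c = (q \<bullet> e (suc_coord c)) * (lie_bracket E (\<lambda>_. v) Y q \<bullet> e CX)"
        using bracket_form[OF W(1,3) vs[OF W(1)] W(2) c] v by simp
    qed
  qed
  then have "v \<in> cauchy_bundle E (K i) p"
    unfolding cauchy_bundle_iff by (intro exI[of _ "\<lambda>_. v"] exI[of _ UNIV]) simp
  then show "v \<in> char_bundle_int E (standard_pp \<tau> e) i p"
    unfolding char_bundle_int_def char_bundle_def flag_standard_pp using vK(1) by blast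
qed

lemma char_int_rank_standard_pp:
  assumes "1 \<le> i" "i < length \<tau>" "1 \<le> rho \<tau> (length \<tau>)"
  shows "bundle_rank (char_bundle_int E (standard_pp \<tau> e) i) + card (pp_level \<tau> (i - 1)) = DIM('a)"
proof -
  have d: "dim {v. \<forall>c\<in>pp_level \<tau> (i - 1). v \<bullet> e c = 0} + card (pp_level \<tau> (i - 1)) = DIM('a)"
    using forms_kernel_dim[OF finite_pp_level linear_dirder_z independent_forms_level, of "i - 1" 0]
    by (simp add: dirder_z)
  have "bundle_rank (char_bundle_int E (standard_pp \<tau> e) i) = dim {v. \<forall>c\<in>pp_level \<tau> (i - 1). v \<bullet> e c = 0}"
    by (rule bundle_rank_eqI) (simp add: char_bundle_int_standard_pp[OF assms])
  with d show ?thesis by simp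
qed

end

section \<open>Charts from independent differentials\<close>

context smooth_mfd
begin

lemma differential_apply:
  assumes "smooth_fun A W f" "p \<in> W"
  shows "blinfun_apply (differential A f p) v = dirder A f p v"
  unfolding differential_def using dirder_linear[OF assms]
  by (simp add: bounded_linear_Blinfun_apply linear_conv_bounded_linear)

lemma smooth_fun_continuous:
  assumes W: "open W" and f: "smooth_fun A W f"
  shows "continuous_on W f"
proof -
  have "isCont f p" if p: "p \<in> W" for p
  proof -
    obtain D c where c: "(D, c) \<in> A" "p \<in> D" by (metis chart_at_props)
    let ?S = "W \<inter> D"
    have op: "open ?S" using W chart_homeomorphism(1)[OF c(1)] by blast
    have cc: "continuous_on ?S c"
      using homeomorphism_cont1[OF chart_homeomorphism(3)[OF c(1)]] by (rule continuous_on_subset) simp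
    have "continuous_on ?S (\<lambda>q. f (inv_into D c (c q)))"
      by (rule continuous_on_compose2[OF smooth_on_continuous[OF smooth_funD[OF f c(1)]] cc]) simp
    then have "continuous_on ?S f"
      by (rule continuous_on_eq) (simp add: inv_chart[OF c(1)])
    then show ?thesis using op p c(2) continuous_on_eq_continuous_at by blast
  qed
  then show ?thesis using W continuous_on_eq_continuous_at by blast
qed

lemma frechet_in_chart_inj:
  fixes \<psi> :: "'m \<Rightarrow> 'a"
  assumes W: "open W" and \<psi>: "smooth_fun A W \<psi>" and q: "q \<in> W" and inj: "inj (dirder A \<psi> q)"
    and c: "(D, c) \<in> A" "q \<in> D"
  shows "inj (frechet_derivative (\<psi> \<circ> inv_into D c) (at (c q)))"
proof -
  let ?D = "frechet_derivative (\<psi> \<circ> inv_into D c) (at (c q))"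
  have lin: "linear ?D" using smooth_fun_has_derivative[OF \<psi> q c] has_derivative_linear by blast
  have "surj (dirder A c q)"
    by (rule linear_injective_imp_surjective[OF dirder_linear[OF smooth_fun_chart[OF c(1)] c(2)] inj_dirder_chart[OF c]]) simp
  then have "u = 0" if "?D u = 0" for u
  proof -
    obtain v where v: "u = dirder A c q v" using \<open>surj (dirder A c q)\<close> by (metis surjD)
    then have "dirder A \<psi> q v = 0" using dirder_in_chart[OF W \<psi> q c, of v] that by simp
    then have "v = 0" using inj dirder_linear[OF \<psi> q] linear_injective_0 by blast
    then show "u = 0" using v linear_0[OF dirder_linear[OF smooth_fun_chart[OF c(1)] c(2)]] by simp
  qed
  then show ?thesis using linear_injective_0[OF lin] by blast
qed

text \<open>The map is injective near the point by \<open>locally_injective\<close>. Read in any chart it satisfies the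
  hypotheses of \<open>smooth_inverse_function\<close>.\<close>

lemma is_chart_near:
  fixes \<psi> :: "'m \<Rightarrow> 'a"
  assumes W: "open W" and \<psi>: "smooth_fun A W \<psi>" and inj: "\<And>q. q \<in> W \<Longrightarrow> inj (dirder A \<psi> q)" and p: "p \<in> W"
  obtains W1 where "open W1" "p \<in> W1" "W1 \<subseteq> W" "is_chart A W1 \<psi>"
proof -
  obtain D c where c: "(D, c) \<in> A" "p \<in> D" by (metis chart_at_props)
  let ?S = "c ` (W \<inter> D)"
  have pS: "c p \<in> ?S" using p c(2) by blast
  obtain T where T: "open T" "c p \<in> T" "T \<subseteq> ?S" "inj_on (\<psi> \<circ> inv_into D c) T"
    "\<And>z. z \<in> T \<Longrightarrow> inj (frechet_derivative (\<psi> \<circ> inv_into D c) (at z))"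
    by (rule locally_injective[OF chart_image_open[OF c(1) W] smooth_fun_in_chart[OF \<psi> c(1)] pS
        frechet_in_chart_inj[OF W \<psi> p inj[OF p] c]]) (rule that)
  let ?W1 = "D \<inter> c -` T \<inter> W"
  have W1: "open ?W1"
    using continuous_open_preimage[OF homeomorphism_cont1[OF chart_homeomorphism(3)[OF c(1)]] chart_homeomorphism(1)[OF c(1)] T(1)] W
    by blast
  have injW1: "inj_on \<psi> ?W1"
  proof (rule inj_onI)
    fix q q' assume q: "q \<in> ?W1" "q' \<in> ?W1" "\<psi> q = \<psi> q'"
    then have "(\<psi> \<circ> inv_into D c) (c q) = (\<psi> \<circ> inv_into D c) (c q')" by (simp add: inv_chart[OF c(1)])
    from inj_onD[OF T(4) this] have "c q = c q'" using q by blast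
    from inj_onD[OF chart_homeomorphism(4)[OF c(1)] this] show "q = q'" using q by blast
  qed
  have loc: "open (\<psi> ` (?W1 \<inter> D')) \<and> smooth_on (\<psi> ` (?W1 \<inter> D')) (c' \<circ> inv_into ?W1 \<psi>)"
    if c': "(D', c') \<in> A" for D' c'
  proof -
    let ?S' = "c' ` (?W1 \<inter> D')" and ?G = "\<psi> \<circ> inv_into D' c'"
    have op: "open ?S'" by (rule chart_image_open[OF c' W1])
    have G: "?G (c' q) = \<psi> q" if "q \<in> D'" for q by (simp add: inv_chart[OF c' that])
    have sm: "smooth_on ?S' ?G"
      by (rule smooth_on_subset[OF smooth_fun_in_chart[OF \<psi> c']]) auto
    have injG: "inj_on ?G ?S'"
    proof (rule inj_onI)
      fix y y' assume "y \<in> ?S'" "y' \<in> ?S'" and eq: "?G y = ?G y'"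
      then obtain q q' where q: "q \<in> ?W1" "q \<in> D'" "y = c' q" "q' \<in> ?W1" "q' \<in> D'" "y' = c' q'" by blast
      then have "\<psi> q = \<psi> q'" using eq G by simp
      then show "y = y'" using injW1 q by (auto dest: inj_onD)
    qed
    have injD: "inj (frechet_derivative ?G (at y))" if "y \<in> ?S'" for y
    proof -
      obtain q where "q \<in> W" "q \<in> D'" "y = c' q" using \<open>y \<in> ?S'\<close> by blast
      then show ?thesis using frechet_in_chart_inj[OF W \<psi> _ inj c'] by blast
    qed
    note inverse = smooth_inverse_function[OF op sm injG injD]
    have im: "?G ` ?S' = \<psi> ` (?W1 \<inter> D')"
      unfolding image_image by (rule image_cong[OF refl]) (use G in blast)
    have "smooth_on (\<psi> ` (?W1 \<inter> D')) (c' \<circ> inv_into ?W1 \<psi>)"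
    proof (rule smooth_on_cong[OF _ _ inverse(2)[unfolded im]])
      show "open (\<psi> ` (?W1 \<inter> D'))" using inverse(1) im by simp
      fix y assume "y \<in> \<psi> ` (?W1 \<inter> D')"
      then obtain q where q: "q \<in> ?W1" "q \<in> D'" "y = \<psi> q" by blast
      then have "inv_into ?W1 \<psi> y = q" using injW1 by simp
      moreover have "inv_into ?S' ?G y = c' q"
        unfolding q(3) G[OF q(2), symmetric] by (rule inv_into_f_f[OF injG]) (use q in blast)
      ultimately show "inv_into ?S' ?G y = (c' \<circ> inv_into ?W1 \<psi>) y" by simp
    qed
    then show ?thesis using inverse(1) im by simp
  qed
  have "?W1 \<inter> D = ?W1" by blast
  then have opi: "open (\<psi> ` ?W1)" using loc[OF c(1)] by simp
  have "is_chart A ?W1 \<psi>"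
    unfolding is_chart_def using W1 opi injW1 smooth_fun_subset[OF \<psi>, of ?W1] loc by auto
  moreover have "p \<in> ?W1" "?W1 \<subseteq> W" using p c(2) T(2) by auto
  ultimately show ?thesis by (intro that[OF W1])
qed

end

text \<open>As the \<open>\<omega>\<^sub>m\<close> are independent modulo \<open>\<Xi>\<close>, a relation among the \<open>\<alpha>\<^sub>l\<close> modulo \<open>\<Xi>\<close> says that the row
  of its coefficients is annihilated by \<open>M\<close>.\<close>

lemma independent_modulo:
  fixes \<omega> :: "nat \<Rightarrow> 'v::real_vector" and M :: "real mat"
  assumes \<Xi>: "subspace \<Xi>" and dim: "dim (span (\<omega> ` {1..r})) = r" and disj: "\<Xi> \<inter> span (\<omega> ` {1..r}) = {0}"
    and M: "M \<in> carrier_mat r r" "Determinant.det M \<noteq> 0"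
    and eq: "\<And>l. l \<in> {1..r} \<Longrightarrow> \<alpha> l - (\<Sum>m=1..r. (M $$ (l - 1, m - 1)) *\<^sub>R \<omega> m) \<in> \<Xi>"
    and c: "(\<Sum>l=1..r. c l *\<^sub>R \<alpha> l) \<in> \<Xi>" and l: "l \<in> {1..r}"
  shows "c l = 0"
proof -
  have ind: "independent_family {1..r} \<omega>"
  proof -
    obtain B where B: "B \<subseteq> \<omega> ` {1..r}" "independent B" "\<omega> ` {1..r} \<subseteq> span B" "card B = dim (\<omega> ` {1..r})"
      by (rule basis_exists)
    have "card B = r" using B(4) dim by simp
    moreover have "card (\<omega> ` {1..r}) \<le> r" using card_image_le[of "{1..r}" \<omega>] by simp
    ultimately have "B = \<omega> ` {1..r}" "card (\<omega> ` {1..r}) = card {1..r}"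
      using B(1) card_seteq[of "\<omega> ` {1..r}" B] card_mono[of "\<omega> ` {1..r}" B] by auto
    then show ?thesis using B(2) by (simp add: independent_family_iff eq_card_imp_inj_on)
  qed
  have "(\<Sum>l=1..r. c l *\<^sub>R (\<alpha> l - (\<Sum>m=1..r. (M $$ (l - 1, m - 1)) *\<^sub>R \<omega> m))) \<in> \<Xi>"
    using eq \<Xi> by (intro subspace_sum subspace_scale) auto
  then have "(\<Sum>l=1..r. c l *\<^sub>R \<alpha> l) - (\<Sum>l=1..r. c l *\<^sub>R (\<alpha> l - (\<Sum>m=1..r. (M $$ (l - 1, m - 1)) *\<^sub>R \<omega> m))) \<in> \<Xi>"
    by (rule subspace_diff[OF \<Xi> c])
  also have "(\<Sum>l=1..r. c l *\<^sub>R \<alpha> l) - (\<Sum>l=1..r. c l *\<^sub>R (\<alpha> l - (\<Sum>m=1..r. (M $$ (l - 1, m - 1)) *\<^sub>R \<omega> m)))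
      = (\<Sum>l=1..r. \<Sum>m=1..r. (c l * M $$ (l - 1, m - 1)) *\<^sub>R \<omega> m)"
    by (simp add: scaleR_diff_right sum_subtractf scaleR_sum_right)
  also have "\<dots> = (\<Sum>m=1..r. (\<Sum>l=1..r. c l * M $$ (l - 1, m - 1)) *\<^sub>R \<omega> m)"
    by (subst sum.swap) (simp add: scaleR_sum_left)
  finally have inX: "(\<Sum>m=1..r. (\<Sum>l=1..r. c l * M $$ (l - 1, m - 1)) *\<^sub>R \<omega> m) \<in> \<Xi>" .
  moreover have "(\<Sum>m=1..r. (\<Sum>l=1..r. c l * M $$ (l - 1, m - 1)) *\<^sub>R \<omega> m) \<in> span (\<omega> ` {1..r})"
    by (intro span_sum span_scale span_base) auto
  ultimately have "(\<Sum>m=1..r. (\<Sum>l=1..r. c l * M $$ (l - 1, m - 1)) *\<^sub>R \<omega> m) = 0" using disj by blast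
  then have cM: "(\<Sum>l=1..r. c l * M $$ (l - 1, m - 1)) = 0" if "m \<in> {1..r}" for m
    using independent_familyD[OF ind, of "\<lambda>m. \<Sum>l=1..r. c l * M $$ (l - 1, m - 1)" m] that by simp
  define v where "v = vec r (\<lambda>i. c (Suc i))"
  have shift: "(\<Sum>l=1..r. g l) = (\<Sum>i<r. g (Suc i))" for g :: "nat \<Rightarrow> real"
    by (rule sum.reindex_bij_witness[of _ Suc "\<lambda>l. l - 1"]) auto
  have Mt: "transpose_mat M \<in> carrier_mat r r" using M(1) by simp
  have "transpose_mat M *\<^sub>v v = 0\<^sub>v r"
  proof (rule eq_vecI)
    fix m assume "m < dim_vec (0\<^sub>v r :: real vec)"
    then have m: "m < r" by simp
    have "(transpose_mat M *\<^sub>v v) $ m = (\<Sum>i<r. M $$ (i, m) * c (Suc i))"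
      using M(1) m by (simp add: v_def scalar_prod_def atLeast0LessThan)
    also have "\<dots> = (\<Sum>l=1..r. c l * M $$ (l - 1, Suc m - 1))" by (subst shift) (simp add: mult.commute)
    also have "\<dots> = 0" by (rule cM) (use m in auto)
    finally show "(transpose_mat M *\<^sub>v v) $ m = 0\<^sub>v r $ m" using m by simp
  qed (use M(1) in auto)
  moreover have "Determinant.det (transpose_mat M) \<noteq> 0" using M by (simp add: det_transpose)
  ultimately have "v = 0\<^sub>v r"
    using det_0_iff_vec_prod_zero_field[OF Mt] by (metis v_def vec_carrier)
  moreover have "l - 1 < r" "Suc (l - 1) = l" using l by auto
  ultimately show "c l = 0" unfolding v_def by (metis index_vec index_zero_vec(1))
qed

section \<open>Goursat bundles\<close>

locale goursat = smooth_mfd A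
  for A :: "('m::{t2_space,second_countable_topology}, 'a::euclidean_space) chart set" +
  fixes V :: "'m \<Rightarrow> 'a set" and \<tau> :: "nat list" and k :: nat
  assumes gb: "goursat_bundle A V \<tau>" and kd: "k = derived_length A V" and k2: "k \<ge> 2" and rk: "rho \<tau> k = 1"
begin

abbreviation "F \<equiv> derived_flag A V"

lemma regular: "regular_bundle A V"
  using gb unfolding goursat_bundle_def Let_def totally_regular_def by blast

lemma length_\<tau>: "length \<tau> = k"
proof -
  have "map int \<tau> = deccel A V" using gb unfolding goursat_bundle_def Let_def by blast
  then have "length \<tau> = length (deccel A V)" by (metis length_map)
  then show ?thesis using k2 by (simp add: deccel_def Let_def kd[symmetric])
qed

lemma F_subbundle: "subbundle A (F a)"
  by (rule derived_flag_subbundle[OF regular])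

lemma F_subspace: "subspace (F a p)"
  by (rule subbundle_subspace[OF F_subbundle])

lemma F_top: "F k p = UNIV"
  using gb unfolding goursat_bundle_def Let_def kd by metis

lemma model:
  obtains e where "pp_model \<tau> (e :: pp_coord \<Rightarrow> 'a)"
    "\<And>i. i \<le> k \<Longrightarrow> flag_rank A V i = flag_rank euclidean_atlas (standard_pp \<tau> e) i"
    "\<And>i. 1 \<le> i \<Longrightarrow> i < k \<Longrightarrow> bundle_rank (char_bundle_int A V i) =
       bundle_rank (char_bundle_int euclidean_atlas (standard_pp \<tau> e) i)"
proof -
  obtain e :: "pp_coord \<Rightarrow> 'a" where e: "bij_betw e (pp_coords \<tau>) Basis"
    "\<forall>i\<le>k. flag_rank A V i = flag_rank euclidean_atlas (standard_pp \<tau> e) i"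
    "\<forall>i\<in>{1..k-1}. bundle_rank (char_bundle_int A V i) =
       bundle_rank (char_bundle_int euclidean_atlas (standard_pp \<tau> e) i)"
    using gb unfolding goursat_bundle_def Let_def kd[symmetric] by blast
  show ?thesis
  proof (rule that)
    show "pp_model \<tau> e" by (rule pp_model.intro) (rule e(1))
  qed (use e(2,3) in auto)
qed

lemma F_dim: "a \<le> k \<Longrightarrow> dim (F a p) + card (pp_level \<tau> a) = Suc DIM('a)"
proof -
  assume a: "a \<le> k"
  obtain e where e: "pp_model \<tau> (e :: pp_coord \<Rightarrow> 'a)"
    "\<And>i. i \<le> k \<Longrightarrow> flag_rank A V i = flag_rank euclidean_atlas (standard_pp \<tau> e) i"
    by (rule model) (rule that)
  have "dim (F a p) = flag_rank A V a"
    unfolding flag_rank_def by (rule subbundle_rank[OF F_subbundle])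
  then show ?thesis using e(2)[OF a] pp_model.flag_rank_standard_pp[OF e(1), of a] by simp
qed

lemma card_pp_coords: "card (pp_coords \<tau>) = DIM('a)"
proof -
  obtain e where e: "pp_model \<tau> (e :: pp_coord \<Rightarrow> 'a)" by (rule model)
  show ?thesis by (rule pp_model.card_coords[OF e])
qed

lemma char_int_subbundle: "1 \<le> i \<Longrightarrow> i < k \<Longrightarrow> subbundle A (char_bundle_int A V i)"
  and char_int_integrable: "1 \<le> i \<Longrightarrow> i < k \<Longrightarrow> integrable_bundle A (char_bundle_int A V i)"
proof -
  have "\<forall>i\<in>{1..k-1}. subbundle A (char_bundle_int A V i) \<and> integrable_bundle A (char_bundle_int A V i)"
    using gb unfolding goursat_bundle_def Let_def kd[symmetric] by blast
  then show "1 \<le> i \<Longrightarrow> i < k \<Longrightarrow> subbundle A (char_bundle_int A V i)"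
    "1 \<le> i \<Longrightarrow> i < k \<Longrightarrow> integrable_bundle A (char_bundle_int A V i)" by auto
qed

lemma char_int_dim:
  assumes i: "1 \<le> i" "i < k"
  shows "dim (char_bundle_int A V i p) + card (pp_level \<tau> (i - 1)) = DIM('a)"
proof -
  obtain e where e: "pp_model \<tau> (e :: pp_coord \<Rightarrow> 'a)"
    "\<And>i. 1 \<le> i \<Longrightarrow> i < k \<Longrightarrow> bundle_rank (char_bundle_int A V i) =
       bundle_rank (char_bundle_int euclidean_atlas (standard_pp \<tau> e) i)"
    by (rule model) (rule that)
  show ?thesis
    using subbundle_rank[OF char_int_subbundle[OF i], of p] e(2)[OF i]
      pp_model.char_int_rank_standard_pp[OF e(1), of i] i rk by (simp add: length_\<tau>)
qed

lemma F_Suc: "F (Suc a) p = span (F a p \<union> brackets A (F a) p)"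
  by (simp add: derived_flag_Suc derived_bundle_def)

lemma F_mono: "a \<le> b \<Longrightarrow> F a p \<subseteq> F b p"
proof (induction rule: dec_induct)
  case (step b)
  then show ?case unfolding F_Suc using span_superset by blast
qed simp

lemma F_bracket:
  assumes "open W" "q \<in> W" "smooth_section A (F a) W X" "smooth_section A (F a) W Y"
  shows "lie_bracket A X Y q \<in> F (Suc a) q"
  unfolding derived_flag_Suc by (rule bracket_in_derived[OF assms])

end

locale goursat_integral = goursat A V \<tau> k
  for A :: "('m::{t2_space,second_countable_topology}, 'a::euclidean_space) chart set" and V \<tau> k +
  fixes x :: "'m \<Rightarrow> real" and U :: "'m set"
  assumes U: "open U" and fix_x: "first_integral A U (char_bundle A V (k - 1)) x"
begin

text \<open>Where a unit section exists, this family will be recognised as \<open>Char V\<^sup>(\<^sup>a\<^sup>+\<^sup>1\<^sup>)\<^sub>a\<close> for \<open>a + 1 < k\<close>, and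
  as part of \<open>\<Pi>\<^sup>k\<close> for \<open>a = k - 1\<close>. Its definition does not involve a section \<open>Z\<close>, whereas that of
  \<open>\<Pi>\<^sup>k\<close> does.\<close>

definition H :: "nat \<Rightarrow> 'm \<Rightarrow> 'a set" where
  "H a q = {v \<in> F a q. dirder A x q v = 0}"

lemma x_smooth: "smooth_fun A U x"
  using fix_x unfolding first_integral_def by blast

lemma x_linear: "q \<in> U \<Longrightarrow> linear (dirder A x q)"
  by (rule dirder_linear[OF x_smooth])

lemma H_subspace: "q \<in> U \<Longrightarrow> subspace (H a q)"
  unfolding H_def using F_subspace[of a q] x_linear[of q]
  by (auto simp: subspace_def linear_0 linear_add linear_scale)

lemma H_mono: "a \<le> b \<Longrightarrow> H a q \<subseteq> H b q"
  unfolding H_def using F_mono by blast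

text \<open>As Cauchy fields of \<open>V\<^sup>(\<^sup>j\<^sup>)\<close> are Cauchy fields of \<open>V\<^sup>(\<^sup>k\<^sup>-\<^sup>1\<^sup>)\<close>, \<open>x\<close> is a first integral of every \<open>Char V\<^sup>(\<^sup>j\<^sup>)\<close>.\<close>

lemma x_first_integral_char:
  assumes j: "j < k" and v: "v \<in> char_bundle A V j q" and q: "q \<in> U"
  shows "dirder A x q v = 0"
proof -
  obtain X W where X: "v = X q" "open W" "q \<in> W" "cauchy_field A (F j) W X"
    using v unfolding char_bundle_def cauchy_bundle_iff by blast
  have "cauchy_field A (F (k - 1)) W X"
    by (rule cauchy_field_flag_mono[OF regular X(4)]) (use j in simp)
  then have "v \<in> char_bundle A V (k - 1) q"
    unfolding char_bundle_def cauchy_bundle_iff using X(1-3) by blast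
  then have "blinfun_apply (differential A x q) v = 0"
    using fix_x q unfolding first_integral_def annihilator_def by blast
  then show ?thesis using differential_apply[OF x_smooth q] by simp
qed

lemma char_int_subset_H:
  assumes j: "1 \<le> j" "j < k" and q: "q \<in> U"
  shows "char_bundle_int A V j q \<subseteq> H (j - 1) q"
  unfolding H_def char_bundle_int_def using x_first_integral_char[OF j(2) _ q] by blast

text \<open>Where \<open>X x\<close> and \<open>Y x\<close> vanish identically, \<open>[X, Y] x = X (Y x) - Y (X x) = 0\<close>.\<close>

lemma x_vanishes_on_flag:
  assumes O: "open W" "W \<subseteq> U" and V: "\<And>q v. q \<in> W \<Longrightarrow> v \<in> V q \<Longrightarrow> dirder A x q v = 0"
    and "q \<in> W" "v \<in> F a q"
  shows "dirder A x q v = 0"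
  using assms(4,5)
proof (induction a arbitrary: q v)
  case 0 then show ?case using V by simp
next
  case (Suc a)
  have q: "q \<in> U" using Suc.prems(1) O(2) by blast
  have sub: "subspace {v. dirder A x q v = 0}"
    using x_linear[OF q] by (auto simp: subspace_def linear_0 linear_add linear_scale)
  have "F a q \<union> brackets A (F a) q \<subseteq> {v. dirder A x q v = 0}"
  proof
    fix w assume "w \<in> F a q \<union> brackets A (F a) q"
    then consider "w \<in> F a q" | X Y W' where "w = lie_bracket A X Y q" "open W'" "q \<in> W'"
        "smooth_section A (F a) W' X" "smooth_section A (F a) W' Y"
      unfolding brackets_def by auto
    then show "w \<in> {v. dirder A x q v = 0}"
    proof cases
      case 1 then show ?thesis using Suc.IH Suc.prems(1) by blast
    next
      case 2
      let ?W = "W' \<inter> W"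
      have W: "open ?W" "q \<in> ?W" "?W \<subseteq> W'" "?W \<subseteq> W" "?W \<subseteq> U" using 2 O Suc.prems(1) by auto
      note XY = smooth_section_subset[OF 2(4) W(3)] smooth_section_subset[OF 2(5) W(3)]
      have XYf: "smooth_field A ?W X" "smooth_field A ?W Y" using XY unfolding smooth_section_def by auto
      have xW: "smooth_fun A ?W x" by (rule smooth_fun_subset[OF x_smooth W(5)])
      have z: "lie_derivative A Z x p = 0" if "smooth_section A (F a) ?W Z" "p \<in> ?W" for Z p
        using Suc.IH that W(4) unfolding smooth_section_def lie_derivative_def by blast
      have "lie_derivative A Y' (lie_derivative A Z x) q = 0" if "smooth_section A (F a) ?W Z" for Y' Z
      proof -
        have "lie_derivative A Y' (lie_derivative A Z x) q = lie_derivative A Y' (\<lambda>_. 0) q"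
          by (rule lie_derivative_cong[OF W(1,2) smooth_fun_const[OF W(1)]]) (simp add: z[OF that])
        then show ?thesis by (simp add: lie_derivative_def dirder_const)
      qed
      then show ?thesis using dirder_lie_bracket[OF W(1,2) XYf xW] XY 2(1) by simp
    qed
  qed
  then show ?case using span_minimal[OF _ sub] Suc.prems(2) unfolding F_Suc by blast
qed

lemma unit_section_exists:
  assumes O: "open W" "W \<subseteq> U" "W \<noteq> {}" and dx: "\<And>q. q \<in> U \<Longrightarrow> differential A x q \<noteq> 0"
  obtains W' Z where "open W'" "W' \<noteq> {}" "W' \<subseteq> W" "unit_section A V x W' Z"
proof -
  have "\<exists>q\<in>W. \<exists>v\<in>V q. dirder A x q v \<noteq> 0"
  proof (rule ccontr)
    assume *: "\<not> ?thesis"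
    obtain q where q: "q \<in> W" using O(3) by blast
    then have qU: "q \<in> U" using O(2) by blast
    have "dirder A x q v = 0" for v
      by (rule x_vanishes_on_flag[OF O(1,2) _ q, of v k]) (use * in \<open>auto simp: F_top\<close>)
    then have "differential A x q = 0"
      by (intro blinfun_eqI) (simp add: differential_apply[OF x_smooth qU])
    then show False using dx[OF qU] by blast
  qed
  then obtain q v where q: "q \<in> W" "v \<in> V q" "dirder A x q v \<noteq> 0" by blast
  have Vsub: "subbundle A V" using F_subbundle[of 0] by simp
  obtain W0 X where X: "open W0" "q \<in> W0" "smooth_section A V W0 X" "X q = v"
    by (rule section_through[OF Vsub q(2)])
  let ?W1 = "W0 \<inter> W"
  have W1: "open ?W1" "?W1 \<subseteq> W" "?W1 \<subseteq> W0" using X(1) O by auto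
  have Xf: "smooth_field A ?W1 X" using X(3) smooth_field_subset unfolding smooth_section_def by blast
  have xW1: "smooth_fun A ?W1 x" by (rule smooth_fun_subset[OF x_smooth]) (use O(2) in blast)
  let ?g = "lie_derivative A X x"
  have g: "smooth_fun A ?W1 ?g" by (rule lie_derivative_smooth[OF W1(1) Xf xW1])
  let ?W2 = "?W1 \<inter> ?g -` (- {0})"
  have W2: "open ?W2" by (rule continuous_open_preimage[OF smooth_fun_continuous[OF W1(1) g] W1(1)]) (simp add: open_Compl)
  have W21: "?W2 \<subseteq> ?W1" by blast
  define Z where "Z p = inverse (?g p) *\<^sub>R X p" for p
  have Zf: "smooth_field A ?W2 Z"
    unfolding Z_def
    by (intro smooth_field_scaleR smooth_fun_inverse W2 smooth_fun_subset[OF g W21] smooth_field_subset[OF Xf W21]) auto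
  have "unit_section A V x ?W2 Z"
    unfolding unit_section_def smooth_section_def
  proof (intro conjI Zf ballI)
    fix p assume p: "p \<in> ?W2"
    have "X p \<in> V p" using X(3) p unfolding smooth_section_def by blast
    then show "Z p \<in> V p" unfolding Z_def by (rule subspace_scale[OF subbundle_subspace[OF Vsub]])
    have "p \<in> U" using p O(2) by blast
    then show "lie_derivative A Z x p = 1"
      using p linear_scale[OF x_linear] by (simp add: lie_derivative_def Z_def)
  qed
  moreover have "q \<in> ?W2" using X q by (simp add: lie_derivative_def)
  ultimately show ?thesis using that[OF W2, of Z] by blast
qed

text \<open>Every nonempty open subset of \<open>U\<close> contains the domain of a unit section, so a maximal disjoint family
  of such domains, which exists by Zorn's lemma, has dense union. The sections combine without any
  matching because the domains are disjoint.\<close>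

lemma dense_unit_section:
  assumes dx: "\<And>q. q \<in> U \<Longrightarrow> differential A x q \<noteq> 0"
  obtains U' Z where "open U'" "U' \<subseteq> U" "U \<subseteq> closure U'" "unit_section A V x U' Z"
proof -
  \<comment> \<open>the members of the disjoint families to which Zorn's lemma is applied\<close>
  define good where "good W \<longleftrightarrow> open W \<and> W \<noteq> {} \<and> W \<subseteq> U \<and> (\<exists>Z. unit_section A V x W Z)" for W
  define \<F> where "\<F> = {\<D>. (\<forall>W\<in>\<D>. good W) \<and> (\<forall>W\<in>\<D>. \<forall>W'\<in>\<D>. W \<noteq> W' \<longrightarrow> W \<inter> W' = {})}"
  have "\<exists>\<D>\<in>\<F>. \<forall>\<E>\<in>\<F>. \<D> \<subseteq> \<E> \<longrightarrow> \<E> = \<D>"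
  proof (rule subset_Zorn_nonempty)
    show "\<F> \<noteq> {}" unfolding \<F>_def by blast
    fix \<C> assume C: "\<C> \<noteq> {}" "subset.chain \<F> \<C>"
    show "\<Union>\<C> \<in> \<F>"
      unfolding \<F>_def
    proof (intro CollectI conjI ballI impI)
      show "good W" if "W \<in> \<Union>\<C>" for W using that C(2) unfolding subset.chain_def \<F>_def by blast
      fix W W' assume W: "W \<in> \<Union>\<C>" "W' \<in> \<Union>\<C>" "W \<noteq> W'"
      then obtain \<D> \<D>' where D: "\<D> \<in> \<C>" "\<D>' \<in> \<C>" "W \<in> \<D>" "W' \<in> \<D>'" by blast
      then have "\<D> \<subseteq> \<D>' \<or> \<D>' \<subseteq> \<D>" using C(2) unfolding subset.chain_def by blast
      then obtain \<D>'' where "\<D>'' \<in> \<C>" "W \<in> \<D>''" "W' \<in> \<D>''" using D by blast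
      moreover have "\<C> \<subseteq> \<F>" using C(2) unfolding subset.chain_def by blast
      ultimately show "W \<inter> W' = {}" using W(3) unfolding \<F>_def by blast
    qed
  qed
  then obtain \<D> where D: "\<D> \<in> \<F>" and max: "\<And>\<E>. \<E> \<in> \<F> \<Longrightarrow> \<D> \<subseteq> \<E> \<Longrightarrow> \<E> = \<D>" by blast
  have good: "good W" if "W \<in> \<D>" for W using D that unfolding \<F>_def by blast
  have disj: "W = W'" if "W \<in> \<D>" "W' \<in> \<D>" "p \<in> W" "p \<in> W'" for W W' p
    using D that unfolding \<F>_def by blast
  let ?U = "\<Union>\<D>"
  have opU: "open ?U" using good unfolding good_def by blast
  define ZW where "ZW W = (SOME Z. unit_section A V x W Z)" for W
  have ZW: "unit_section A V x W (ZW W)" if "W \<in> \<D>" for W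
    using good[OF that] unfolding good_def ZW_def by (metis someI_ex)
  define Z where "Z p = ZW (THE W. W \<in> \<D> \<and> p \<in> W) p" for p
  have ZZW: "Z p = ZW W p" if "W \<in> \<D>" "p \<in> W" for W p
  proof -
    have "(THE W. W \<in> \<D> \<and> p \<in> W) = W" using that disj by (intro the_equality) auto
    then show ?thesis by (simp add: Z_def)
  qed
  have "smooth_field A ?U Z"
  proof (rule smooth_field_local[OF opU])
    fix p assume "p \<in> ?U"
    then obtain W where W: "W \<in> \<D>" "p \<in> W" by blast
    have "smooth_field A W Z"
      by (rule smooth_field_cong[of W "ZW W"])
         (use W good ZW ZZW in \<open>auto simp: good_def unit_section_def smooth_section_def\<close>)
    then show "\<exists>W. open W \<and> p \<in> W \<and> smooth_field A W Z" using W good unfolding good_def by blast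
  qed
  moreover have "Z p \<in> V p \<and> lie_derivative A Z x p = 1" if p: "p \<in> ?U" for p
  proof -
    obtain W where W: "W \<in> \<D>" "p \<in> W" using p by blast
    then have "ZW W p \<in> V p" "lie_derivative A (ZW W) x p = 1"
      using ZW unfolding unit_section_def smooth_section_def by blast+
    then show ?thesis using ZZW[OF W] by (simp add: lie_derivative_def)
  qed
  ultimately have unit: "unit_section A V x ?U Z" unfolding unit_section_def smooth_section_def by blast
  have "U \<subseteq> closure ?U"
  proof
    fix p assume p: "p \<in> U"
    show "p \<in> closure ?U"
    proof (rule ccontr)
      assume np: "p \<notin> closure ?U"
      let ?O = "U - closure ?U"
      have O: "open ?O" "?O \<subseteq> U" using U by auto
      have O': "?O \<noteq> {}" using p np by blast
      obtain W Z where W: "open W" "W \<noteq> {}" "W \<subseteq> ?O" "unit_section A V x W Z"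
        by (rule unit_section_exists[OF O O' dx], assumption, rule that)
      have WU: "W \<inter> ?U = {}" using W(3) closure_subset by blast
      have "good W" unfolding good_def using W by blast
      then have "insert W \<D> \<in> \<F>" using D WU unfolding \<F>_def by blast
      then have "insert W \<D> = \<D>" by (rule max) blast
      then have "W \<in> \<D>" by blast
      then show False using WU W(2) by blast
    qed
  qed
  moreover have "?U \<subseteq> U" using good unfolding good_def by blast
  ultimately show ?thesis using unit by (intro that[OF opU])
qed

end

section \<open>The kernel of dx along a unit section\<close>

locale goursat_section = goursat_integral A V \<tau> k x U
  for A :: "('m::{t2_space,second_countable_topology}, 'a::euclidean_space) chart set" and V \<tau> k x U +
  fixes W :: "'m set" and Z :: "'m \<Rightarrow> 'a"
  assumes W: "open W" "W \<subseteq> U" and Z: "unit_section A V x W Z"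
begin

lemma x_smooth_W: "smooth_fun A W x"
  by (rule smooth_fun_subset[OF x_smooth W(2)])

lemma Z_smooth: "smooth_field A W Z"
  using Z unfolding unit_section_def smooth_section_def by blast

lemma Z_in_F: "q \<in> W \<Longrightarrow> Z q \<in> F a q"
  using Z F_mono[of 0 a] unfolding unit_section_def smooth_section_def by auto

lemma Z_x: "q \<in> W \<Longrightarrow> dirder A x q (Z q) = 1"
  using Z unfolding unit_section_def lie_derivative_def by blast

lemma Z_section: "smooth_section A (F a) W Z"
  unfolding smooth_section_def using Z_smooth Z_in_F by blast

lemma x_linear_W: "q \<in> W \<Longrightarrow> linear (dirder A x q)"
  using x_linear W(2) by blast

lemma F_decompose:
  assumes "q \<in> W" "v \<in> F a q"
  shows "v - dirder A x q v *\<^sub>R Z q \<in> H a q"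
  unfolding H_def using assms Z_x[OF assms(1)] x_linear_W[OF assms(1)]
  by (auto simp: linear_diff linear_scale intro!: subspace_diff[OF F_subspace] subspace_scale[OF F_subspace] Z_in_F)

lemma H_dim:
  assumes "a \<le> k" "q \<in> W"
  shows "dim (H a q) + card (pp_level \<tau> a) = DIM('a)"
proof -
  have sub: "subspace (H a q)" using H_subspace W(2) assms(2) by blast
  have "Z q \<notin> span (H a q)"
    using Z_x[OF assms(2)] sub by (simp add: span_eq_iff[THEN iffD2] H_def)
  then have "dim (insert (Z q) (H a q)) = Suc (dim (H a q))" by (simp add: dim_insert)
  moreover have "span (insert (Z q) (H a q)) = F a q"
  proof
    show "span (insert (Z q) (H a q)) \<subseteq> F a q"
      using Z_in_F[OF assms(2)] by (intro span_minimal F_subspace) (auto simp: H_def)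
    show "F a q \<subseteq> span (insert (Z q) (H a q))"
    proof
      fix v assume "v \<in> F a q"
      then have "v - dirder A x q v *\<^sub>R Z q \<in> span (insert (Z q) (H a q))"
        using F_decompose[OF assms(2)] by (intro span_base) blast
      moreover have "dirder A x q v *\<^sub>R Z q \<in> span (insert (Z q) (H a q))"
        by (intro span_scale span_base) simp
      ultimately have "v - dirder A x q v *\<^sub>R Z q + dirder A x q v *\<^sub>R Z q \<in> span (insert (Z q) (H a q))"
        by (rule span_add)
      then show "v \<in> span (insert (Z q) (H a q))" by simp
    qed
  qed
  then have "dim (insert (Z q) (H a q)) = dim (F a q)" by (metis dim_span)
  ultimately show ?thesis using F_dim[OF assms(1), of q] by simp
qed

text \<open>Where \<open>V\<close> is transversal to the level sets of \<open>x\<close>, the inclusion of \<open>Char V\<^sup>(\<^sup>j\<^sup>)\<^sub>j\<^sub>-\<^sub>1\<close> into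
  the kernel of \<open>dx\<close> on \<open>V\<^sup>(\<^sup>j\<^sup>-\<^sup>1\<^sup>)\<close> is an equality, by dimension.\<close>

lemma char_int_eq_H:
  assumes "1 \<le> j" "j < k" "q \<in> W"
  shows "char_bundle_int A V j q = H (j - 1) q"
proof (rule subspace_dim_equal)
  have q: "q \<in> U" using assms(3) W(2) by blast
  show "subspace (char_bundle_int A V j q)" by (rule subbundle_subspace[OF char_int_subbundle[OF assms(1,2)]])
  show "subspace (H (j - 1) q)" by (rule H_subspace[OF q])
  show "char_bundle_int A V j q \<subseteq> H (j - 1) q" by (rule char_int_subset_H[OF assms(1,2) q])
  show "dim (H (j - 1) q) \<le> dim (char_bundle_int A V j q)"
  proof -
    have "j - 1 \<le> k" using assms by simp
    from H_dim[OF this assms(3)] show ?thesis using char_int_dim[OF assms(1,2), of q] by linarith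
  qed
qed

definition H_section :: "nat \<Rightarrow> 'm set \<Rightarrow> ('m \<Rightarrow> 'a) \<Rightarrow> bool" where
  "H_section a S X \<longleftrightarrow> open S \<and> S \<subseteq> W \<and> smooth_section A (H a) S X"

lemma H_sectionD:
  assumes "H_section a S X"
  shows "open S" "S \<subseteq> W" "smooth_field A S X" "smooth_section A (F a) S X"
    "\<And>q. q \<in> S \<Longrightarrow> X q \<in> H a q" "\<And>q. q \<in> S \<Longrightarrow> lie_derivative A X x q = 0"
  using assms unfolding H_section_def smooth_section_def H_def lie_derivative_def by auto

lemma H_projection:
  assumes "open S" "S \<subseteq> W" "smooth_section A (F a) S X"
  shows "H_section a S (\<lambda>q. X q - lie_derivative A X x q *\<^sub>R Z q)"
proof -
  have X: "smooth_field A S X" using assms(3) unfolding smooth_section_def by blast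
  have "smooth_field A S (\<lambda>q. X q - lie_derivative A X x q *\<^sub>R Z q)"
    by (intro smooth_field_diff smooth_field_scaleR lie_derivative_smooth assms X
        smooth_fun_subset[OF x_smooth_W] smooth_field_subset[OF Z_smooth])
  then show ?thesis
    unfolding H_section_def smooth_section_def
    using assms F_decompose unfolding smooth_section_def lie_derivative_def by blast
qed

lemma H_section_through:
  assumes "q \<in> W" "v \<in> H a q"
  obtains S X where "q \<in> S" "H_section a S X" "X q = v"
proof -
  have v: "v \<in> F a q" "dirder A x q v = 0" using assms(2) unfolding H_def by auto
  obtain S Y where Y: "open S" "q \<in> S" "smooth_section A (F a) S Y" "Y q = v"
    by (rule section_through[OF F_subbundle v(1)])
  have "H_section a (S \<inter> W) (\<lambda>p. Y p - lie_derivative A Y x p *\<^sub>R Z p)"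
    by (rule H_projection[OF _ _ smooth_section_subset[OF Y(3)]]) (use Y W in auto)
  moreover have "Y q - lie_derivative A Y x q *\<^sub>R Z q = v" using Y(4) v(2) by (simp add: lie_derivative_def)
  moreover have "q \<in> S \<inter> W" using Y(2) assms(1) by blast
  ultimately show ?thesis
    using that[of "S \<inter> W" "\<lambda>p. Y p - lie_derivative A Y x p *\<^sub>R Z p"] by blast
qed

lemma lie_derivative_locally_constant:
  assumes "open S" "q \<in> S" "\<And>p. p \<in> S \<Longrightarrow> g p = (c::real)"
  shows "lie_derivative A X g q = 0"
proof -
  have "lie_derivative A X g q = lie_derivative A X (\<lambda>_. c) q"
    by (rule lie_derivative_cong[OF assms(1,2) smooth_fun_const[OF assms(1)]]) (simp add: assms(3))
  then show ?thesis by (simp add: lie_derivative_def dirder_const)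
qed

text \<open>\<open>[X, Z] x = X (1) - Z (0) = 0\<close>.\<close>

lemma bracket_Z:
  assumes X: "H_section a S X" and q: "q \<in> S"
  shows "lie_bracket A X Z q \<in> H (Suc a) q"
proof -
  note X' = H_sectionD[OF X]
  have "lie_bracket A X Z q \<in> F (Suc a) q"
    by (rule F_bracket[OF X'(1) q X'(4) smooth_section_subset[OF Z_section X'(2)]])
  moreover have "dirder A x q (lie_bracket A X Z q) = 0"
  proof -
    have "dirder A x q (lie_bracket A X Z q) = lie_derivative A X (lie_derivative A Z x) q - lie_derivative A Z (lie_derivative A X x) q"
      by (rule dirder_lie_bracket[OF X'(1) q X'(3) smooth_field_subset[OF Z_smooth X'(2)] smooth_fun_subset[OF x_smooth_W X'(2)]])
    also have "lie_derivative A X (lie_derivative A Z x) q = 0"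
      by (rule lie_derivative_locally_constant[OF X'(1) q, of _ 1]) (use X'(2) Z_x in \<open>auto simp: lie_derivative_def\<close>)
    also have "lie_derivative A Z (lie_derivative A X x) q = 0"
      by (rule lie_derivative_locally_constant[OF X'(1) q X'(6)])
    finally show ?thesis by simp
  qed
  ultimately show ?thesis unfolding H_def by blast
qed

lemma H_integrable:
  assumes a: "Suc a < k" and X: "H_section a S X" and Y: "H_section a S Y" and q: "q \<in> S"
  shows "lie_bracket A X Y q \<in> H a q"
proof -
  have eq: "char_bundle_int A V (Suc a) p = H a p" if "p \<in> W" for p
    using char_int_eq_H[of "Suc a" p] a that by simp
  have "smooth_section A (char_bundle_int A V (Suc a)) S X'" if "H_section a S X'" for X'
    using H_sectionD[OF that] eq unfolding smooth_section_def by auto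
  then have "lie_bracket A X Y q \<in> char_bundle_int A V (Suc a) q"
    using char_int_integrable[of "Suc a"] a X Y q H_sectionD(1)[OF X] unfolding integrable_bundle_def by simp
  then show ?thesis using eq[of q] q H_sectionD(2)[OF X] by auto
qed

text \<open>At \<open>q\<close> one has \<open>[(x - x(q)) X, Z] = - (Z x) X = - X\<close>.\<close>

lemma H_in_bracket_with:
  assumes P: "\<And>p. p \<in> W \<Longrightarrow> H a p \<subseteq> P p" and q: "q \<in> W" and v: "v \<in> H a q"
  shows "v \<in> bracket_with A Z P q"
proof -
  obtain S X where X: "q \<in> S" "H_section a S X" "X q = v" by (rule H_section_through[OF q v])
  note X' = H_sectionD[OF X(2)]
  \<comment> \<open>a function that vanishes at \<open>q\<close> and has derivative \<open>1\<close> along \<open>Z\<close>\<close>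
  define g where "g p = x p - x q" for p
  have g: "smooth_fun A S g"
    unfolding g_def by (intro smooth_fun_diff smooth_fun_const X' smooth_fun_subset[OF x_smooth_W])
  have gX: "smooth_section A P S (\<lambda>p. g p *\<^sub>R X p)"
    unfolding smooth_section_def
  proof (intro conjI ballI)
    show "smooth_field A S (\<lambda>p. g p *\<^sub>R X p)" by (intro smooth_field_scaleR X' g)
    fix p assume p: "p \<in> S"
    then have pW: "p \<in> W" using X'(2) by blast
    then have "g p *\<^sub>R X p \<in> H a p"
      using X'(5)[OF p] H_subspace[of p a] W(2) by (intro subspace_scale) auto
    then show "g p *\<^sub>R X p \<in> P p" using P[OF pW] by blast
  qed
  have "lie_bracket A (\<lambda>p. g p *\<^sub>R X p) Z q = g q *\<^sub>R lie_bracket A X Z q - lie_derivative A Z g q *\<^sub>R X q"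
    by (rule lie_bracket_scale_left[OF X'(1) X(1) X'(3) smooth_field_subset[OF Z_smooth X'(2)] g])
  moreover have "lie_derivative A Z g q = 1"
  proof -
    have "dirder A g q (Z q) = dirder A x q (Z q) - dirder A (\<lambda>_. x q) q (Z q)"
      unfolding g_def by (rule dirder_diff[OF x_smooth_W smooth_fun_const[OF W(1)] q])
    then show ?thesis using Z_x[OF q] by (simp add: dirder_const lie_derivative_def)
  qed
  ultimately have "lie_bracket A (\<lambda>p. g p *\<^sub>R X p) Z q = - v" using X(3) by (simp add: g_def)
  moreover have "lie_bracket A (\<lambda>p. g p *\<^sub>R X p) Z q \<in> bracket_with A Z P q"
    unfolding bracket_with_def using gX X(1) X'(1) by (intro span_base) blast
  ultimately show ?thesis unfolding bracket_with_def using span_neg[of "- v"] by simp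
qed

text \<open>Sections of \<open>V\<^sup>(\<^sup>a\<^sup>)\<close> are written as \<open>X\<^sub>1 + s Z\<close> and \<open>Y\<^sub>1 + t Z\<close> with \<open>X\<^sub>1\<close>, \<open>Y\<^sub>1\<close> in \<open>H\<^sub>a\<close>. Modulo \<open>Z\<close>
  their bracket is \<open>[X\<^sub>1, Y\<^sub>1] + t [X\<^sub>1, Z] - s [Y\<^sub>1, Z]\<close>, whose first term lies in \<open>H\<^sub>a\<close> by
  integrability.\<close>

lemma H_Suc_in_bracket_with:
  assumes a: "Suc a < k" and P: "\<And>p. p \<in> W \<Longrightarrow> H a p \<subseteq> P p" and q: "q \<in> W"
  shows "H (Suc a) q \<subseteq> bracket_with A Z P q"
proof -
  let ?B = "bracket_with A Z P q"
  have subB: "subspace ?B" unfolding bracket_with_def by simp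
  have lin: "linear (dirder A x q)" by (rule x_linear_W[OF q])
  have br: "lie_bracket A X Z q \<in> ?B" if "H_section a S X" "q \<in> S" for S X
  proof -
    have "smooth_section A P S X" using H_sectionD[OF that(1)] P unfolding smooth_section_def by blast
    then show ?thesis unfolding bracket_with_def using that(2) H_sectionD(1)[OF that(1)] by (intro span_base) blast
  qed
  \<comment> \<open>the vectors whose projection along \<open>Z\<close> lies in the bundle of brackets\<close>
  let ?Q = "{w. w - dirder A x q w *\<^sub>R Z q \<in> ?B}"
  have subQ: "subspace ?Q"
  proof (rule subspaceI)
    show "0 \<in> ?Q" using lin subB by (simp add: linear_0 subspace_0)
    show "u + w \<in> ?Q" if "u \<in> ?Q" "w \<in> ?Q" for u w
    proof -
      have "(u - dirder A x q u *\<^sub>R Z q) + (w - dirder A x q w *\<^sub>R Z q) \<in> ?B"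
        using that subB by (intro subspace_add) auto
      then show ?thesis using lin by (simp add: linear_add scaleR_add_left algebra_simps)
    qed
    show "c *\<^sub>R u \<in> ?Q" if "u \<in> ?Q" for c u
    proof -
      have "c *\<^sub>R (u - dirder A x q u *\<^sub>R Z q) \<in> ?B" using that subB by (intro subspace_scale) auto
      then show ?thesis using lin by (simp add: linear_scale scaleR_diff_right)
    qed
  qed
  have "F a q \<union> brackets A (F a) q \<subseteq> ?Q"
  proof
    fix w assume "w \<in> F a q \<union> brackets A (F a) q"
    then consider "w \<in> F a q" | X Y S where "w = lie_bracket A X Y q" "open S" "q \<in> S"
        "smooth_section A (F a) S X" "smooth_section A (F a) S Y"
      unfolding brackets_def by auto
    then show "w \<in> ?Q"
    proof cases
      case 1
      have "w - dirder A x q w *\<^sub>R Z q \<in> ?B"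
        by (rule H_in_bracket_with[OF _ q F_decompose[OF q 1]]) (rule P)
      then show ?thesis by blast
    next
      case 2
      define S' where "S' = S \<inter> W"
      have S': "open S'" "q \<in> S'" "S' \<subseteq> W" "S' \<subseteq> S" using 2 W q by (auto simp: S'_def)
      note X = smooth_section_subset[OF 2(4) S'(4)] and Y = smooth_section_subset[OF 2(5) S'(4)]
      let ?s = "lie_derivative A X x" and ?t = "lie_derivative A Y x"
      define X1 where "X1 p = X p - ?s p *\<^sub>R Z p" for p
      define Y1 where "Y1 p = Y p - ?t p *\<^sub>R Z p" for p
      have X1: "H_section a S' X1" and Y1: "H_section a S' Y1"
        unfolding X1_def Y1_def by (rule H_projection[OF S'(1,3) X], rule H_projection[OF S'(1,3) Y])
      note X1' = H_sectionD[OF X1] and Y1' = H_sectionD[OF Y1]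
      have Xf: "smooth_field A S' X" "smooth_field A S' Y" using X Y unfolding smooth_section_def by auto
      have xS: "smooth_fun A S' x" by (rule smooth_fun_subset[OF x_smooth_W S'(3)])
      have s: "smooth_fun A S' ?s" "smooth_fun A S' ?t" by (intro lie_derivative_smooth S' Xf xS)+
      have Zf: "smooth_field A S' Z" by (rule smooth_field_subset[OF Z_smooth S'(3)])
      note sZ = smooth_field_scaleR[OF S'(1) s(1) Zf] and tZ = smooth_field_scaleR[OF S'(1) s(2) Zf]
      have ZZ: "lie_bracket A Z Z q = 0" by (simp add: lie_bracket_def Let_def)
      have "w = lie_bracket A (\<lambda>p. X1 p + ?s p *\<^sub>R Z p) Y q"
        unfolding 2(1) by (rule lie_bracket_cong[OF S'(1,2) _ Xf(2)])
          (auto simp: X1_def intro!: Xf)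
      also have "\<dots> = lie_bracket A X1 Y q + lie_bracket A (\<lambda>p. ?s p *\<^sub>R Z p) Y q"
        by (rule lie_bracket_add_left[OF S'(1,2) X1'(3) sZ Xf(2)])
      also have "lie_bracket A X1 Y q = lie_bracket A X1 (\<lambda>p. Y1 p + ?t p *\<^sub>R Z p) q"
        by (rule lie_bracket_cong[OF S'(1,2) X1'(3)])
          (auto simp: Y1_def intro!: Xf)
      also have "\<dots> = lie_bracket A X1 Y1 q + lie_bracket A X1 (\<lambda>p. ?t p *\<^sub>R Z p) q"
        by (rule lie_bracket_add_right[OF S'(1,2) X1'(3) Y1'(3) tZ])
      also have "lie_bracket A X1 (\<lambda>p. ?t p *\<^sub>R Z p) q = lie_derivative A X1 ?t q *\<^sub>R Z q + ?t q *\<^sub>R lie_bracket A X1 Z q"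
        by (rule lie_bracket_scale_right[OF S'(1,2) X1'(3) Zf s(2)])
      also have "lie_bracket A (\<lambda>p. ?s p *\<^sub>R Z p) Y q = ?s q *\<^sub>R lie_bracket A Z Y q - lie_derivative A Y ?s q *\<^sub>R Z q"
        by (rule lie_bracket_scale_left[OF S'(1,2) Zf Xf(2) s(1)])
      also have "lie_bracket A Z Y q = lie_bracket A Z (\<lambda>p. Y1 p + ?t p *\<^sub>R Z p) q"
        by (rule lie_bracket_cong[OF S'(1,2) Zf])
          (auto simp: Y1_def intro!: Xf)
      also have "\<dots> = lie_bracket A Z Y1 q + lie_bracket A Z (\<lambda>p. ?t p *\<^sub>R Z p) q"
        by (rule lie_bracket_add_right[OF S'(1,2) Zf Y1'(3) tZ])
      also have "lie_bracket A Z (\<lambda>p. ?t p *\<^sub>R Z p) q = lie_derivative A Z ?t q *\<^sub>R Z q + ?t q *\<^sub>R lie_bracket A Z Z q"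
        by (rule lie_bracket_scale_right[OF S'(1,2) Zf Zf s(2)])
      finally have w0: "w = lie_bracket A X1 Y1 q + (lie_derivative A X1 ?t q *\<^sub>R Z q + ?t q *\<^sub>R lie_bracket A X1 Z q)
          + (?s q *\<^sub>R (lie_bracket A Z Y1 q + (lie_derivative A Z ?t q *\<^sub>R Z q + ?t q *\<^sub>R lie_bracket A Z Z q))
             - lie_derivative A Y ?s q *\<^sub>R Z q)" .
      define c where "c = lie_derivative A X1 ?t q + ?s q * lie_derivative A Z ?t q - lie_derivative A Y ?s q"
      have w: "w = lie_bracket A X1 Y1 q + ?t q *\<^sub>R lie_bracket A X1 Z q
          - ?s q *\<^sub>R lie_bracket A Y1 Z q + c *\<^sub>R Z q"
        unfolding w0 ZZ lie_bracket_swap[of Z Y1 q] c_def by (simp add: algebra_simps)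
      let ?h = "lie_bracket A X1 Y1 q + ?t q *\<^sub>R lie_bracket A X1 Z q - ?s q *\<^sub>R lie_bracket A Y1 Z q"
      have "lie_bracket A X1 Y1 q \<in> H a q" by (rule H_integrable[OF a X1 Y1 S'(2)])
      then have h1: "lie_bracket A X1 Y1 q \<in> ?B" "dirder A x q (lie_bracket A X1 Y1 q) = 0"
        using H_in_bracket_with[OF P q] by (auto simp: H_def)
      have h2: "dirder A x q (lie_bracket A X1 Z q) = 0" "dirder A x q (lie_bracket A Y1 Z q) = 0"
        using bracket_Z[OF X1 S'(2)] bracket_Z[OF Y1 S'(2)] by (auto simp: H_def)
      have "dirder A x q w = c"
        unfolding w using lin h1(2) h2 Z_x[OF q] by (simp add: linear_add linear_diff linear_scale)
      then have "w - dirder A x q w *\<^sub>R Z q = ?h" using w by simp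
      moreover have "?h \<in> ?B"
        using h1(1) br[OF X1 S'(2)] br[OF Y1 S'(2)] subB by (intro subspace_add subspace_diff subspace_scale) auto
      ultimately show ?thesis by simp
    qed
  qed
  then have "F (Suc a) q \<subseteq> ?Q" unfolding F_Suc by (rule span_minimal[OF _ subQ])
  then show ?thesis unfolding H_def by auto
qed

lemma H_in_pi_iter:
  assumes "l < k" "q \<in> W"
  shows "H l q \<subseteq> pi_iter A V Z l q"
  using assms
proof (induction l arbitrary: q)
  case 0
  then show ?case using char_int_eq_H[of 1 q] k2 by (simp add: pi_iter_def)
next
  case (Suc l)
  have "H (Suc l) q \<subseteq> bracket_with A Z (pi_iter A V Z l) q"
    by (rule H_Suc_in_bracket_with[OF Suc.prems(1) _ Suc.prems(2)]) (use Suc in auto)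
  then show ?case by (simp add: pi_iter_def)
qed

text \<open>For a section \<open>X\<close> of \<open>H\<^sub>a\<close>, \<open>X (Z f) = [X, Z] f + Z (X f)\<close>, and \<open>[X, Z]\<close> is a section of
  \<open>H\<^sub>a\<^sub>+\<^sub>1\<close>.\<close>

lemma first_integral_descends:
  assumes f: "smooth_fun A W f" and vanish: "\<And>q v. q \<in> W \<Longrightarrow> v \<in> H (Suc a) q \<Longrightarrow> dirder A f q v = 0"
    and q: "q \<in> W" and v: "v \<in> H a q"
  shows "dirder A (lie_derivative A Z f) q v = 0"
proof -
  obtain S X where X: "q \<in> S" "H_section a S X" "X q = v" by (rule H_section_through[OF q v])
  note X' = H_sectionD[OF X(2)]
  have "dirder A f q (lie_bracket A X Z q) = lie_derivative A X (lie_derivative A Z f) q - lie_derivative A Z (lie_derivative A X f) q"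
    by (rule dirder_lie_bracket[OF X'(1) X(1) X'(3) smooth_field_subset[OF Z_smooth X'(2)] smooth_fun_subset[OF f X'(2)]])
  moreover have "dirder A f q (lie_bracket A X Z q) = 0"
    by (rule vanish[OF q bracket_Z[OF X(2,1)]])
  moreover have "lie_derivative A Z (lie_derivative A X f) q = 0"
  proof (rule lie_derivative_locally_constant[OF X'(1) X(1)])
    fix p assume "p \<in> S"
    then show "lie_derivative A X f p = 0"
      unfolding lie_derivative_def using X'(2,5) H_mono[of a "Suc a" p] by (intro vanish) auto
  qed
  ultimately show ?thesis using X(3) by (simp add: lie_derivative_def)
qed

end

section \<open>Independence of the prolonged functions\<close>

text \<open>Level \<open>a - 1\<close> adds to level \<open>a\<close> one further derivative of each family present, and the functions
  of order \<open>a\<close>.\<close>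

lemma pp_level_decompose:
  assumes "1 \<le> a" "a \<le> length \<tau>"
  shows "pp_level \<tau> (a - 1) = pp_level \<tau> a \<union> suc_coord ` (pp_level \<tau> a - pp_level \<tau> (Suc a)) \<union>
    (\<lambda>l. CZ l a 0) ` {1..rho \<tau> a}"
proof (intro equalityI subsetI)
  fix i assume i: "i \<in> pp_level \<tau> (a - 1)"
  show "i \<in> pp_level \<tau> a \<union> suc_coord ` (pp_level \<tau> a - pp_level \<tau> (Suc a)) \<union> (\<lambda>l. CZ l a 0) ` {1..rho \<tau> a}"
  proof (cases i)
    case CX then show ?thesis by simp
  next
    case (CZ l j s)
    then have *: "1 \<le> j" "j \<le> length \<tau>" "1 \<le> l" "l \<le> rho \<tau> j" "s + a \<le> j"
      using i assms by (auto simp: CZ_in_pp_level)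
    show ?thesis
    proof (cases "s + a < j")
      case True then show ?thesis using * CZ by (simp add: CZ_in_pp_level)
    next
      case False
      then have j: "j = s + a" using * by simp
      show ?thesis
      proof (cases s)
        case 0 then show ?thesis using * CZ j by auto
      next
        case (Suc t)
        then have "CZ l j t \<in> pp_level \<tau> a - pp_level \<tau> (Suc a)" using * j by (simp add: CZ_in_pp_level)
        moreover have "i = suc_coord (CZ l j t)" using CZ Suc by simp
        ultimately show ?thesis by blast
      qed
    qed
  qed
next
  fix i assume "i \<in> pp_level \<tau> a \<union> suc_coord ` (pp_level \<tau> a - pp_level \<tau> (Suc a)) \<union> (\<lambda>l. CZ l a 0) ` {1..rho \<tau> a}"
  then consider "i \<in> pp_level \<tau> a" | t where "t \<in> pp_level \<tau> a" "i = suc_coord t" | l where "l \<in> {1..rho \<tau> a}" "i = CZ l a 0"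
    by blast
  then show "i \<in> pp_level \<tau> (a - 1)"
  proof cases
    case 1 then show ?thesis using pp_level_antimono[of "a - 1" a \<tau>] by auto
  next
    case 2
    then show ?thesis using suc_coord_level(1)[of t \<tau> "a - 1"] assms by simp
  next
    case 3
    then show ?thesis using assms by (simp add: CZ_in_pp_level)
  qed
qed

lemma pp_coords_decompose:
  "pp_coords \<tau> = pp_level \<tau> 0 \<union> suc_coord ` (pp_level \<tau> 0 - pp_level \<tau> (Suc 0))"
proof (intro equalityI subsetI)
  fix i assume i: "i \<in> pp_coords \<tau>"
  show "i \<in> pp_level \<tau> 0 \<union> suc_coord ` (pp_level \<tau> 0 - pp_level \<tau> (Suc 0))"
  proof (cases i)
    case CX then show ?thesis by simp
  next
    case (CZ l j s)
    then have *: "1 \<le> j" "j \<le> length \<tau>" "1 \<le> l" "l \<le> rho \<tau> j" "s \<le> j"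
      using i by (auto simp: CZ_in_pp_coords)
    show ?thesis
    proof (cases "s < j")
      case True then show ?thesis using * CZ by (simp add: CZ_in_pp_level)
    next
      case False
      then obtain t where t: "s = Suc t" "j = Suc t" using * by (cases s) auto
      then have "CZ l j t \<in> pp_level \<tau> 0 - pp_level \<tau> (Suc 0)" using * by (simp add: CZ_in_pp_level)
      moreover have "i = suc_coord (CZ l j t)" using CZ t by simp
      ultimately show ?thesis by blast
    qed
  qed
next
  fix i assume "i \<in> pp_level \<tau> 0 \<union> suc_coord ` (pp_level \<tau> 0 - pp_level \<tau> (Suc 0))"
  then show "i \<in> pp_coords \<tau>" using pp_level_subset_coords[of \<tau> 0] suc_coord_level(2) by blast
qed

text \<open>The hypotheses on the \<open>\<phi>\<^sup>l\<^sup>,\<^sup>j\<close> in the form in which they enter: they are first integrals of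
  \<open>H\<^sub>j\<^sub>-\<^sub>1\<close>, and their differentials are independent modulo \<open>dx\<close> for \<open>j = k\<close> and modulo the annihilator
  of \<open>Char V\<^sup>(\<^sup>j\<^sup>)\<close> for \<open>j < k\<close>.\<close>

locale goursat_functions = goursat_section A V \<tau> k x U W Z
  for A :: "('m::{t2_space,second_countable_topology}, 'a::euclidean_space) chart set" and V \<tau> k x U W Z +
  fixes \<phi> :: "nat \<Rightarrow> nat \<Rightarrow> 'm \<Rightarrow> real"
  assumes \<phi>_smooth: "\<And>l j. \<lbrakk>1 \<le> j; j \<le> k; 1 \<le> l; l \<le> rho \<tau> j\<rbrakk> \<Longrightarrow> smooth_fun A W (\<phi> l j)"
    and \<phi>_first_integral: "\<And>l j q v. \<lbrakk>1 \<le> j; j \<le> k; 1 \<le> l; l \<le> rho \<tau> j; q \<in> W; v \<in> H (j - 1) q\<rbrakk> \<Longrightarrow> dirder A (\<phi> l j) q v = 0"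
    and \<phi>_top: "\<And>q. q \<in> W \<Longrightarrow> wedge_nonzero (differential A x q) (differential A (\<phi> 1 k) q)"
    and \<phi>_fundamental: "\<And>j q c l. \<lbrakk>1 \<le> j; j < k; q \<in> W;
        \<And>v. v \<in> char_bundle A V j q \<Longrightarrow> (\<Sum>l=1..rho \<tau> j. c l * dirder A (\<phi> l j) q v) = 0; l \<in> {1..rho \<tau> j}\<rbrakk> \<Longrightarrow> c l = 0"
begin

abbreviation "f \<equiv> prolonged_functions A Z x \<phi>"

lemma f_CX: "f CX = x"
  by (rule ext) (simp add: prolonged_functions_def)

lemma f_0: "f (CZ l j 0) = \<phi> l j"
  by (rule ext) (simp add: prolonged_functions_def)

lemma f_suc: "i \<noteq> CX \<Longrightarrow> f (suc_coord i) = lie_derivative A Z (f i)"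
  by (rule ext, cases i) (simp_all add: prolonged_functions_def fun_eq_iff)

lemma f_smooth: "i \<in> pp_coords \<tau> \<Longrightarrow> smooth_fun A W (f i)"
proof (cases i)
  case CX then show ?thesis using x_smooth_W by (simp add: f_CX)
next
  case (CZ l j s)
  assume "i \<in> pp_coords \<tau>"
  then have *: "1 \<le> j" "j \<le> k" "1 \<le> l" "l \<le> rho \<tau> j" using CZ by (auto simp: CZ_in_pp_coords length_\<tau>)
  have "smooth_fun A W (f (CZ l j s))" for s
  proof (induction s)
    case 0 then show ?case using \<phi>_smooth[OF *] by (simp add: f_0)
  next
    case (Suc s)
    have "f (CZ l j (Suc s)) = lie_derivative A Z (f (CZ l j s))" using f_suc[of "CZ l j s"] by simp
    then show ?case using lie_derivative_smooth[OF W(1) Z_smooth Suc] by simp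
  qed
  then show ?thesis using CZ by simp
qed

lemma f_linear: "i \<in> pp_coords \<tau> \<Longrightarrow> q \<in> W \<Longrightarrow> linear (dirder A (f i) q)"
  by (rule dirder_linear[OF f_smooth])

text \<open>Each derivative along \<open>Z\<close> lowers by one the index of the bundle that the function is a first
  integral of.\<close>

lemma f_first_integral:
  assumes "i \<in> pp_level \<tau> a" "q \<in> W" "v \<in> H a q"
  shows "dirder A (f i) q v = 0"
proof (cases i)
  case CX then show ?thesis using assms(3) by (simp add: f_CX H_def)
next
  case (CZ l j s)
  then have *: "1 \<le> j" "j \<le> k" "1 \<le> l" "l \<le> rho \<tau> j" "s + a < j"
    using assms(1) by (auto simp: CZ_in_pp_level length_\<tau>)
  have "\<forall>a q v. s + a < j \<longrightarrow> q \<in> W \<longrightarrow> v \<in> H a q \<longrightarrow> dirder A (f (CZ l j s)) q v = 0"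
  proof (induction s)
    case 0
    show ?case
    proof (intro allI impI)
      fix a q v assume "0 + a < j" "q \<in> W" "v \<in> H a q"
      moreover from this have "a \<le> j - 1" by simp
      ultimately show "dirder A (f (CZ l j 0)) q v = 0"
        unfolding f_0 using H_mono[of a "j - 1" q] by (intro \<phi>_first_integral *) blast+
    qed
  next
    case (Suc s)
    show ?case
    proof (intro allI impI)
      fix a q v assume a: "Suc s + a < j" "q \<in> W" "v \<in> H a q"
      have "CZ l j s \<in> pp_coords \<tau>" using * a(1) by (simp add: CZ_in_pp_coords length_\<tau>)
      then have "smooth_fun A W (f (CZ l j s))" by (rule f_smooth)
      moreover have "dirder A (f (CZ l j s)) p w = 0" if "p \<in> W" "w \<in> H (Suc a) p" for p w
        by (rule Suc.IH[rule_format, OF _ that]) (use a(1) in simp)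
      ultimately have "dirder A (lie_derivative A Z (f (CZ l j s))) q v = 0"
        by (rule first_integral_descends[OF _ _ a(2,3)])
      then show "dirder A (f (CZ l j (Suc s))) q v = 0" using f_suc[of "CZ l j s"] by simp
    qed
  qed
  then show ?thesis using * assms(2,3) CZ by blast
qed

lemma f_suc_value:
  "i \<noteq> CX \<Longrightarrow> f (suc_coord i) q = dirder A (f i) q (Z q)"
  by (simp add: f_suc lie_derivative_def)

text \<open>On \<open>H\<^sub>a\<close> both sides are zero, and on \<open>Z\<close> they agree by the definition of the next function.\<close>

lemma contact_form_vanishes:
  assumes i: "i \<in> pp_level \<tau> a - {CX}" and q: "q \<in> W" and v: "v \<in> F a q"
  shows "dirder A (f i) q v = f (suc_coord i) q * dirder A x q v"
proof -
  have "i \<in> pp_coords \<tau>" using i pp_level_subset_coords by blast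
  from f_linear[OF this q] have lin: "linear (dirder A (f i) q)" .
  have "dirder A (f i) q (v - dirder A x q v *\<^sub>R Z q) = 0"
    by (rule f_first_integral[OF _ q F_decompose[OF q v]]) (use i in blast)
  then show ?thesis using lin i by (simp add: linear_diff linear_scale f_suc_value mult.commute)
qed

lemma F_subset_contact: "q \<in> W \<Longrightarrow> F a q \<subseteq> contact_bundle A \<tau> f a q"
  unfolding contact_bundle_def using contact_form_vanishes by (auto simp: f_CX)

lemma F_eq_contact:
  assumes q: "q \<in> W" and a: "a \<le> k" and ind: "independent_forms (pp_level \<tau> a) (\<lambda>i. dirder A (f i) q)"
  shows "F a q = contact_bundle A \<tau> f a q"
proof (rule subspace_dim_equal[OF F_subspace contact_bundle_subspace F_subset_contact[OF q]])
  show "linear (dirder A (f i) q)" if "i \<in> pp_coords \<tau>" for i by (rule f_linear[OF that q])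
  have "dim (contact_bundle A \<tau> f a q) + card (pp_level \<tau> a) = Suc DIM('a)"
    by (rule contact_bundle_dim[OF f_linear[OF _ q] ind])
  then show "dim (contact_bundle A \<tau> f a q) \<le> dim (F a q)" using F_dim[OF a, of q] by linarith
qed

text \<open>The step from the level \<open>a\<close> to the derivatives along \<open>Z\<close> of its last functions. If a
  combination \<open>\<Sum> c\<^sub>t df\<^sub>t\<^sub>+\<close> of the new differentials vanishes on \<open>H\<^sub>a\<close>, then by the structure
  equation \<open>\<Sum> c\<^sub>t (df\<^sub>t - f\<^sub>t\<^sub>+ dx)\<close> vanishes on brackets of sections of \<open>V\<^sup>(\<^sup>a\<^sup>)\<close>, hence on \<open>V\<^sup>(\<^sup>a\<^sup>+\<^sup>1\<^sup>)\<close>;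
  but by its rank \<open>V\<^sup>(\<^sup>a\<^sup>+\<^sup>1\<^sup>)\<close> is annihilated by the contact forms of level \<open>a + 1\<close> only.\<close>

lemma independent_prolong:
  assumes a: "a < k" and q: "q \<in> W" and ind: "independent_forms (pp_level \<tau> a) (\<lambda>i. dirder A (f i) q)"
  shows "independent_forms (pp_level \<tau> a \<union> suc_coord ` (pp_level \<tau> a - pp_level \<tau> (Suc a))) (\<lambda>i. dirder A (f i) q)"
proof -
  let ?L = "pp_level \<tau> a" and ?L1 = "pp_level \<tau> (Suc a)"
  let ?T = "?L - ?L1"
  let ?l = "\<lambda>i. dirder A (f i) q"
  let ?\<theta> = "\<lambda>i v. ?l i v - f (suc_coord i) q * ?l CX v"
  have T: "?T \<subseteq> ?L - {CX}" "finite ?T" by auto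
  have coords: "i \<in> pp_coords \<tau>" if "i \<in> ?L" for i using that pp_level_subset_coords by blast
  have scoords: "suc_coord i \<in> pp_coords \<tau>" if "i \<in> ?T" for i
    using that pp_level_antimono[of 0 a \<tau>] suc_coord_level(2) by blast
  have linl: "linear (?l i)" if "i \<in> pp_coords \<tau>" for i by (rule f_linear[OF that q])
  have lin\<theta>: "linear (?\<theta> i)" if "i \<in> ?L" for i
    using linl[OF coords[OF that]] linl[OF CX_in_pp(1)]
    by (intro linearI) (auto simp: linear_add linear_scale algebra_simps)
  have ind\<theta>: "independent_forms (?L - {CX}) ?\<theta>"
    by (rule independent_forms_shear[OF finite_pp_level ind CX_in_pp(2)])
  have L1L: "?L1 \<subseteq> ?L" by (rule pp_level_antimono) simp
  have ind1: "independent_forms ?L1 ?l" by (rule independent_forms_subset[OF ind L1L]) simp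
  have ind\<theta>1: "independent_forms (?L1 - {CX}) ?\<theta>"
    by (rule independent_forms_shear[OF finite_pp_level ind1 CX_in_pp(2)])
  show ?thesis
    unfolding independent_forms_def
  proof (intro allI impI ballI)
    fix c i assume c: "\<forall>v. (\<Sum>i\<in>?L \<union> suc_coord ` ?T. c i * ?l i v) = 0" and i: "i \<in> ?L \<union> suc_coord ` ?T"
    have disj: "?L \<inter> suc_coord ` ?T = {}" using suc_coord_not_level by blast
    \<comment> \<open>\<open>\<alpha>\<close> is the part of the relation made of the new differentials, \<open>\<beta>\<close> the combination of contact
      forms with the same coefficients\<close>
    define \<alpha> where "\<alpha> v = (\<Sum>t\<in>?T. c (suc_coord t) * ?l (suc_coord t) v)" for v
    have split: "(\<Sum>i\<in>?L \<union> suc_coord ` ?T. c i * ?l i v) = (\<Sum>i\<in>?L. c i * ?l i v) + \<alpha> v" for v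
    proof -
      have "inj_on suc_coord ?T" by (auto simp: inj_on_def inj_suc_coord)
      then have "(\<Sum>i\<in>suc_coord ` ?T. c i * ?l i v) = \<alpha> v" unfolding \<alpha>_def by (simp add: sum.reindex)
      then show ?thesis by (subst sum.union_disjoint[OF _ _ disj]) auto
    qed
    have lin\<alpha>: "linear \<alpha>"
      unfolding \<alpha>_def
    proof (rule linear_compose_sum, rule ballI)
      fix t assume "t \<in> ?T"
      from linl[OF scoords[OF this]] show "linear (\<lambda>v. c (suc_coord t) * ?l (suc_coord t) v)"
        by (intro linearI) (auto simp: linear_add linear_scale algebra_simps)
    qed
    have \<alpha>H: "\<alpha> v = 0" if "v \<in> H a q" for v
    proof -
      have "(\<Sum>i\<in>?L. c i * ?l i v) = 0" using f_first_integral[OF _ q that] by (intro sum.neutral) auto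
      then show ?thesis using c split[of v] by simp
    qed
    have \<alpha>F: "\<alpha> v = dirder A x q v * \<alpha> (Z q)" if "v \<in> F a q" for v
      using \<alpha>H[OF F_decompose[OF q that]] by (simp add: linear_diff[OF lin\<alpha>] linear_scale[OF lin\<alpha>])
    define \<beta> where "\<beta> v = (\<Sum>t\<in>?T. c (suc_coord t) * ?\<theta> t v)" for v
    have lin\<beta>: "linear \<beta>"
      unfolding \<beta>_def
    proof (rule linear_compose_sum, rule ballI)
      fix t assume "t \<in> ?T"
      then have "t \<in> ?L" by blast
      note lt = lin\<theta>[OF this]
      show "linear (\<lambda>v. c (suc_coord t) * ?\<theta> t v)"
        using linear_add[OF lt] linear_scale[OF lt] by (intro linearI) (simp_all only: real_scaleR_def distrib_left mult.left_commute)
    qed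
    have \<beta>F: "\<beta> v = 0" if "v \<in> F a q" for v
      unfolding \<beta>_def using contact_form_vanishes[OF _ q that] T(1) by (intro sum.neutral) (auto simp: f_CX)
    have \<beta>br: "\<beta> w = 0" if w: "w \<in> brackets A (F a) q" for w
    proof -
      obtain X Y S where *: "w = lie_bracket A X Y q" "open S" "q \<in> S" "smooth_section A (F a) S X" "smooth_section A (F a) S Y"
        using w unfolding brackets_def by auto
      let ?S = "S \<inter> W"
      have S: "open ?S" "q \<in> ?S" "?S \<subseteq> S" "?S \<subseteq> W" using * W q by auto
      note X = smooth_section_subset[OF *(4) S(3)] and Y = smooth_section_subset[OF *(5) S(3)]
      have XY: "smooth_field A ?S X" "smooth_field A ?S Y" using X Y unfolding smooth_section_def by auto
      have XYF: "X p \<in> F a p" "Y p \<in> F a p" if "p \<in> ?S" for p using X Y that unfolding smooth_section_def by auto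
      have \<theta>w: "?\<theta> t w = ?l (suc_coord t) (X q) * dirder A x q (Y q) - ?l (suc_coord t) (Y q) * dirder A x q (X q)"
        if t: "t \<in> ?T" for t
      proof -
        have tL: "t \<in> ?L - {CX}" using T(1) t by blast
        have sm: "smooth_fun A ?S (f t)" "smooth_fun A ?S (f (suc_coord t))" "smooth_fun A ?S x"
          using f_smooth[OF coords, of t] f_smooth[OF scoords[OF t]] x_smooth_W smooth_fun_subset[OF _ S(4)] tL by auto
        have "dirder A (f t) q (lie_bracket A X Y q) - f (suc_coord t) q * dirder A x q (lie_bracket A X Y q) =
            ?l (suc_coord t) (X q) * dirder A x q (Y q) - ?l (suc_coord t) (Y q) * dirder A x q (X q)"
        proof (rule contact_form_bracket[OF S(1,2) XY sm])
          fix p assume p: "p \<in> ?S"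
          then have pW: "p \<in> W" by blast
          show "dirder A (f t) p (X p) = f (suc_coord t) p * dirder A x p (X p)"
            by (rule contact_form_vanishes[OF tL pW XYF(1)[OF p]])
          show "dirder A (f t) p (Y p) = f (suc_coord t) p * dirder A x p (Y p)"
            by (rule contact_form_vanishes[OF tL pW XYF(2)[OF p]])
        qed
        then show ?thesis unfolding *(1) f_CX .
      qed
      have "\<beta> w = (\<Sum>t\<in>?T. c (suc_coord t) * (?l (suc_coord t) (X q) * dirder A x q (Y q) - ?l (suc_coord t) (Y q) * dirder A x q (X q)))"
        unfolding \<beta>_def by (rule sum.cong[OF refl]) (simp only: \<theta>w)
      also have "\<dots> = \<alpha> (X q) * dirder A x q (Y q) - \<alpha> (Y q) * dirder A x q (X q)"
        unfolding \<alpha>_def by (simp add: sum_distrib_right right_diff_distrib sum_subtractf mult.assoc)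
      also have "\<dots> = 0" using \<alpha>F[OF XYF(1)[OF S(2)]] \<alpha>F[OF XYF(2)[OF S(2)]] by simp
      finally show ?thesis .
    qed
    have \<beta>F1: "\<beta> v = 0" if v: "v \<in> F (Suc a) q" for v
    proof -
      have "subspace {v. \<beta> v = 0}" using lin\<beta> by (auto simp: subspace_def linear_0 linear_add linear_scale)
      then have "F (Suc a) q \<subseteq> {v. \<beta> v = 0}"
        unfolding F_Suc using \<beta>F \<beta>br by (intro span_minimal) auto
      then show ?thesis using v by blast
    qed
    have F1: "F (Suc a) q = contact_bundle A \<tau> f (Suc a) q"
      by (rule F_eq_contact[OF q _ ind1]) (use a in simp)
    have "\<exists>d. \<forall>v. \<beta> v = (\<Sum>i\<in>?L1 - {CX}. d i * ?\<theta> i v)"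
    proof (rule form_in_span[of "?L1 - {CX}" ?\<theta> \<beta>])
      show "linear (?\<theta> i)" if "i \<in> ?L1 - {CX}" for i using that L1L by (intro lin\<theta>) blast
      show "\<beta> v = 0" if v: "\<And>i. i \<in> ?L1 - {CX} \<Longrightarrow> ?\<theta> i v = 0" for v
      proof (rule \<beta>F1)
        show "v \<in> F (Suc a) q" unfolding F1 contact_bundle_def using v by blast
      qed
      fix d assume "\<And>v. \<beta> v = (\<Sum>i\<in>?L1 - {CX}. d i * ?\<theta> i v)"
      then show "\<exists>d. \<forall>v. \<beta> v = (\<Sum>i\<in>?L1 - {CX}. d i * ?\<theta> i v)" by blast
    qed (simp_all add: lin\<beta> ind\<theta>1)
    then obtain d where d: "\<And>v. \<beta> v = (\<Sum>i\<in>?L1 - {CX}. d i * ?\<theta> i v)" by blast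
    let ?b = "\<lambda>i. if i \<in> ?T then c (suc_coord i) else - d i"
    have "(\<Sum>i\<in>?L - {CX}. ?b i * ?\<theta> i v) = 0" for v
    proof -
      have eq: "?L - {CX} = ?T \<union> (?L1 - {CX})" using L1L by auto
      have "(\<Sum>i\<in>?L - {CX}. ?b i * ?\<theta> i v) = (\<Sum>i\<in>?T. ?b i * ?\<theta> i v) + (\<Sum>i\<in>?L1 - {CX}. ?b i * ?\<theta> i v)"
        unfolding eq by (rule sum.union_disjoint) auto
      also have "(\<Sum>i\<in>?T. ?b i * ?\<theta> i v) = \<beta> v" unfolding \<beta>_def by (rule sum.cong) auto
      also have "(\<Sum>i\<in>?L1 - {CX}. ?b i * ?\<theta> i v) = - (\<Sum>i\<in>?L1 - {CX}. d i * ?\<theta> i v)"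
        unfolding sum_negf[symmetric] by (rule sum.cong) auto
      finally show ?thesis using d[of v] by simp
    qed
    note b0 = independent_formsD[of "?L - {CX}" ?\<theta> ?b, OF ind\<theta> this]
    have cT: "c (suc_coord t) = 0" if "t \<in> ?T" for t using b0[of t] T(1) that by auto
    then have "\<alpha> v = 0" for v unfolding \<alpha>_def by (intro sum.neutral) auto
    then have "(\<Sum>i\<in>?L. c i * ?l i v) = 0" for v using c split[of v] by simp
    note cL = independent_formsD[of ?L ?l c, OF ind this]
    show "c i = 0" using i cT cL by blast
  qed
qed

text \<open>A Cauchy field \<open>X\<close> of \<open>V\<^sup>(\<^sup>a\<^sup>)\<close> is a section of \<open>H\<^sub>a\<close>, and so is \<open>[X, Z]\<close>; hence \<open>X (Z f) = 0\<close> for the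
  functions \<open>f\<close> of level \<open>a\<close>.\<close>

lemma f_first_integral_char:
  assumes a: "a < k" and q: "q \<in> W" and v: "v \<in> char_bundle A V a q"
    and i: "i \<in> pp_level \<tau> a \<union> suc_coord ` (pp_level \<tau> a - pp_level \<tau> (Suc a))"
  shows "dirder A (f i) q v = 0"
proof -
  obtain X S where X: "v = X q" "open S" "q \<in> S" "cauchy_field A (F a) S X"
    using v unfolding char_bundle_def cauchy_bundle_iff by blast
  let ?S = "S \<inter> W"
  have S: "open ?S" "q \<in> ?S" "?S \<subseteq> S" "?S \<subseteq> W" using X W q by auto
  have XF: "smooth_section A (F a) S X" using X(4) unfolding cauchy_field_def by blast
  have Xx: "dirder A x p (X p) = 0" if "p \<in> ?S" for p
  proof (rule x_first_integral_char[OF a])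
    show "X p \<in> char_bundle A V a p"
      unfolding char_bundle_def cauchy_bundle_iff using X(2,4) that by blast
    show "p \<in> U" using that W(2) by blast
  qed
  have XH: "H_section a ?S X"
    unfolding H_section_def smooth_section_def H_def
    using S(1,4) Xx smooth_section_subset[OF XF S(3)] unfolding smooth_section_def by blast
  note X' = H_sectionD[OF XH]
  show ?thesis
  proof (cases "i \<in> pp_level \<tau> a")
    case True
    then show ?thesis using f_first_integral[OF _ q] X'(5)[OF S(2)] X(1) by blast
  next
    case False
    then obtain t where t: "t \<in> pp_level \<tau> a - pp_level \<tau> (Suc a)" "i = suc_coord t" using i by blast
    then have tX: "t \<noteq> CX" by auto
    have tc: "t \<in> pp_coords \<tau>" using t pp_level_subset_coords by blast
    have "lie_bracket A X Z q \<in> F a q"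
      using X(4) smooth_section_subset[OF Z_section S(4)] S unfolding cauchy_field_def by blast
    moreover have "dirder A x q (lie_bracket A X Z q) = 0"
      using bracket_Z[OF XH S(2)] by (simp add: H_def)
    ultimately have "lie_bracket A X Z q \<in> H a q" by (simp add: H_def)
    then have "dirder A (f t) q (lie_bracket A X Z q) = 0" using f_first_integral[OF _ q] t(1) by blast
    moreover have "dirder A (f t) q (lie_bracket A X Z q) = lie_derivative A X (lie_derivative A Z (f t)) q - lie_derivative A Z (lie_derivative A X (f t)) q"
      by (rule dirder_lie_bracket[OF S(1,2) X'(3) smooth_field_subset[OF Z_smooth S(4)] smooth_fun_subset[OF f_smooth[OF tc] S(4)]])
    moreover have "lie_derivative A Z (lie_derivative A X (f t)) q = 0"
    proof (rule lie_derivative_locally_constant[OF S(1,2)])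
      fix p assume "p \<in> ?S"
      then show "lie_derivative A X (f t) p = 0"
        unfolding lie_derivative_def using X'(5) t(1) by (intro f_first_integral) auto
    qed
    ultimately show ?thesis using f_suc[OF tX] t(2) X(1) by (simp add: lie_derivative_def)
  qed
qed

text \<open>The differentials that are already present annihilate \<open>Char V\<^sup>(\<^sup>a\<^sup>)\<close>, while those of the fundamental
  functions of order \<open>a\<close> are independent modulo the annihilator.\<close>

lemma independent_fundamental:
  assumes a: "1 \<le> a" "a < k" and q: "q \<in> W"
    and ind: "independent_forms (pp_level \<tau> a \<union> suc_coord ` (pp_level \<tau> a - pp_level \<tau> (Suc a))) (\<lambda>i. dirder A (f i) q)"
  shows "independent_forms (pp_level \<tau> (a - 1)) (\<lambda>i. dirder A (f i) q)"
  unfolding independent_forms_def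
proof (intro allI impI ballI)
  let ?J = "pp_level \<tau> a \<union> suc_coord ` (pp_level \<tau> a - pp_level \<tau> (Suc a))"
  let ?R = "(\<lambda>l. CZ l a 0) ` {1..rho \<tau> a}" and ?l = "\<lambda>i. dirder A (f i) q"
  fix c i assume c: "\<forall>v. (\<Sum>i\<in>pp_level \<tau> (a - 1). c i * ?l i v) = 0" and i: "i \<in> pp_level \<tau> (a - 1)"
  have dec: "pp_level \<tau> (a - 1) = ?J \<union> ?R" by (rule pp_level_decompose) (use a length_\<tau> in auto)
  have disj: "?J \<inter> ?R = {}"
  proof -
    have "suc_coord t \<noteq> CZ l a 0" for t l by (cases t) auto
    moreover have "CZ l a 0 \<notin> pp_level \<tau> a" for l by (simp add: CZ_in_pp_level)
    ultimately show ?thesis by blast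
  qed
  have split: "(\<Sum>i\<in>pp_level \<tau> (a - 1). c i * ?l i v) =
      (\<Sum>i\<in>?J. c i * ?l i v) + (\<Sum>l=1..rho \<tau> a. c (CZ l a 0) * dirder A (\<phi> l a) q v)" for v
  proof -
    have "inj_on (\<lambda>l. CZ l a 0) {1..rho \<tau> a}" by (auto simp: inj_on_def)
    then have "(\<Sum>i\<in>?R. c i * ?l i v) = (\<Sum>l=1..rho \<tau> a. c (CZ l a 0) * dirder A (\<phi> l a) q v)"
      by (simp add: sum.reindex f_0)
    then show ?thesis unfolding dec by (subst sum.union_disjoint[OF _ _ disj]) auto
  qed
  have cR: "c (CZ l a 0) = 0" if l: "l \<in> {1..rho \<tau> a}" for l
  proof (rule \<phi>_fundamental[OF a q _ l])
    fix v assume v: "v \<in> char_bundle A V a q"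
    have "(\<Sum>i\<in>?J. c i * ?l i v) = 0" using f_first_integral_char[OF a(2) q v] by (intro sum.neutral) auto
    then show "(\<Sum>l=1..rho \<tau> a. c (CZ l a 0) * dirder A (\<phi> l a) q v) = 0" using c split[of v] by simp
  qed
  then have "(\<Sum>l=1..rho \<tau> a. c (CZ l a 0) * dirder A (\<phi> l a) q v) = 0" for v by (intro sum.neutral) auto
  then have "(\<Sum>i\<in>?J. c i * ?l i v) = 0" for v using c split[of v] by simp
  note cJ = independent_formsD[of ?J ?l c, OF ind this]
  show "c i = 0" using i cJ cR unfolding dec by blast
qed

lemma pp_level_top: "pp_level \<tau> (k - 1) = {CX, CZ 1 k 0}"
proof (intro equalityI subsetI)
  fix i assume i: "i \<in> pp_level \<tau> (k - 1)"
  show "i \<in> {CX, CZ 1 k 0}"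
  proof (cases i)
    case (CZ l j s)
    then have *: "j \<le> k" "1 \<le> l" "l \<le> rho \<tau> j" "s + (k - 1) < j" using i by (auto simp: CZ_in_pp_level length_\<tau>)
    then have "j = k" "s = 0" by linarith+
    then show ?thesis using * CZ rk by simp
  qed simp
next
  fix i assume "i \<in> {CX, CZ 1 k 0}"
  then show "i \<in> pp_level \<tau> (k - 1)" using rk k2 by (auto simp: CZ_in_pp_level length_\<tau>)
qed

lemma independent_top:
  assumes q: "q \<in> W"
  shows "independent_forms (pp_level \<tau> (k - 1)) (\<lambda>i. dirder A (f i) q)"
  unfolding independent_forms_def pp_level_top
proof (intro allI impI)
  have \<phi>: "smooth_fun A W (\<phi> 1 k)" using \<phi>_smooth[of k 1] k2 rk by simp
  fix c assume "\<forall>v. (\<Sum>i\<in>{CX, CZ 1 k 0}. c i * dirder A (f i) q v) = 0"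
  then have c: "c CX * dirder A x q v + c (CZ 1 k 0) * dirder A (\<phi> 1 k) q v = 0" for v
    by (simp add: f_CX f_0)
  obtain u v where uv: "dirder A x q u * dirder A (\<phi> 1 k) q v - dirder A x q v * dirder A (\<phi> 1 k) q u \<noteq> 0"
    using \<phi>_top[OF q] unfolding wedge_nonzero_def differential_apply[OF x_smooth_W q] differential_apply[OF \<phi> q]
    by blast
  have "c CX * (dirder A x q u * dirder A (\<phi> 1 k) q v - dirder A x q v * dirder A (\<phi> 1 k) q u) =
      (c CX * dirder A x q u + c (CZ 1 k 0) * dirder A (\<phi> 1 k) q u) * dirder A (\<phi> 1 k) q v
      - (c CX * dirder A x q v + c (CZ 1 k 0) * dirder A (\<phi> 1 k) q v) * dirder A (\<phi> 1 k) q u"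
    by (simp add: algebra_simps)
  also have "\<dots> = 0" unfolding c by simp
  finally have c0: "c CX = 0" using uv by simp
  have "c (CZ 1 k 0) = 0"
  proof (rule ccontr)
    assume "c (CZ 1 k 0) \<noteq> 0"
    then have "dirder A (\<phi> 1 k) q w = 0" for w using c[of w] c0 by simp
    then show False using uv by simp
  qed
  with c0 show "\<forall>i\<in>{CX, CZ 1 k 0}. c i = 0" by simp
qed

lemma independent_level:
  assumes q: "q \<in> W" and a: "a < k"
  shows "independent_forms (pp_level \<tau> a) (\<lambda>i. dirder A (f i) q)"
proof -
  have "a \<le> k - 1" using a by simp
  then show ?thesis
  proof (induction rule: inc_induct)
    case base show ?case by (rule independent_top[OF q])
  next
    case (step b)
    have b: "Suc b < k" using step.hyps by simp
    show ?case
      using independent_fundamental[OF _ b q independent_prolong[OF b q step.IH]] by simp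
  qed
qed

lemma independent_coords:
  assumes q: "q \<in> W"
  shows "independent_forms (pp_coords \<tau>) (\<lambda>i. dirder A (f i) q)"
  unfolding pp_coords_decompose
  by (rule independent_prolong[OF _ q independent_level[OF q]]) (use k2 in auto)

lemma V_eq_partial_prolongation:
  assumes q: "q \<in> W"
  shows "V q = partial_prolongation A \<tau> f q"
proof -
  have "partial_prolongation A \<tau> f q = contact_bundle A \<tau> f 0 q"
    by (rule partial_prolongation_eq_contact_bundle[OF f_linear[OF _ q] independent_coords[OF q] card_pp_coords])
  moreover have "F 0 q = contact_bundle A \<tau> f 0 q"
    by (rule F_eq_contact[OF q _ independent_level[OF q]]) (use k2 in auto)
  ultimately show ?thesis by simp
qed

text \<open>The functions \<open>f\<^sub>i\<close> are the components of a map into the model space whose derivative is invertible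
  because the \<open>df\<^sub>i\<close> are independent and as many as the dimension.\<close>

lemma contact_coordinates: "contact_coordinates A V \<tau> W f"
  unfolding contact_coordinates_def
proof
  fix p assume p: "p \<in> W"
  let ?I = "pp_coords \<tau>"
  obtain e where e: "bij_betw e ?I (Basis :: 'a set)"
    using finite_same_card_bij[OF finite_pp_coords finite_Basis] card_pp_coords by metis
  define \<psi> where "\<psi> q = (\<Sum>i\<in>?I. f i q *\<^sub>R e i)" for q
  have \<psi>: "smooth_fun A W \<psi>"
    unfolding \<psi>_def by (intro smooth_fun_sum smooth_fun_scaleR f_smooth smooth_fun_const W)
  interpret pp_model \<tau> e by (rule pp_model.intro) (rule e)
  have D\<psi>: "dirder A (f j) q v = dirder A \<psi> q v \<bullet> e j" if q: "q \<in> W" and j: "j \<in> ?I" for q j v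
  proof -
    have "dirder A (\<lambda>q. \<psi> q \<bullet> e j) q v = dirder A \<psi> q v \<bullet> e j"
      by (rule dirder_linear_comp[OF \<psi> q bounded_linear_inner_left])
    moreover have "(\<lambda>q. \<psi> q \<bullet> e j) = f j"
      unfolding \<psi>_def using inner_sum_e[of ?I j] j by (simp add: fun_eq_iff)
    ultimately show ?thesis by simp
  qed
  have inj: "inj (dirder A \<psi> q)" if q: "q \<in> W" for q
  proof (rule injI)
    fix v w assume "dirder A \<psi> q v = dirder A \<psi> q w"
    then have eq: "dirder A (f i) q v = dirder A (f i) q w" if "i \<in> ?I" for i using D\<psi>[OF q that] by simp
    show "v = w"
      by (rule forms_separate[of ?I "\<lambda>i. dirder A (f i) q", OF finite_pp_coords f_linear[OF _ q] independent_coords[OF q] card_pp_coords eq])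
  qed
  obtain W1 where W1: "open W1" "p \<in> W1" "W1 \<subseteq> W" "is_chart A W1 \<psi>"
    by (rule is_chart_near[OF W(1) \<psi> inj p], assumption, rule that)
  have "local_coordinates A W1 ?I f"
    unfolding local_coordinates_def using e W1(4) unfolding \<psi>_def by blast
  then show "\<exists>W'. open W' \<and> p \<in> W' \<and> W' \<subseteq> W \<and> local_coordinates A W' ?I f \<and>
      (\<forall>q\<in>W'. V q = partial_prolongation A \<tau> f q)"
    using W1 V_eq_partial_prolongation by blast
qed

end

section \<open>Contact coordinates of a Goursat bundle\<close>

lemma annihilator_subspace: "subspace (annihilator E q)"
  unfolding annihilator_def
  by (rule subspaceI) (auto simp: blinfun.zero_left blinfun.add_left blinfun.scaleR_left)

text \<open>The forms \<open>\<omega>\<^sub>m\<close> and the matrix of the definition disappear: each \<open>d\<phi>\<^sup>l\<close> lies in the sum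
  \<open>\<Xi> \<oplus> \<Omega>\<close>, and the invertibility of the matrix makes them independent modulo \<open>\<Xi>\<close>.\<close>

lemma (in smooth_mfd) fundamental_functionsD:
  assumes ff: "fundamental_functions A V j r U \<phi>" and q: "q \<in> U"
  shows "\<And>l. l \<in> {1..r} \<Longrightarrow> smooth_fun A U (\<phi> l)"
    and "\<And>l v. l \<in> {1..r} \<Longrightarrow> v \<in> char_bundle_int A V j q \<Longrightarrow> dirder A (\<phi> l) q v = 0"
    and "\<And>c l. (\<And>v. v \<in> char_bundle A V j q \<Longrightarrow> (\<Sum>l=1..r. c l * dirder A (\<phi> l) q v) = 0) \<Longrightarrow>
      l \<in> {1..r} \<Longrightarrow> c l = 0"
proof -
  let ?\<Xi> = "annihilator (char_bundle A V j) q" and ?\<Xi>' = "annihilator (char_bundle_int A V j) q"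
  note ff' = ff[unfolded fundamental_functions_def Let_def]
  show sm: "smooth_fun A U (\<phi> l)" if "l \<in> {1..r}" for l
    by (rule bspec[OF conjunct1[OF ff'] that])
  obtain \<omega> M where \<omega>M: "\<forall>p\<in>U. annihilator (char_bundle_int A V j) p =
        {\<alpha> + \<beta> | \<alpha> \<beta>. \<alpha> \<in> annihilator (char_bundle A V j) p \<and> \<beta> \<in> span ((\<lambda>l. \<omega> l p) ` {1..r})} \<and>
        annihilator (char_bundle A V j) p \<inter> span ((\<lambda>l. \<omega> l p) ` {1..r}) = {0} \<and> dim (span ((\<lambda>l. \<omega> l p) ` {1..r})) = r"
    "\<forall>p\<in>U. M p \<in> carrier_mat r r \<and> Determinant.det (M p :: real mat) \<noteq> 0 \<and>
        (\<forall>l\<in>{1..r}. differential A (\<phi> l) p - (\<Sum>m=1..r. (M p $$ (l - 1, m - 1)) *\<^sub>R \<omega> m p) \<in> annihilator (char_bundle A V j) p)"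
    using conjunct2[OF ff'] by (elim exE conjE) (rule that, assumption+)
  let ?w = "\<lambda>l. \<omega> l q"
  let ?\<Omega> = "span (?w ` {1..r})"
  note h1 = bspec[OF \<omega>M(1) q] and h2 = bspec[OF \<omega>M(2) q]
  have \<Xi>': "?\<Xi>' = {\<alpha> + \<beta> | \<alpha> \<beta>. \<alpha> \<in> ?\<Xi> \<and> \<beta> \<in> ?\<Omega>}" and disj: "?\<Xi> \<inter> ?\<Omega> = {0}" and dim: "dim ?\<Omega> = r"
    by (rule conjunct1[OF h1], rule conjunct1[OF conjunct2[OF h1]], rule conjunct2[OF conjunct2[OF h1]])
  have M: "M q \<in> carrier_mat r r" "Determinant.det (M q) \<noteq> 0"
    and eq: "\<And>l. l \<in> {1..r} \<Longrightarrow> differential A (\<phi> l) q - (\<Sum>m=1..r. (M q $$ (l - 1, m - 1)) *\<^sub>R ?w m) \<in> ?\<Xi>"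
    by (rule conjunct1[OF h2], rule conjunct1[OF conjunct2[OF h2]], rule bspec[OF conjunct2[OF conjunct2[OF h2]]])
  show "dirder A (\<phi> l) q v = 0" if l: "l \<in> {1..r}" and v: "v \<in> char_bundle_int A V j q" for l v
  proof -
    let ?s = "\<Sum>m=1..r. (M q $$ (l - 1, m - 1)) *\<^sub>R ?w m"
    have "?s \<in> ?\<Omega>" by (intro span_sum span_scale span_base) auto
    then have "(differential A (\<phi> l) q - ?s) + ?s \<in> ?\<Xi>'" unfolding \<Xi>' using eq[OF l] by blast
    then have "blinfun_apply (differential A (\<phi> l) q) v = 0" using v unfolding annihilator_def by simp
    then show ?thesis using differential_apply[OF sm[OF l] q] by simp
  qed
  show "c l = 0" if c: "\<And>v. v \<in> char_bundle A V j q \<Longrightarrow> (\<Sum>l=1..r. c l * dirder A (\<phi> l) q v) = 0"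
    and l: "l \<in> {1..r}" for c l
  proof (rule independent_modulo[OF annihilator_subspace dim disj M eq _ l])
    have "blinfun_apply (\<Sum>l=1..r. c l *\<^sub>R differential A (\<phi> l) q) v = (\<Sum>l=1..r. c l * dirder A (\<phi> l) q v)" for v
      unfolding blinfun.sum_left
      by (rule sum.cong[OF refl]) (simp add: blinfun.scaleR_left differential_apply[OF sm q])
    then show "(\<Sum>l=1..r. c l *\<^sub>R differential A (\<phi> l) q) \<in> ?\<Xi>" using c unfolding annihilator_def by simp
  qed
qed

theorem theorem4p3:
  fixes A :: "('m::{t2_space,second_countable_topology}, 'a::euclidean_space) chart set"
    and V :: "'m \<Rightarrow> 'a set"
    and P :: "'m \<Rightarrow> 'a set"
    and \<tau> :: "nat list"
    and k :: nat
    and x :: "'m \<Rightarrow> real"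
    and \<phi> :: "nat \<Rightarrow> nat \<Rightarrow> 'm \<Rightarrow> real"
    and U :: "'m set"
  assumes "smooth_manifold A"
    and "goursat_bundle A V \<tau>"
    and "k = derived_length A V" and "k \<ge> 2" and "rho \<tau> k = 1"
    and "open U"
    and "first_integral A U (char_bundle A V (k - 1)) x"
    and "\<forall>p\<in>U. differential A x p \<noteq> 0"
    and "is_Pi_bundle A V k x U P"
    and "smooth_fun A U (\<phi> 1 k)"
    and "first_integral A (transversal_locus A V x U) P (\<phi> 1 k)"
    and "\<forall>p\<in>U. wedge_nonzero (differential A x p) (differential A (\<phi> 1 k) p)"
    and "\<forall>j\<in>{1..k-1}. rho \<tau> j > 0 \<longrightarrow>
           fundamental_functions A V j (rho \<tau> j) U (\<lambda>l. \<phi> l j)"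
  shows "\<exists>U' Z. open U' \<and> U' \<subseteq> U \<and> U \<subseteq> closure U' \<and> unit_section A V x U' Z \<and>
           contact_coordinates A V \<tau> U' (prolonged_functions A Z x \<phi>)"
proof -
  interpret goursat_integral A V \<tau> k x U
    by unfold_locales (rule assms(1), rule assms(2), rule assms(3), rule assms(4), rule assms(5), rule assms(6), rule assms(7))
  have dx: "differential A x q \<noteq> 0" if "q \<in> U" for q using assms(8) that by blast
  obtain U' Z where U': "open U'" "U' \<subseteq> U" "U \<subseteq> closure U'" "unit_section A V x U' Z"
    by (rule dense_unit_section[OF dx], assumption, rule that)
  interpret goursat_section A V \<tau> k x U U' Z
    by unfold_locales (rule U')+
  have top: "dirder A (\<phi> 1 k) q v = 0" if q: "q \<in> U'" and v: "v \<in> H (k - 1) q" for q v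
  proof -
    have qU: "q \<in> U" using q U'(2) by blast
    have qT: "q \<in> transversal_locus A V x U"
      unfolding transversal_locus_def using q U' by blast
    obtain W1 Z1 where W1: "open W1" "q \<in> W1" "W1 \<subseteq> U" "unit_section A V x W1 Z1"
      "\<forall>p\<in>W1. P p = pi_iter A V Z1 (k - 1) p"
      using bspec[OF assms(9)[unfolded is_Pi_bundle_def] qT] by (elim exE conjE) (rule that)
    interpret near: goursat_section A V \<tau> k x U W1 Z1
      by unfold_locales (rule W1)+
    have "v \<in> P q" using near.H_in_pi_iter[of "k - 1" q] v W1(2,5) k2 by auto
    then have "blinfun_apply (differential A (\<phi> 1 k) q) v = 0"
      using assms(11) qT unfolding first_integral_def annihilator_def by blast
    then show ?thesis using differential_apply[OF assms(10) qU] by simp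
  qed
  have ff: "fundamental_functions A V j (rho \<tau> j) U (\<lambda>l. \<phi> l j)" if "1 \<le> j" "j < k" "l \<in> {1..rho \<tau> j}" for j l
    using assms(13) that by auto
  interpret goursat_functions A V \<tau> k x U U' Z \<phi>
  proof unfold_locales
    fix l j assume j: "1 \<le> j" "j \<le> k" and l: "1 \<le> l" "l \<le> rho \<tau> j"
    show "smooth_fun A U' (\<phi> l j)"
    proof (cases "U' = {}")
      case True
      then show ?thesis by (intro smooth_fun_local) blast
    next
      case False
      then obtain q where q: "q \<in> U" using U'(2) by blast
      have "smooth_fun A U (\<phi> l j)"
      proof (cases "j = k")
        case True then show ?thesis using assms(10) l rk by simp
      next
        case False
        then show ?thesis using fundamental_functionsD(1)[OF ff q, of j l l] j l by simp
      qed
      then show ?thesis by (rule smooth_fun_subset[OF _ U'(2)])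
    qed
    fix q v assume q: "q \<in> U'" and v: "v \<in> H (j - 1) q"
    have qU: "q \<in> U" using q U'(2) by blast
    show "dirder A (\<phi> l j) q v = 0"
    proof (cases "j = k")
      case True then show ?thesis using top[OF q] v l rk by simp
    next
      case False
      then have jk: "j < k" using j by simp
      have lr: "l \<in> {1..rho \<tau> j}" using l by simp
      have "v \<in> char_bundle_int A V j q" using v char_int_eq_H[OF j(1) jk q] by simp
      then show ?thesis by (rule fundamental_functionsD(2)[OF ff[OF j(1) jk lr] qU lr])
    qed
  next
    fix q assume "q \<in> U'"
    then show "wedge_nonzero (differential A x q) (differential A (\<phi> 1 k) q)" using assms(12) U'(2) by blast
  next
    fix j q c l assume j: "1 \<le> j" "j < k" and q: "q \<in> U'" and l: "l \<in> {1..rho \<tau> j}"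
      and c: "\<And>v. v \<in> char_bundle A V j q \<Longrightarrow> (\<Sum>l=1..rho \<tau> j. c l * dirder A (\<phi> l j) q v) = 0"
    have qU: "q \<in> U" using q U'(2) by blast
    show "c l = 0" by (rule fundamental_functionsD(3)[OF ff[OF j l] qU c l])
  qed
  show ?thesis using U' contact_coordinates by blast
qed

end
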